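(* Let $\gamma\in\mathbb{R}$ and $\mu>0$, and let $\mathcal{A}_\mu$, $\mu_l^0(\gamma)$, $\mu_r^0(\gamma)$, $E_\mu^{(1)}$, $E_\mu^{(2)}$ be as defined in the context. (A) Suppose that either $\gamma\ge12$ and $\mu>0$ is arbitrary, or $\gamma<12$ and $\mu\ne\mu_r^0(\gamma)$. Then the part of the discrete spectrum of $\mathcal{A}_\mu$ lying to the right of $E_\mu^{(2)}$ is finite. (B) Suppose that either $\gamma\le0$ and $\mu>0$ is arbitrary, or $\gamma>0$ and $\mu\ne\mu_l^0(\gamma)$. Then the part of the discrete spectrum of $\mathcal{A}_\mu$ lying to the left of $E_\mu^{(1)}$ is finite.
   Context: $\mathbb{T}^3$ is the three-dimensional torus, i.e. the cube $(-\pi,\pi]^3$ with appropriately identified sides, equipped with its Haar measure (Lebesgue measure $dt$ on the cube); addition and multiplication by real numbers are regarded as operations on $\mathbb{R}^3$ modulo $(2\pi\mathbb{Z})^3$, and $\tfrac12(k+p)$ is computed from the representatives of $k,p$ in $(-\pi,\pi]^3$. Write $\overline{0}=(0,0,0)$. Let $\mathcal{H}_0=\mathbb{C}$, $\mathcal{H}_1=L_2(\mathbb{T}^3)$, $\mathcal{H}_2=L_2^{\rm s}((\mathbb{T}^3)^2)$ (square integrable complex functions symmetric in their two variables), $\mathcal{H}=\mathcal{H}_1\oplus\mathcal{H}_2$. Put $$\varepsilon(k)=\sum_{i=1}^3(1-\cos k_i),\quad w_1(k)=\varepsilon(k)+\gamma,\quad w_2(k,p)=\varepsilon(k)+\varepsilon\big(\tfrac12(k+p)\big)+\varepsilon(p).$$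 For $\mu>0$, $\mathcal{A}_\mu$ is the bounded self-adjoint operator in $\mathcal{H}$ $$\mathcal{A}_\mu=\begin{pmatrix}A_{11}&\mu A_{12}\\ \mu A_{12}^*&A_{22}\end{pmatrix},\quad (A_{11}f_1)(k)=w_1(k)f_1(k),\quad (A_{12}f_2)(k)=\int_{\mathbb{T}^3}f_2(k,t)\,dt,\quad (A_{22}f_2)(k,p)=w_2(k,p)f_2(k,p),$$ with $(A_{12}^*f_1)(k,p)=\frac12(f_1(k)+f_1(p))$. For $k\in\mathbb{T}^3$, $\mathcal{A}_\mu(k)$ is the bounded self-adjoint operator in $\mathcal{H}_0\oplus\mathcal{H}_1$ $$\mathcal{A}_\mu(k)=\begin{pmatrix}A_{00}(k)&\mu A_{01}\\ \mu A_{01}^*&A_{11}(k)\end{pmatrix},\quad A_{00}(k)f_0=w_1(k)f_0,\quad A_{01}f_1=\frac1{\sqrt2}\int_{\mathbb{T}^3}f_1(t)\,dt,\quad (A_{11}(k)f_1)(p)=w_2(k,p)f_1(p).$$ $\sigma_{\rm ess}$ and $\sigma_{\rm disc}$ denote the essential and discrete spectrum. Set $\Lambda_\mu=\bigcup_{k\in\mathbb{T}^3}\sigma_{\rm disc}(\mathcal{A}_\mu(k))$. Let $I(\overline0,0)=\int_{\mathbb{T}^3}\frac{dt}{w_2(\overline0,t)}$ (which is finite), and $$\mu_l^0(\gamma)=\sqrt{2\gamma}\;I(\overline0,0)^{-1/2}\ (\gamma>0),\qquad \mu_r^0(\gamma)=\sqrt{24-2\gamma}\;I(\overline0,0)^{-1/2}\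 (\gamma<12).$$ Set $E_\mu^{(1)}=\min\{\Lambda_\mu\cap(-\infty,0]\}$ if $\gamma\le0$, or if $\gamma>0$ and $\mu>\mu_l^0(\gamma)$; and $E_\mu^{(1)}=0$ if $\gamma>0$ and $\mu\le\mu_l^0(\gamma)$. Set $E_\mu^{(2)}=\max\{\Lambda_\mu\cap[18,\infty)\}$ if $\gamma\ge12$, or if $\gamma<12$ and $\mu>\mu_r^0(\gamma)$; and $E_\mu^{(2)}=18$ if $\gamma<12$ and $\mu\le\mu_r^0(\gamma)$.
   Formalization: Part (A) is asserted only when the maximum defining E_μ^(2) exists; for γ<12 and μ slightly above μ_r^0(γ), Λ_μ∩[18,∞) is empty with the stated convention for ½(k+p), so E_μ^(2) is undefined and nothing is claimed. *)

theory Defs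
  imports "HOL-Analysis.Analysis" "HOL-Library.Function_Algebras"
begin

section \<open>Complex vector spaces of functions\<close>

class complex_vector = ab_group_add +
  fixes scaleC :: "complex \<Rightarrow> 'a \<Rightarrow> 'a"  (infixr "*\<^sub>C" 75)
  assumes scaleC_add_right: "a *\<^sub>C (x + y) = a *\<^sub>C x + a *\<^sub>C y"
    and scaleC_add_left: "(a + b) *\<^sub>C x = a *\<^sub>C x + b *\<^sub>C x"
    and scaleC_scaleC: "a *\<^sub>C b *\<^sub>C x = (a * b) *\<^sub>C x"
    and scaleC_one: "1 *\<^sub>C x = x"

instantiation complex :: complex_vector
begin
definition scaleC_complex_def: "a *\<^sub>C (x::complex) = a * x"
instance by standard (auto simp: scaleC_complex_def algebra_simps)
end

instantiation "fun" :: (type, complex_vector) complex_vector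
begin
definition scaleC_fun_def: "a *\<^sub>C f = (\<lambda>x. a *\<^sub>C f x)"
instance
  by standard
    (auto simp: scaleC_fun_def fun_eq_iff scaleC_add_right scaleC_add_left scaleC_scaleC scaleC_one)
end

instantiation prod :: (complex_vector, complex_vector) complex_vector
begin
definition scaleC_prod_def: "a *\<^sub>C x = (a *\<^sub>C fst x, a *\<^sub>C snd x)"
instance
  by standard
    (auto simp: scaleC_prod_def prod_eq_iff scaleC_add_right scaleC_add_left scaleC_scaleC scaleC_one)
end

section \<open>Spectrum and discrete spectrum\<close>

text \<open>A Hilbert space is presented by a complex subspace \<open>V\<close> with a seminorm \<open>N\<close>; its elements
  are the vectors of \<open>V\<close> up to \<open>N (x - y) = 0\<close> (for \<open>L\<^sub>2\<close>: up to equality almost everywhere).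
  All notions below concern these classes. An operator is given on representatives.\<close>

text \<open>\<open>z\<close> is a regular point iff \<open>A - z\<close> is a bijection with bounded inverse: the lower bound
  says that \<open>A - z\<close> is injective with bounded inverse on its range.\<close>

definition regular_point ::
    "'h::complex_vector set \<Rightarrow> ('h \<Rightarrow> real) \<Rightarrow> ('h \<Rightarrow> 'h) \<Rightarrow> complex \<Rightarrow> bool" where
  "regular_point V N A z \<longleftrightarrow>
     (\<forall>y\<in>V. \<exists>x\<in>V. N (A x - z *\<^sub>C x - y) = 0) \<and>
     (\<exists>c. \<forall>x\<in>V. N x \<le> c * N (A x - z *\<^sub>C x))"

definition op_spectrum ::
    "'h::complex_vector set \<Rightarrow> ('h \<Rightarrow> real) \<Rightarrow> ('h \<Rightarrow> 'h) \<Rightarrow> complex set" where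
  "op_spectrum V N A = {z. \<not> regular_point V N A z}"

definition eigenspace ::
    "'h::complex_vector set \<Rightarrow> ('h \<Rightarrow> real) \<Rightarrow> ('h \<Rightarrow> 'h) \<Rightarrow> complex \<Rightarrow> 'h set" where
  "eigenspace V N A z = {x \<in> V. N (A x - z *\<^sub>C x) = 0}"

definition eigenvalue ::
    "'h::complex_vector set \<Rightarrow> ('h \<Rightarrow> real) \<Rightarrow> ('h \<Rightarrow> 'h) \<Rightarrow> complex \<Rightarrow> bool" where
  "eigenvalue V N A z \<longleftrightarrow> (\<exists>x\<in>eigenspace V N A z. N x \<noteq> 0)"

definition finite_multiplicity ::
    "'h::complex_vector set \<Rightarrow> ('h \<Rightarrow> real) \<Rightarrow> ('h \<Rightarrow> 'h) \<Rightarrow> complex \<Rightarrow> bool" where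
  "finite_multiplicity V N A z \<longleftrightarrow>
     (\<exists>B. finite B \<and> B \<subseteq> eigenspace V N A z \<and>
        (\<forall>x\<in>eigenspace V N A z. \<exists>c. N (x - (\<Sum>b\<in>B. c b *\<^sub>C b)) = 0))"

definition disc_spectrum ::
    "'h::complex_vector set \<Rightarrow> ('h \<Rightarrow> real) \<Rightarrow> ('h \<Rightarrow> 'h) \<Rightarrow> complex set" where
  "disc_spectrum V N A =
     {z. z isolated_in op_spectrum V N A \<and> eigenvalue V N A z \<and> finite_multiplicity V N A z}"

section \<open>The torus and the Hilbert spaces\<close>

type_synonym R3 = "real^3"

definition cube3 :: "R3 set" where
  "cube3 = {k. \<forall>i. - pi < k $ i \<and> k $ i \<le> pi}"

definition T3 :: "R3 measure" where
  "T3 = restrict_space lborel cube3"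

abbreviation T3T3 :: "(R3 \<times> R3) measure" where
  "T3T3 \<equiv> T3 \<Otimes>\<^sub>M T3"

definition L2 :: "'a measure \<Rightarrow> ('a \<Rightarrow> complex) set" where
  "L2 M = {f \<in> borel_measurable M. integrable M (\<lambda>x. (cmod (f x))\<^sup>2)}"

definition L2norm :: "'a measure \<Rightarrow> ('a \<Rightarrow> complex) \<Rightarrow> real" where
  "L2norm M f = sqrt (LINT x|M. (cmod (f x))\<^sup>2)"

definition L2sym :: "(R3 \<times> R3 \<Rightarrow> complex) set" where
  "L2sym = {f \<in> L2 T3T3. AE x in T3T3. f (fst x, snd x) = f (snd x, fst x)}"

definition H12 :: "((R3 \<Rightarrow> complex) \<times> (R3 \<times> R3 \<Rightarrow> complex)) set" where
  "H12 = L2 T3 \<times> L2sym"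

definition norm_H12 :: "(R3 \<Rightarrow> complex) \<times> (R3 \<times> R3 \<Rightarrow> complex) \<Rightarrow> real" where
  "norm_H12 = (\<lambda>(f1, f2). sqrt ((L2norm T3 f1)\<^sup>2 + (L2norm T3T3 f2)\<^sup>2))"

definition H01 :: "(complex \<times> (R3 \<Rightarrow> complex)) set" where
  "H01 = UNIV \<times> L2 T3"

definition norm_H01 :: "complex \<times> (R3 \<Rightarrow> complex) \<Rightarrow> real" where
  "norm_H01 = (\<lambda>(f0, f1). sqrt ((cmod f0)\<^sup>2 + (L2norm T3 f1)\<^sup>2))"

section \<open>The operator matrices\<close>

definition eps :: "R3 \<Rightarrow> real" where
  "eps k = (\<Sum>i\<in>UNIV. 1 - cos (k $ i))"

definition w1 :: "real \<Rightarrow> R3 \<Rightarrow> real" where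
  "w1 \<gamma> k = eps k + \<gamma>"

text \<open>Only used for \<open>k, p \<in> cube3\<close>. The half sum is not well defined on the torus; it is formed
  from the representatives in the cube, so \<open>w2\<close> jumps across the faces of the cube.\<close>

definition w2 :: "R3 \<Rightarrow> R3 \<Rightarrow> real" where
  "w2 k p = eps k + eps ((1/2) *\<^sub>R (k + p)) + eps p"

definition A11 :: "real \<Rightarrow> (R3 \<Rightarrow> complex) \<Rightarrow> (R3 \<Rightarrow> complex)" where
  "A11 \<gamma> f1 = (\<lambda>k. of_real (w1 \<gamma> k) * f1 k)"

definition A12 :: "(R3 \<times> R3 \<Rightarrow> complex) \<Rightarrow> (R3 \<Rightarrow> complex)" where
  "A12 f2 = (\<lambda>k. LINT t|T3. f2 (k, t))"

definition A12_adj :: "(R3 \<Rightarrow> complex) \<Rightarrow> (R3 \<times> R3 \<Rightarrow> complex)" where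
  "A12_adj f1 = (\<lambda>(k, p). (f1 k + f1 p) / 2)"

definition A22 :: "(R3 \<times> R3 \<Rightarrow> complex) \<Rightarrow> (R3 \<times> R3 \<Rightarrow> complex)" where
  "A22 f2 = (\<lambda>(k, p). of_real (w2 k p) * f2 (k, p))"

definition Aop :: "real \<Rightarrow> real \<Rightarrow>
    (R3 \<Rightarrow> complex) \<times> (R3 \<times> R3 \<Rightarrow> complex) \<Rightarrow>
    (R3 \<Rightarrow> complex) \<times> (R3 \<times> R3 \<Rightarrow> complex)" where
  "Aop \<gamma> \<mu> = (\<lambda>(f1, f2).
     (A11 \<gamma> f1 + of_real \<mu> *\<^sub>C A12 f2, of_real \<mu> *\<^sub>C A12_adj f1 + A22 f2))"

definition A00_fib :: "real \<Rightarrow> R3 \<Rightarrow> complex \<Rightarrow> complex" where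
  "A00_fib \<gamma> k f0 = of_real (w1 \<gamma> k) * f0"

definition A01 :: "(R3 \<Rightarrow> complex) \<Rightarrow> complex" where
  "A01 f1 = of_real (1 / sqrt 2) * (LINT t|T3. f1 t)"

definition A01_adj :: "complex \<Rightarrow> (R3 \<Rightarrow> complex)" where
  "A01_adj f0 = (\<lambda>t. of_real (1 / sqrt 2) * f0)"

lemma A01_adj_is_adjoint: "A01 f1 * cnj f0 = (LINT t|T3. f1 t * cnj (A01_adj f0 t))"
  by (simp add: A01_def A01_adj_def)

definition A11_fib :: "R3 \<Rightarrow> (R3 \<Rightarrow> complex) \<Rightarrow> (R3 \<Rightarrow> complex)" where
  "A11_fib k f1 = (\<lambda>p. of_real (w2 k p) * f1 p)"

definition Afib :: "real \<Rightarrow> real \<Rightarrow> R3 \<Rightarrow>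
    complex \<times> (R3 \<Rightarrow> complex) \<Rightarrow> complex \<times> (R3 \<Rightarrow> complex)" where
  "Afib \<gamma> \<mu> k = (\<lambda>(f0, f1).
     (A00_fib \<gamma> k f0 + of_real \<mu> *\<^sub>C A01 f1, of_real \<mu> *\<^sub>C A01_adj f0 + A11_fib k f1))"

section \<open>Discrete spectra, thresholds and the bounds \<open>E1\<close>, \<open>E2\<close>\<close>

text \<open>The operators are self-adjoint, so their spectra are real and nothing is lost here.\<close>

definition sigma_disc_A :: "real \<Rightarrow> real \<Rightarrow> real set" where
  "sigma_disc_A \<gamma> \<mu> = {x. complex_of_real x \<in> disc_spectrum H12 norm_H12 (Aop \<gamma> \<mu>)}"

definition sigma_disc_fib :: "real \<Rightarrow> real \<Rightarrow> R3 \<Rightarrow> real set" where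
  "sigma_disc_fib \<gamma> \<mu> k = {x. complex_of_real x \<in> disc_spectrum H01 norm_H01 (Afib \<gamma> \<mu> k)}"

definition Lam :: "real \<Rightarrow> real \<Rightarrow> real set" where
  "Lam \<gamma> \<mu> = (\<Union>k\<in>cube3. sigma_disc_fib \<gamma> \<mu> k)"

definition I00 :: real where
  "I00 = (LINT t|T3. 1 / w2 0 t)"

definition mu_l :: "real \<Rightarrow> real" where
  "mu_l \<gamma> = sqrt (2 * \<gamma>) * I00 powr (-1/2)"

definition mu_r :: "real \<Rightarrow> real" where
  "mu_r \<gamma> = sqrt (24 - 2 * \<gamma>) * I00 powr (-1/2)"

definition is_min :: "real set \<Rightarrow> real \<Rightarrow> bool" where
  "is_min S m \<longleftrightarrow> m \<in> S \<and> (\<forall>x\<in>S. m \<le> x)"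

definition is_max :: "real set \<Rightarrow> real \<Rightarrow> bool" where
  "is_max S m \<longleftrightarrow> m \<in> S \<and> (\<forall>x\<in>S. x \<le> m)"

text \<open>\<open>is_E1 \<gamma> \<mu> E\<close> and \<open>is_E2 \<gamma> \<mu> E\<close> say that \<open>E\<close> is the left, respectively right, bound.
  They are relations, not functions, since a maximum need not exist: by the jump of \<open>w2\<close> at the
  faces of the cube, \<open>LINT t|T3. 1 / (18 - w2 (\<chi> i. pi) t)\<close> is smaller than \<open>I00\<close>, and for
  \<open>\<gamma> < 12\<close> and \<open>\<mu>\<close> slightly above \<open>mu_r \<gamma>\<close> the set \<open>Lam \<gamma> \<mu> \<inter> {18..}\<close> is empty.\<close>

definition is_E1 :: "real \<Rightarrow> real \<Rightarrow> real \<Rightarrow> bool" where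
  "is_E1 \<gamma> \<mu> E \<longleftrightarrow>
     (if \<gamma> \<le> 0 \<or> (\<gamma> > 0 \<and> \<mu> > mu_l \<gamma>) then is_min (Lam \<gamma> \<mu> \<inter> {..0}) E else E = 0)"

definition is_E2 :: "real \<Rightarrow> real \<Rightarrow> real \<Rightarrow> bool" where
  "is_E2 \<gamma> \<mu> E \<longleftrightarrow>
     (if \<gamma> \<ge> 12 \<or> (\<gamma> < 12 \<and> \<mu> > mu_r \<gamma>) then is_max (Lam \<gamma> \<mu> \<inter> {18..}) E else E = 18)"

end

theory Submission
  imports Defs
begin

text \<open>The left edge of the band \<open>[0, 18]\<close> is moved to \<open>18\<close> by passing to \<open>18 - A\<close>, so that both claims
  concern eigenvalues above some \<open>E \<ge> 18\<close>. On the span of the corresponding eigenvectors, which are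
  orthogonal, the form of \<open>z - A\<close> is negative for \<open>z\<close> slightly above \<open>E\<close>. Completing the square in
  the two-particle component bounds this form from below by
  \<open>\<integral> D(k,z) f(k)\<^sup>2 dk - \<mu>\<^sup>2/2 \<integral>\<integral> f(k) f(p) / (z - w2 k p) dk dp\<close>, where \<open>D\<close> is the determinant of the
  fibre operator. In the geometric series of \<open>1 / (z - w2)\<close> the powers of the trigonometric
  polynomial \<open>w2\<close> are kernels of finite rank, hence vanish on a subspace of finite codimension that
  does not depend on \<open>z\<close>; the remainder is small in Hilbert-Schmidt norm relative to \<open>D\<close>, uniformly
  in \<open>z > E\<close>. So there are only finitely many eigenvectors.

  The bound on the remainder needs a lower bound for \<open>D\<close>. Symmetrising the integral over the
  torus in each coordinate shows that \<open>D(k,z) - D(k*,z)\<close> is at least the distance \<open>e(k)\<close> of \<open>\<epsilon>(k)\<close>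
  from its extremal value at \<open>k*\<close>, and \<open>1/e\<close> is integrable in dimension three. That \<open>E\<close> is the
  extremal eigenvalue of the fibres gives \<open>D(k*,z) \<ge> 0\<close> for \<open>z > E\<close> and excludes \<open>E = 18\<close>; below the
  critical coupling \<open>D\<close> is bounded away from \<open>0\<close>.\<close>

section \<open>The torus\<close>

text \<open>The half sum inside \<open>w2\<close> shapes the proof. Because of it \<open>w2\<close>
  is neither even in a coordinate nor invariant under translation by pi, so the integrand of the
  determinant is not maximal at k* for each t; only its sum over t_i and -t_i is. For the same
  reason the two edges are not mirror images: at the right edge k* is the corner (pi, pi, pi), where
  \<open>w2\<close> jumps, and the one-coordinate inequality needs a different argument there,
  although what follows from it is common to both edges.

  Two singularities threaten the remainder: the kernel 1 / (E - w2) blows up when E = 18, and 1 / D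
  may blow up at k*. They never have to be handled together. Either E = 18 and D is bounded below by
  a positive constant, or E > 18, the kernel is bounded and D dominates e. In both cases the squared
  kernel divided by the weights at k and p is at most a constant times 1 / (e(k) e(p)), which is
  integrable. At the critical coupling of the left edge both singularities would meet.\<close>

lemma cube3_borel [measurable]: "cube3 \<in> sets borel"
proof -
  have "cube3 = {k \<in> space borel. \<forall>i. - pi < k $ i \<and> k $ i \<le> pi}"
    by (auto simp: cube3_def)
  also have "\<dots> \<in> sets borel" by measurable
  finally show ?thesis .
qed

lemma space_T3 [simp]: "space T3 = cube3"
  by (simp add: T3_def space_restrict_space)

lemma borel_measurable_T3: "f \<in> borel_measurable borel \<Longrightarrow> f \<in> borel_measurable T3"
  by (simp add: T3_def measurable_restrict_space1)

lemma nth_borel_T3 [measurable]: "(\<lambda>x. x $ i) \<in> borel_measurable T3"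
  by (rule borel_measurable_T3) measurable

lemma cube3_subset_cbox: "cube3 \<subseteq> cbox (\<chi> i. - pi) (\<chi> i. pi)"
  by (auto simp: cube3_def mem_box_cart less_imp_le)

lemma emeasure_cube3_finite: "emeasure lborel cube3 < \<infinity>"
proof -
  have "emeasure lborel cube3 \<le> emeasure lborel (cbox (\<chi> i. - pi) (\<chi> i. pi) :: R3 set)"
    by (rule emeasure_mono[OF cube3_subset_cbox]) simp
  also have "\<dots> < \<infinity>" by (metis emeasure_lborel_cbox_finite infinity_ennreal_def)
  finally show ?thesis .
qed

lemma finite_measure_T3: "finite_measure T3"
  by (rule finite_measureI)
    (use emeasure_cube3_finite in \<open>auto simp: T3_def space_restrict_space emeasure_restrict_space\<close>)

interpretation T3: finite_measure T3 by (rule finite_measure_T3)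
interpretation T3T3: pair_sigma_finite T3 T3 ..
interpretation T3T3f: finite_measure T3T3
  by (rule finite_measure_pair_measure) (rule finite_measure_T3)+

text \<open>The open cube is invariant under sign changes of coordinates, which the half-open
  \<open>cube3\<close> is not; the two differ by a null set.\<close>

definition cubeo :: "R3 set" where
  "cubeo = {k. \<forall>i. - pi < k $ i \<and> k $ i < pi}"

lemma cubeo_borel [measurable]: "cubeo \<in> sets borel"
proof -
  have "cubeo = {k \<in> space borel. \<forall>i. - pi < k $ i \<and> k $ i < pi}"
    by (auto simp: cubeo_def)
  also have "\<dots> \<in> sets borel" by measurable
  finally show ?thesis .
qed

lemma AE_coord_neq: "AE t in lborel. (t::R3) $ i \<noteq> c"
proof -
  have "{x::R3. x $ i = c} \<in> null_sets lebesgue"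
    using negligible_hyperplane[of "axis i 1 :: R3" c] by (simp add: negligible_iff_null_sets inner_axis' axis_eq_0_iff)
  then have "{x::R3. x $ i = c} \<in> null_sets lborel"
    by (rule null_sets_completion_iff[THEN iffD1, rotated]) measurable
  then show ?thesis by (rule AE_I') auto
qed

lemma AE_T3_neq: "AE t in T3. t $ i \<noteq> c"
  unfolding T3_def by (subst AE_restrict_space_iff) (use AE_coord_neq[of i c] in auto)

lemma nn_integral_T3:
  "(\<integral>\<^sup>+t. f t \<partial>T3) = (\<integral>\<^sup>+t. f t * indicator cubeo t \<partial>lborel)"
proof -
  have "AE t in lborel. \<forall>i\<in>UNIV. (t::R3) $ i \<noteq> pi"
    by (intro AE_finite_allI AE_coord_neq) auto
  then have "AE t in lborel. f t * indicator cube3 t = f t * indicator cubeo t"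
  proof (rule eventually_mono)
    fix t :: R3 assume "\<forall>i\<in>UNIV. t $ i \<noteq> pi"
    then have "t \<in> cube3 \<longleftrightarrow> t \<in> cubeo"
      unfolding cube3_def cubeo_def mem_Collect_eq by (metis UNIV_I less_le)
    then show "f t * indicator cube3 t = f t * indicator cubeo t"
      by (simp add: indicator_def)
  qed
  then show ?thesis
    unfolding T3_def
    by (subst nn_integral_restrict_space) (auto intro: nn_integral_cong_AE)
qed

section \<open>Measure-preserving reflections of the cube\<close>

definition reflect :: "3 \<Rightarrow> real \<Rightarrow> R3 \<Rightarrow> R3" where
  "reflect i c t = (\<chi> j. if j = i then c - t $ j else t $ j)"

lemma reflect_nth [simp]: "reflect i c t $ j = (if j = i then c - t $ j else t $ j)"
  by (simp add: reflect_def)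

lemma reflect_refl [simp]: "reflect i c (reflect i c t) = t"
  by (simp add: vec_eq_iff)

lemma borel_vec: 
  assumes "\<And>i. (\<lambda>x. f x $ i) \<in> borel_measurable M"
  shows "(f :: 'a \<Rightarrow> R3) \<in> borel_measurable M"
  by (rule borel_measurable_euclidean_space[THEN iffD2])
    (use assms in \<open>auto simp: Basis_vec_def inner_axis\<close>)

lemma reflect_measurable [measurable]: "reflect i c \<in> borel_measurable borel"
  by (rule borel_vec) simp

text \<open>The map is affine and diagonal with all factors 1 or -1, so the Jacobian factor
  \<open>p\<close> of the change of variables is 1. The parameter \<open>c\<close> is left free: 0
  gives the sign change of a coordinate, \<open>pi\<close> and \<open>- pi\<close> give the two
  branches of \<open>half_swap\<close>.\<close>

lemma nn_integral_reflect:
  assumes [measurable]: "F \<in> borel_measurable borel"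
  shows "(\<integral>\<^sup>+t. F (reflect i c t) \<partial>lborel) = (\<integral>\<^sup>+t. F t \<partial>lborel)"
proof -
  let ?c = "\<lambda>b::R3. if b = axis i 1 then - 1 else (1::real)"
  let ?T = "\<lambda>x. c *\<^sub>R axis i 1 + (\<Sum>b\<in>Basis. (?c b * (x \<bullet> b)) *\<^sub>R b)"
  have "?T x $ j = reflect i c x $ j" for x j
  proof -
    have "(\<Sum>b\<in>Basis. (?c b * (x \<bullet> b)) *\<^sub>R b) $ j = ?c (axis j 1) * x $ j"
    proof -
      have "(\<Sum>b\<in>Basis. (?c b * (x \<bullet> b)) *\<^sub>R b) $ j = (\<Sum>b\<in>Basis. (?c b * (x \<bullet> b)) *\<^sub>R b) \<bullet> axis j 1"
        by (simp add: inner_axis)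
      also have "\<dots> = ?c (axis j 1) * (x \<bullet> axis j 1)"
        by (subst inner_sum_left_Basis) (auto simp: axis_in_Basis_iff)
      finally show ?thesis by (simp add: inner_axis)
    qed
    then show ?thesis by (auto simp: axis_eq_axis) (auto simp: axis_def)
  qed
  then have T: "?T = reflect i c" by (auto simp: fun_eq_iff vec_eq_iff)
  have p: "(\<Prod>j\<in>Basis. \<bar>?c j\<bar>) = 1" by (rule prod.neutral) auto
  have "lborel = density (distr lborel borel ?T) (\<lambda>_. (\<Prod>j\<in>Basis. \<bar>?c j\<bar>))"
    by (rule lborel_affine_euclidean) auto
  then have "(lborel :: R3 measure) = distr lborel borel (reflect i c)"
    unfolding T p by (simp add: density_1)
  then have "(\<integral>\<^sup>+t. F t \<partial>lborel) = (\<integral>\<^sup>+t. F t \<partial>distr lborel borel (reflect i c))"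
    by simp
  then show ?thesis by (simp add: nn_integral_distr)
qed

lemma nn_integral_T3_flip:
  assumes [measurable]: "F \<in> borel_measurable borel"
  shows "(\<integral>\<^sup>+t. F (reflect i 0 t) \<partial>T3) = (\<integral>\<^sup>+t. F t \<partial>T3)"
proof -
  have imp: "reflect i 0 t \<in> cubeo" if "t \<in> cubeo" for t
    unfolding cubeo_def mem_Collect_eq
  proof
    fix j show "- pi < reflect i 0 t $ j \<and> reflect i 0 t $ j < pi"
      using that[unfolded cubeo_def mem_Collect_eq, rule_format, of j] by auto
  qed
  have ind: "indicator cubeo (reflect i 0 t) = (indicator cubeo t :: ennreal)" for t
    using imp[of t] imp[of "reflect i 0 t"] by (cases "t \<in> cubeo"; cases "reflect i 0 t \<in> cubeo") auto
  show ?thesis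
    unfolding nn_integral_T3
    using nn_integral_reflect[of "\<lambda>t. F t * indicator cubeo t" i 0] by (simp add: ind)
qed

text \<open>Applied to all coordinates, this preserves the measure and interchanges \<open>1 - cos\<close> and \<open>1 + cos\<close>.\<close>

definition half_swap :: "real \<Rightarrow> real" where
  "half_swap y = (if y > 0 then pi - y else - pi - y)"

definition half_swap_at :: "3 \<Rightarrow> R3 \<Rightarrow> R3" where
  "half_swap_at i t = (\<chi> j. if j = i then half_swap (t $ j) else t $ j)"

lemma half_swap_at_nth [simp]: "half_swap_at i t $ j = (if j = i then half_swap (t $ j) else t $ j)"
  by (simp add: half_swap_at_def)

lemma half_swap_measurable [measurable]: "half_swap \<in> borel_measurable borel"
  unfolding half_swap_def by measurable

lemma half_swap_at_measurable [measurable]: "half_swap_at i \<in> borel_measurable borel"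
  by (rule borel_vec) simp

text \<open>\<open>half_swap\<close> is the reflection about pi/2 on (0, pi) and about -pi/2 on
  (-pi, 0), and it maps each of these intervals onto itself. So the integral is split along the null
  hyperplane t_i = 0, and each half is treated by a reflection.\<close>

lemma nn_integral_T3_half_swap_at:
  assumes [measurable]: "F \<in> borel_measurable borel"
  shows "(\<integral>\<^sup>+t. F (half_swap_at i t) \<partial>T3) = (\<integral>\<^sup>+t. F t \<partial>T3)"
proof -
  let ?P = "cubeo \<inter> {t. 0 < t $ i}" and ?N = "cubeo \<inter> {t. t $ i < 0}"
  have "{t::R3. 0 < t $ i} \<in> sets borel" "{t::R3. t $ i < 0} \<in> sets borel"
    by (auto intro: borel_open simp: open_halfspace_component_gt_cart open_halfspace_component_lt_cart)
  then have [measurable]: "?P \<in> sets borel" "?N \<in> sets borel"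
    using cubeo_borel by auto
  have split: "(\<integral>\<^sup>+t. G t \<partial>T3) = (\<integral>\<^sup>+t. G t * indicator ?P t \<partial>lborel) + (\<integral>\<^sup>+t. G t * indicator ?N t \<partial>lborel)"
    if [measurable]: "G \<in> borel_measurable borel" for G
  proof -
    have "(\<integral>\<^sup>+t. G t \<partial>T3) = (\<integral>\<^sup>+t. G t * indicator ?P t + G t * indicator ?N t \<partial>lborel)"
      unfolding nn_integral_T3
      by (rule nn_integral_cong_AE, rule eventually_mono[OF AE_coord_neq[of i 0]])
        (auto simp: indicator_def)
    also have "\<dots> = (\<integral>\<^sup>+t. G t * indicator ?P t \<partial>lborel) + (\<integral>\<^sup>+t. G t * indicator ?N t \<partial>lborel)"
      by (rule nn_integral_add) measurable
    finally show ?thesis .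
  qed
  have c: "(\<forall>j. - pi < (if j = i then d - t $ j else t $ j) \<and> (if j = i then d - t $ j else t $ j) < pi)
      \<longleftrightarrow> (\<forall>j. j \<noteq> i \<longrightarrow> - pi < t $ j \<and> t $ j < pi) \<and> -pi < d - t $ i \<and> d - t $ i < pi" for d and t :: R3
    by auto
  have c': "(\<forall>j. - pi < t $ j \<and> t $ j < pi)
      \<longleftrightarrow> (\<forall>j. j \<noteq> i \<longrightarrow> - pi < t $ j \<and> t $ j < pi) \<and> -pi < t $ i \<and> t $ i < pi" for t :: R3
    by auto
  have P: "t \<in> ?P \<longleftrightarrow> reflect i pi t \<in> ?P" and N: "t \<in> ?N \<longleftrightarrow> reflect i (- pi) t \<in> ?N" for t
    using pi_gt_zero unfolding cubeo_def by (simp_all add: c c') auto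
  have iP: "indicator ?P (reflect i pi t) = (indicator ?P t :: ennreal)"
    and iN: "indicator ?N (reflect i (- pi) t) = (indicator ?N t :: ennreal)" for t
    using P[of t] N[of t] by (metis indicator_simps)+
  have sP: "F (half_swap_at i t) * indicator ?P t = F (reflect i pi t) * indicator ?P (reflect i pi t)" for t
  proof -
    have "half_swap_at i t = reflect i pi t" if "t \<in> ?P" using that by (auto simp: vec_eq_iff half_swap_def)
    then show ?thesis unfolding iP by (cases "t \<in> ?P") auto
  qed
  have sN: "F (half_swap_at i t) * indicator ?N t = F (reflect i (- pi) t) * indicator ?N (reflect i (- pi) t)" for t
  proof -
    have "half_swap_at i t = reflect i (- pi) t" if "t \<in> ?N" using that by (auto simp: vec_eq_iff half_swap_def)
    then show ?thesis unfolding iN by (cases "t \<in> ?N") auto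
  qed
  have eP: "(\<integral>\<^sup>+t. F (reflect i pi t) * indicator ?P (reflect i pi t) \<partial>lborel) =
      (\<integral>\<^sup>+t. F t * indicator ?P t \<partial>lborel)"
    by (rule nn_integral_reflect[of "\<lambda>t. F t * indicator ?P t"]) measurable
  have eN: "(\<integral>\<^sup>+t. F (reflect i (- pi) t) * indicator ?N (reflect i (- pi) t) \<partial>lborel) =
      (\<integral>\<^sup>+t. F t * indicator ?N t \<partial>lborel)"
    by (rule nn_integral_reflect[of "\<lambda>t. F t * indicator ?N t"]) measurable
  have "(\<integral>\<^sup>+t. F (half_swap_at i t) \<partial>T3) =
      (\<integral>\<^sup>+t. F (half_swap_at i t) * indicator ?P t \<partial>lborel) + (\<integral>\<^sup>+t. F (half_swap_at i t) * indicator ?N t \<partial>lborel)"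
    by (rule split) measurable
  also have "\<dots> = (\<integral>\<^sup>+t. F t * indicator ?P t \<partial>lborel) + (\<integral>\<^sup>+t. F t * indicator ?N t \<partial>lborel)"
    by (simp only: sP sN eP eN)
  also have "\<dots> = (\<integral>\<^sup>+t. F t \<partial>T3)" by (rule split[symmetric]) measurable
  finally show ?thesis .
qed

definition half_swap3 :: "R3 \<Rightarrow> R3" where
  "half_swap3 t = (\<chi> j. half_swap (t $ j))"

lemma nn_integral_T3_half_swap3:
  assumes [measurable]: "F \<in> borel_measurable borel"
  shows "(\<integral>\<^sup>+t. F (half_swap3 t) \<partial>T3) = (\<integral>\<^sup>+t. F t \<partial>T3)"
proof -
  have s: "half_swap3 t = half_swap_at 1 (half_swap_at 2 (half_swap_at 3 t))" for t
    by (simp add: vec_eq_iff half_swap3_def forall_3)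
  have "(\<integral>\<^sup>+t. F (half_swap3 t) \<partial>T3) = (\<integral>\<^sup>+t. F (half_swap_at 1 (half_swap_at 2 t)) \<partial>T3)"
    unfolding s by (rule nn_integral_T3_half_swap_at[of "\<lambda>t. F (half_swap_at 1 (half_swap_at 2 t))"]) measurable
  also have "\<dots> = (\<integral>\<^sup>+t. F (half_swap_at 1 t) \<partial>T3)"
    by (rule nn_integral_T3_half_swap_at[of "\<lambda>t. F (half_swap_at 1 t)"]) measurable
  also have "\<dots> = (\<integral>\<^sup>+t. F t \<partial>T3)" by (rule nn_integral_T3_half_swap_at) measurable
  finally show ?thesis .
qed

section \<open>The band edges\<close>

text \<open>With y = |x| / 2 one has 1 - cos x = 2 (sin y)^2, and pi < 4 gives y \<le> 2, whence sin
  y \<ge> y - y^3 / 6 \<ge> y / 3. Squaring produces the constant 18.\<close>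

lemma one_minus_cos_ge:
  fixes x :: real
  assumes "\<bar>x\<bar> \<le> pi"
  shows "x\<^sup>2 / 18 \<le> 1 - cos x"
proof -
  define y where "y = \<bar>x\<bar> / 2"
  have y: "0 \<le> y" "y \<le> 2" using assms pi_less_4 by (auto simp: y_def)
  have "\<bar>sin y - (\<Sum>m<3. sin_coeff m * y ^ m)\<bar> \<le> inverse (fact 3) * \<bar>y\<bar> ^ 3"
    by (rule Maclaurin_sin_bound)
  moreover have "(\<Sum>m<3. sin_coeff m * y ^ m) = y"
    by (simp add: sin_coeff_def eval_nat_numeral)
  ultimately have "\<bar>sin y - y\<bar> \<le> y ^ 3 / 6"
    using y by (simp add: fact_numeral)
  then have "y - y ^ 3 / 6 \<le> sin y"
    using abs_ge_minus_self[of "sin y - y"] by linarith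
  moreover have "y ^ 3 \<le> 4 * y"
    using mult_mono[of y 2 y 2] y mult_right_mono[of "y * y" 4 y]
    by (auto simp: eval_nat_numeral)
  ultimately have "y / 3 \<le> sin y" by simp
  then have "(y / 3)\<^sup>2 \<le> (sin y)\<^sup>2" using y by (intro power_mono) auto
  moreover have "1 - cos x = 2 * (sin y)\<^sup>2"
  proof -
    have "cos x = cos (2 * y)" by (simp add: y_def)
    then show ?thesis using cos_double_sin[of y] by simp
  qed
  ultimately show ?thesis by (simp add: y_def power_divide)
qed

lemma one_minus_cos_le: "1 - cos x \<le> (x::real)\<^sup>2 / 2"
proof -
  have "1 - cos x = 2 * (sin (x/2))\<^sup>2" using cos_double_sin[of "x/2"] by simp
  moreover have "(sin (x/2))\<^sup>2 \<le> (x/2)\<^sup>2"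
    using abs_sin_x_le_abs_x[of "x/2"] by (simp only: abs_le_square_iff)
  ultimately show ?thesis by (simp add: power_divide)
qed

lemma eps_nonneg: "0 \<le> eps k"
  unfolding eps_def by (intro sum_nonneg) simp

lemma eps_le: "eps k \<le> 6"
proof -
  have "eps k \<le> (\<Sum>i\<in>(UNIV::3 set). 2)"
    unfolding eps_def
  proof (rule sum_mono)
    show "1 - cos (k $ i) \<le> 2" for i using cos_ge_minus_one[of "k $ i"] by linarith
  qed
  then show ?thesis by simp
qed

lemma cos_measurable [measurable (raw)]:
  fixes f :: "'a \<Rightarrow> real"
  assumes "f \<in> borel_measurable M"
  shows "(\<lambda>x. cos (f x)) \<in> borel_measurable M"
  by (rule borel_measurable_continuous_on[OF _ assms]) (intro continuous_intros)

lemma eps_measurable [measurable]: "eps \<in> borel_measurable borel"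
  unfolding eps_def by measurable

lemma eps_measurable_T3 [measurable]: "eps \<in> borel_measurable T3"
  by (rule borel_measurable_T3) measurable

lemma prod_Basis_vec: "(\<Prod>b\<in>Basis. f ((x::R3) \<bullet> b)) = (\<Prod>i\<in>UNIV. f (x $ i))"
proof -
  have "(\<Prod>b\<in>(\<lambda>i. axis i 1) ` UNIV. f (x \<bullet> b)) = (\<Prod>i\<in>UNIV. f (x $ i))"
    by (subst prod.reindex) (auto intro!: injI simp: axis_eq_axis inner_axis)
  moreover have "(Basis :: R3 set) = (\<lambda>i. axis i 1) ` UNIV" by (auto simp: Basis_vec_def)
  ultimately show ?thesis by simp
qed

text \<open>The integrand is a multiple of |x| to the power -2/3, which is integrable at 0. It is
  the one-dimensional factor of the product bound for \<open>1 / eps\<close>.\<close>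

lemma nn_integral_powr_finite:
  "(\<integral>\<^sup>+x. ennreal ((x\<^sup>2 / 18) powr (-1/3) * indicator {-pi<..<pi} x) \<partial>lborel) < \<infinity>"
proof -
  let ?h = "\<lambda>x::real. ennreal (x powr (-2/3)) * indicator {0..pi} x"
  have h: "(\<integral>\<^sup>+x. ?h x \<partial>lborel) = ennreal (pi powr (-2/3 + 1) / (-2/3 + 1))"
    by (rule nn_integral_has_integral_lebesgue') (use has_integral_powr_from_0[of "-2/3" pi] in auto)
  have h': "(\<integral>\<^sup>+x. ?h (- x) \<partial>lborel) = (\<integral>\<^sup>+x. ?h x \<partial>lborel)"
    using nn_integral_real_affine[of ?h "-1" 0] by simp
  have "(\<integral>\<^sup>+x. ennreal ((x\<^sup>2 / 18) powr (-1/3) * indicator {-pi<..<pi} x) \<partial>lborel)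
      \<le> (\<integral>\<^sup>+x. ennreal (18 powr (1/3)) * (?h x + ?h (- x)) \<partial>lborel)"
  proof (rule nn_integral_mono)
    fix x :: real
    have "(x\<^sup>2 / 18) powr (-1/3) = 18 powr (1/3) * \<bar>x\<bar> powr (-2/3)"
    proof -
      have "(x\<^sup>2) powr (-1/3) = \<bar>x\<bar> powr (-2/3)"
      proof (cases "x = 0")
        case False
        then have "(x\<^sup>2) powr (-1/3) = (\<bar>x\<bar> powr 2) powr (-1/3)" by simp
        also have "\<dots> = \<bar>x\<bar> powr (2 * (-1/3))" by (rule powr_powr)
        finally show ?thesis by simp
      qed simp
      moreover have "(x\<^sup>2 / 18) powr (-1/3) = (x\<^sup>2) powr (-1/3) / 18 powr (-1/3)"
        by (rule powr_divide)
      moreover have "18 powr (-1/3) = 1 / 18 powr (1/3::real)" by (simp add: powr_minus_divide)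
      ultimately show ?thesis by simp
    qed
    then have "ennreal ((x\<^sup>2 / 18) powr (-1/3)) = ennreal (18 powr (1/3)) * ennreal (\<bar>x\<bar> powr (-2/3))"
      by (simp only: ennreal_mult' powr_ge_zero)
    moreover have "ennreal (\<bar>x\<bar> powr (-2/3)) \<le> ?h x + ?h (- x)" if "x \<in> {-pi<..<pi}"
      using that by (cases "0 \<le> x") (auto simp: indicator_def)
    ultimately show "ennreal ((x\<^sup>2 / 18) powr (-1/3) * indicator {-pi<..<pi} x)
      \<le> ennreal (18 powr (1/3)) * (?h x + ?h (- x))"
      by (cases "x \<in> {-pi<..<pi}") (simp_all add: mult_left_mono)
  qed
  also have "\<dots> = ennreal (18 powr (1/3)) * ((\<integral>\<^sup>+x. ?h x \<partial>lborel) + (\<integral>\<^sup>+x. ?h (- x) \<partial>lborel))"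
    by (simp add: nn_integral_cmult nn_integral_add)
  also have "\<dots> < \<infinity>" unfolding h' h by (simp add: ennreal_mult_less_top)
  finally show ?thesis .
qed

text \<open>Each coordinate alone gives eps t \<ge> (t_i)^2 / 18. Writing 1 / eps as a product of
  three powers with exponent -1/3 and using a different coordinate in each factor bounds it by a
  product of one-variable functions, so Fubini replaces spherical coordinates.\<close>

lemma nn_integral_inverse_eps: "(\<integral>\<^sup>+t. ennreal (1 / eps t) \<partial>T3) < \<infinity>"
proof -
  let ?f = "\<lambda>x::real. (x\<^sup>2 / 18) powr (-1/3) * indicator {-pi<..<pi} x"
  have "(\<integral>\<^sup>+t. ennreal (1 / eps t) \<partial>T3) = (\<integral>\<^sup>+t. ennreal (1 / eps t) * indicator cubeo t \<partial>lborel)"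
    by (rule nn_integral_T3)
  also have "\<dots> \<le> (\<integral>\<^sup>+t. ennreal (\<Prod>b\<in>Basis. ?f ((t::R3) \<bullet> b)) \<partial>lborel)"
  proof (rule nn_integral_mono_AE)
    have "AE t in lborel. \<forall>i\<in>UNIV. (t::R3) $ i \<noteq> 0"
      by (intro AE_finite_allI AE_coord_neq) auto
    then show "AE t in lborel. ennreal (1 / eps t) * indicator cubeo t \<le> ennreal (\<Prod>b\<in>Basis. ?f (t \<bullet> b))"
    proof (rule eventually_mono)
      fix t :: R3 assume nz: "\<forall>i\<in>UNIV. t $ i \<noteq> 0"
      show "ennreal (1 / eps t) * indicator cubeo t \<le> ennreal (\<Prod>b\<in>Basis. ?f (t \<bullet> b))"
      proof (cases "t \<in> cubeo")
        case True
        then have b: "\<bar>t $ i\<bar> < pi" for i by (auto simp: cubeo_def abs_less_iff minus_less_iff)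
        have le: "(t $ i)\<^sup>2 / 18 \<le> eps t" for i
        proof -
          have "(t $ i)\<^sup>2 / 18 \<le> 1 - cos (t $ i)"
            using one_minus_cos_ge[of "t $ i"] b[of i] by simp
          also have "\<dots> \<le> eps t" unfolding eps_def
            by (rule member_le_sum[of i UNIV "\<lambda>i. 1 - cos (t $ i)"]) auto
          finally show ?thesis .
        qed
        have pos: "0 < (t $ i)\<^sup>2 / 18" for i using nz by simp
        have e: "0 < eps t" using le[of 1] pos[of 1] by linarith
        have "1 / eps t = (\<Prod>i\<in>(UNIV::3 set). eps t powr (-1/3))"
        proof -
          have "(\<Prod>i\<in>(UNIV::3 set). eps t powr (-1/3)) = (eps t powr (-1/3)) ^ 3" by simp
          also have "\<dots> = eps t powr (-1)" using e by (simp add: powr_power)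
          finally show ?thesis using e by (simp add: powr_minus_divide)
        qed
        also have "\<dots> \<le> (\<Prod>i\<in>UNIV. ((t $ i)\<^sup>2 / 18) powr (-1/3))"
          by (rule prod_mono) (use le pos in \<open>auto intro!: powr_mono2'\<close>)
        also have "\<dots> = (\<Prod>i\<in>UNIV. ?f (t $ i))"
          by (rule prod.cong) (use b in \<open>auto simp: abs_less_iff minus_less_iff\<close>)
        finally show ?thesis using True by (subst prod_Basis_vec) (auto intro: ennreal_leI)
      qed simp
    qed
  qed
  also have "\<dots> = (\<integral>\<^sup>+t. (\<Prod>b\<in>Basis. ennreal (?f (t \<bullet> b))) \<partial>(lborel :: R3 measure))"
    by (intro nn_integral_cong) (auto simp: prod_ennreal)
  also have "\<dots> = (\<Prod>b\<in>(Basis::R3 set). (\<integral>\<^sup>+x. ennreal (?f x) \<partial>lborel))"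
    by (rule nn_integral_lborel_prod) auto
  also have "\<dots> < \<infinity>"
    using nn_integral_powr_finite by (simp add: power_less_top_ennreal)
  finally show ?thesis .
qed

section \<open>Inequalities behind the symmetrisation in one coordinate\<close>

lemma two_recip:
  fixes a b :: real
  assumes "a - b \<noteq> 0" "a + b \<noteq> 0"
  shows "1 / (a - b) + 1 / (a + b) = 2 * a / (a\<^sup>2 - b\<^sup>2)"
proof -
  have "a\<^sup>2 - b\<^sup>2 = (a - b) * (a + b)" by (simp add: algebra_simps power2_eq_square)
  then show ?thesis using assms by (simp add: add_frac_eq)
qed

text \<open>1 / (B + x) is convex and decreasing, so under the constraints the pair (-S, S) is
  extremal. For p \<le> q: if q \<ge> S the summands compare one by one; otherwise p \<ge> -q allows
  p to be replaced by -q, and the symmetric sum 2 B / (B^2 - q^2) grows with q^2.\<close>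

lemma convex_pair_ineq:
  fixes B S p q :: real
  assumes "0 < B - S" "0 \<le> S" "- S \<le> p" "- S \<le> q" "0 \<le> p + q"
  shows "1 / (B + p) + 1 / (B + q) \<le> 1 / (B - S) + 1 / (B + S)"
proof -
  have main: "1 / (B + p) + 1 / (B + q) \<le> 1 / (B - S) + 1 / (B + S)"
    if p: "- S \<le> p" and pq: "p \<le> q" "0 \<le> p + q" for p q
  proof (cases "q \<ge> S")
    case True
    have "1 / (B + p) \<le> 1 / (B - S)" by (rule frac_le) (use p assms(1) in linarith)+
    moreover have "1 / (B + q) \<le> 1 / (B + S)" by (rule frac_le) (use True assms(1,2) in linarith)+
    ultimately show ?thesis by linarith
  next
    case False
    have pos: "0 < B - q" "0 < B + q" "0 < B + S" "0 < B" using p pq assms(1,2) False by linarith+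
    have "1 / (B + p) \<le> 1 / (B - q)" by (rule frac_le) (use pos pq in linarith)+
    moreover have "1 / (B - q) + 1 / (B + q) = 2 * B / (B\<^sup>2 - q\<^sup>2)"
      by (rule two_recip) (use pos in linarith)+
    moreover have "1 / (B - S) + 1 / (B + S) = 2 * B / (B\<^sup>2 - S\<^sup>2)"
      by (rule two_recip) (use pos assms(1) in linarith)+
    moreover have "2 * B / (B\<^sup>2 - q\<^sup>2) \<le> 2 * B / (B\<^sup>2 - S\<^sup>2)"
    proof -
      have "q\<^sup>2 \<le> S\<^sup>2" by (rule power_mono) (use p pq False in linarith)+
      moreover have "0 < (B - S) * (B + S)" using pos assms(1) by simp
      then have "0 < B\<^sup>2 - S\<^sup>2" by (simp add: algebra_simps power2_eq_square)
      ultimately show ?thesis using pos by (intro frac_le) auto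
    qed
    ultimately show ?thesis by linarith
  qed
  show ?thesis
    using main[of p q] main[of q p] assms(3-5) by (cases "p \<le> q") (simp_all add: add.commute)
qed

lemma cos_half_sum: "cos ((x + y) / 2) + cos ((x - y) / 2) = 2 * cos (x / 2) * cos (y / 2 :: real)"
  by (simp add: add_divide_distrib diff_divide_distrib cos_add cos_diff)

lemma cos_half_prod:
  "cos ((x + y) / 2) * cos ((x - y) / 2) = (cos (x / 2))\<^sup>2 + (cos (y / 2 :: real))\<^sup>2 - 1"
proof -
  have "cos ((x + y) / 2) * cos ((x - y) / 2)
      = (cos (x/2))\<^sup>2 * (cos (y/2))\<^sup>2 - (sin (x/2))\<^sup>2 * (sin (y/2))\<^sup>2"
    by (simp add: add_divide_distrib diff_divide_distrib cos_add cos_diff power2_eq_square algebra_simps)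
  then show ?thesis by (simp add: sin_squared_eq algebra_simps)
qed

text \<open>\<open>s = 1\<close> describes the left edge \<open>0\<close> of the two-particle band, \<open>s = -1\<close> the right edge \<open>18\<close>.
  Replacing \<open>A\<close> by \<open>18 - A\<close> for \<open>s = 1\<close> moves both edges to \<open>18\<close>, and \<open>w2\<close> becomes \<open>shifted_w2\<close>.\<close>

locale side =
  fixes s :: real
  assumes s: "s = 1 \<or> s = - 1"
begin

text \<open>One coordinate's share of the distance of \<open>w2\<close> from the chosen edge: each
  coordinate contributes a value in [0, 6] to \<open>w2\<close>, and for s = -1 this is 6 minus that
  contribution.\<close>

definition gap1 :: "real \<Rightarrow> real \<Rightarrow> real" where
  "gap1 x y = 3 - s * (cos x + cos y + cos ((x + y) / 2))"

definition shifted_w2 :: "R3 \<Rightarrow> R3 \<Rightarrow> real" where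
  "shifted_w2 k t = 18 - (\<Sum>i\<in>UNIV. gap1 (k $ i) (t $ i))"

definition gap :: "R3 \<Rightarrow> real" where
  "gap k = (\<Sum>i\<in>UNIV. 1 - s * cos (k $ i))"

text \<open>The coordinate of the point where \<open>gap\<close> vanishes. At the right edge pi and
  -pi are the same point of the torus, but the half-open cube contains only pi.\<close>

definition kcrit1 :: real where "kcrit1 = (if s = 1 then 0 else pi)"

definition kcrit :: R3 where "kcrit = (\<chi> i. kcrit1)"

lemma shifted_w2_w2: "shifted_w2 k t = 9 - s * (w2 k t - 9)"
  using s by (auto simp: shifted_w2_def gap1_def w2_def eps_def sum_3 add_divide_distrib)

lemma gap_eps: "gap k = 3 + s * (eps k - 3)"
  using s by (auto simp: gap_def eps_def sum_3)

lemma gap_nonneg: "0 \<le> gap k" and gap_le: "gap k \<le> 6"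
  using s eps_nonneg[of k] eps_le[of k] by (auto simp: gap_eps)

lemma s_cos_le: "s * cos x \<le> 1" and s_cos_ge: "- 1 \<le> s * cos x"
  using s cos_le_one[of x] cos_ge_minus_one[of x] by auto

lemma gap1_ge: "(1 - s * cos x) + (1 - s * cos y) \<le> gap1 x y"
  using s_cos_le[of "(x + y) / 2"] by (simp add: gap1_def distrib_left)

lemma gap1_nonneg: "0 \<le> gap1 x y"
  using gap1_ge[of x y] s_cos_le[of x] s_cos_le[of y] by linarith

text \<open>The half-sum term is nonnegative and is dropped. What remains is separable, so that
  kernels can be compared with products of functions of k and of t.\<close>

lemma shifted_w2_le: "shifted_w2 k t \<le> 18 - gap k - gap t"
proof -
  have "gap k + gap t \<le> (\<Sum>i\<in>UNIV. gap1 (k $ i) (t $ i))"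
    unfolding gap_def sum.distrib[symmetric] by (intro sum_mono gap1_ge)
  then show ?thesis by (simp add: shifted_w2_def)
qed

lemma shifted_w2_le_18: "shifted_w2 k t \<le> 18"
  using shifted_w2_le[of k t] gap_nonneg[of k] gap_nonneg[of t] by linarith

lemma shifted_w2_nonneg: "0 \<le> shifted_w2 k t"
proof -
  have "gap1 x y \<le> 6" for x y
    using s_cos_ge[of x] s_cos_ge[of y] s_cos_ge[of "(x + y) / 2"] by (simp add: gap1_def distrib_left)
  then have "(\<Sum>i\<in>UNIV. gap1 (k $ i) (t $ i)) \<le> (\<Sum>i\<in>(UNIV :: 3 set). 6)"
    by (intro sum_mono) auto
  then show ?thesis by (simp add: shifted_w2_def)
qed

lemma gap1_sym: "gap1 x y = gap1 y x"
  by (simp add: gap1_def add.commute add.left_commute)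

lemma shifted_w2_sym: "shifted_w2 k t = shifted_w2 t k"
  unfolding shifted_w2_def by (subst gap1_sym) (rule HOL.refl)

lemma gap_kcrit [simp]: "gap kcrit = 0"
  using s by (auto simp: gap_def kcrit_def kcrit1_def)

lemma gap1_measurable [measurable]:
  assumes [measurable]: "f \<in> borel_measurable M" "g \<in> borel_measurable M"
  shows "(\<lambda>x. gap1 (f x) (g x)) \<in> borel_measurable M"
  unfolding gap1_def by measurable

lemma shifted_w2_measurable1 [measurable]: "shifted_w2 k \<in> borel_measurable borel"
  unfolding shifted_w2_def by measurable

lemma shifted_w2_measurable1_T3 [measurable]: "shifted_w2 k \<in> borel_measurable T3"
  by (rule borel_measurable_T3) measurable

lemma shifted_w2_measurable2 [measurable]: "(\<lambda>x. shifted_w2 (fst x) (snd x)) \<in> borel_measurable T3T3"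
  unfolding shifted_w2_def by measurable

lemma gap_measurable [measurable]: "gap \<in> borel_measurable borel"
  unfolding gap_def by measurable

lemma gap_measurable_T3 [measurable]: "gap \<in> borel_measurable T3"
  by (rule borel_measurable_T3) measurable

lemma cube3_kcrit: "kcrit \<in> cube3"
  by (simp add: kcrit_def kcrit1_def cube3_def)

lemma gap_zero_imp:
  assumes "k \<in> cube3" "gap k = 0"
  shows "k = kcrit"
proof -
  have "1 - s * cos (k $ i) = 0" for i
    using assms(2) s_cos_le unfolding gap_def by (subst (asm) sum_nonneg_eq_0_iff) auto
  then have c: "cos (k $ i) = s" for i using s by (elim disjE) (simp_all add: add_eq_0_iff)
  have b: "- pi < k $ i" "k $ i \<le> pi" for i using assms(1) by (auto simp: cube3_def)
  have "k $ i = kcrit1" for i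
  proof (cases "s = 1")
    case True
    have "0 \<le> - ((k $ i)\<^sup>2)" using one_minus_cos_ge[of "k $ i"] c[of i] b[of i] True by (simp add: abs_le_iff)
    then show ?thesis unfolding kcrit1_def using True by simp
  next
    case False
    then have "cos (pi - \<bar>k $ i\<bar>) = 1" using c[of i] s by simp
    then have "(pi - \<bar>k $ i\<bar>)\<^sup>2 \<le> 0"
      using one_minus_cos_ge[of "pi - \<bar>k $ i\<bar>"] b[of i] by (simp add: abs_le_iff)
    then have "\<bar>k $ i\<bar> = pi" by simp
    then show ?thesis unfolding kcrit1_def using b[of i] False by auto
  qed
  then show ?thesis by (simp add: kcrit_def vec_eq_iff)
qed

lemma AE_gap_pos: "AE t in T3. 0 < gap t"
proof -
  have "t = kcrit \<or> 0 < gap t" if "t \<in> cube3" for t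
    using gap_zero_imp[OF that] gap_nonneg[of t] by fastforce
  note pos = this
  from AE_T3_neq[of 1 kcrit1] AE_space[of T3] show ?thesis
  proof eventually_elim
    case (elim t)
    then show ?case using pos[of t] by (auto simp: kcrit_def)
  qed
qed

lemma half_swap_cos: "cos (half_swap y) = - cos y"
  by (simp add: half_swap_def cos_diff)

lemma nn_integral_inverse_gap: "(\<integral>\<^sup>+t. ennreal (1 / gap t) \<partial>T3) < \<infinity>"
proof (cases "s = 1")
  case True
  then have "gap = eps" unfolding gap_eps by (simp add: fun_eq_iff)
  then show ?thesis using nn_integral_inverse_eps by simp
next
  case False
  then have "gap t = eps (half_swap3 t)" for t
    unfolding gap_def eps_def half_swap3_def using s by (simp add: half_swap_cos)
  then show ?thesis
    using nn_integral_inverse_eps nn_integral_T3_half_swap3[of "\<lambda>t. ennreal (1 / eps t)"] by simp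
qed

lemma integrable_inverse_gap: "integrable T3 (\<lambda>t. 1 / gap t)"
  by (rule integrableI_nonneg) (use nn_integral_inverse_gap gap_nonneg in auto)

text \<open>A single summand need not be largest at x = \<open>kcrit1\<close>; the sum over y and -y
  is. For s = 1 the half-sum cosines p and q enter only through p + q = 2 c d and p q = c^2 + d^2 -
  1, and the claim becomes a polynomial inequality in A, c and d with the factor 1 - c. For s = -1
  it follows from \<open>convex_pair_ineq\<close>: dropping 1 + cos x \<ge> 0 leaves B + p and B +
  q, while x = pi gives exactly B - S and B + S. In the application r collects z - 18 and the other
  coordinates.\<close>

lemma pair_ineq:
  assumes rho: "0 < r" and x: "\<bar>x\<bar> \<le> pi" and y: "\<bar>y\<bar> \<le> pi"
  shows "1 / (r + gap1 x y) + 1 / (r + gap1 x (- y)) \<le> 1 / (r + gap1 kcrit1 y) + 1 / (r + gap1 kcrit1 (- y))"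
proof (cases "s = 1")
  case True
  have rpos: "0 < r + gap1 x y" for x y using rho gap1_nonneg[of x y] by simp
  define c d A p q where "c = cos (x / 2)" and "d = cos (y / 2)" and "A = r + 3 - cos x - cos y"
    and "p = cos ((x + y) / 2)" and "q = cos ((x - y) / 2)"
  have cd: "0 \<le> c" "c \<le> 1" "0 \<le> d" "d \<le> 1"
    using x y by (auto simp: c_def d_def abs_le_iff intro!: cos_ge_zero)
  have cx: "cos x = 2 * c\<^sup>2 - 1" "cos y = 2 * d\<^sup>2 - 1"
    using cos_double_cos[of "x/2"] cos_double_cos[of "y/2"] by (simp_all add: c_def d_def)
  have pq: "p + q = 2 * c * d" "p * q = c\<^sup>2 + d\<^sup>2 - 1"
    using cos_half_sum[of x y] cos_half_prod[of x y] by (simp_all add: p_def q_def c_def d_def)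
  have c2: "c\<^sup>2 \<le> 1" "d\<^sup>2 \<le> 1" using cd by (auto intro: power_le_one)
  have A1: "1 \<le> A" using rho c2 by (simp add: A_def cx)
  have e1: "r + gap1 x y = A - p" "r + gap1 x (- y) = A - q"
    unfolding gap1_def A_def p_def q_def using True by simp_all
  \<comment> \<open>B equals r + 2 - cos y, the value of A at x = 0.\<close>
  define B where "B = A - 2 * (1 - c\<^sup>2)"
  have e2: "r + gap1 kcrit1 y = B - d" "r + gap1 kcrit1 (- y) = B - d"
    unfolding gap1_def A_def B_def kcrit1_def cx(1) using True by (simp_all add: d_def)
  have pos: "0 < A - p" "0 < A - q" "0 < B - d"
    using rpos[of x y] rpos[of x "- y"] rpos[of kcrit1 y] unfolding e1 e2 by simp_all
  \<comment> \<open>The expression is the cofactor of 1 - c in the difference of the two sides of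
    \<open>key\<close>.\<close>
  have "0 \<le> (1 + c) * (2 * A - 1 - 2 * c * d) + d * A + d\<^sup>2"
  proof (cases "0 \<le> 2 * A - 1 - 2 * c * d")
    case True
    then show ?thesis using cd A1 by (intro add_nonneg_nonneg mult_nonneg_nonneg) auto
  next
    case False
    define X where "X = (1 + c) * (2 * A - 1 - 2 * c * d)"
    \<comment> \<open>The second factor is negative here, so 1 + c may be replaced by its upper
      bound 2. With A \<ge> 1 the rest is bounded below by (1 - d) (2 - d).\<close>
    have "2 * (2 * A - 1 - 2 * c * d) \<le> X"
      unfolding X_def using False cd by (intro mult_right_mono_neg) auto
    then have "4 * A - 2 - 4 * (c * d) \<le> X" by simp
    moreover have "c * d \<le> d" using cd by (simp add: mult_left_le_one_le)
    moreover have "d \<le> d * A" using cd A1 mult_left_mono[of 1 A d] by simp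
    moreover have "0 \<le> (1 - d) * (2 - d)" using cd by simp
    then have "0 \<le> 2 - 3 * d + d\<^sup>2" by (simp add: algebra_simps power2_eq_square)
    ultimately show ?thesis using A1 unfolding X_def[symmetric] by linarith
  qed
  then have "0 \<le> (1 - c) * ((1 + c) * (2 * A - 1 - 2 * c * d) + d * A + d\<^sup>2)"
    using cd by simp
  then have key: "(A - c * d) * (B - d) \<le> A\<^sup>2 - 2 * A * c * d + c\<^sup>2 + d\<^sup>2 - 1"
    by (simp add: B_def algebra_simps power2_eq_square)
  have prod: "(A - p) * (A - q) = A\<^sup>2 - 2 * A * c * d + c\<^sup>2 + d\<^sup>2 - 1"
  proof -
    have "(A - p) * (A - q) = A\<^sup>2 - A * (p + q) + p * q" by (simp add: algebra_simps power2_eq_square)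
    then show ?thesis unfolding pq by simp
  qed
  have "1 / (A - p) + 1 / (A - q) = (2 * A - (p + q)) / ((A - p) * (A - q))"
    using pos by (simp add: add_frac_eq)
  also have "\<dots> = 2 * (A - c * d) / (A\<^sup>2 - 2 * A * c * d + c\<^sup>2 + d\<^sup>2 - 1)"
    unfolding prod pq by simp
  also have "\<dots> \<le> 2 / (B - d)"
  proof -
    have P: "0 < A\<^sup>2 - 2 * A * c * d + c\<^sup>2 + d\<^sup>2 - 1" (is "0 < ?P")
      unfolding prod[symmetric] using pos by simp
    have "2 * (A - c * d) * (B - d) \<le> 2 * ?P"
      using mult_left_mono[OF key, of 2] unfolding mult.assoc by simp
    then have "2 * (A - c * d) \<le> 2 * ?P / (B - d)" by (rule mult_imp_le_div_pos[OF pos(3)])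
    then show ?thesis by (intro mult_imp_div_pos_le[OF P]) simp
  qed
  finally show ?thesis unfolding e1 e2 by simp
next
  case False
  then have s1: "s = -1" using s by simp
  have main: "1 / (r + gap1 x y) + 1 / (r + gap1 x (- y)) \<le> 1 / (r + gap1 kcrit1 y) + 1 / (r + gap1 kcrit1 (- y))"
    if "0 \<le> x" "x \<le> pi" "0 \<le> y" "y \<le> pi" for x y
  proof -
    define S B p q where "S = sin (y / 2)" and "B = r + 2 + cos y"
      and "p = cos ((x + y) / 2)" and "q = cos ((x - y) / 2)"
    have e: "r + gap1 kcrit1 y = B - S" "r + gap1 kcrit1 (- y) = B + S"
      unfolding gap1_def kcrit1_def B_def S_def unfolding s1
      by (simp_all add: add_divide_distrib diff_divide_distrib cos_add cos_diff)
    have BS: "0 < B - S" using rho gap1_nonneg[of kcrit1 y] unfolding e(1)[symmetric] by simp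
    have S: "0 \<le> S" using that unfolding S_def by (intro sin_ge_zero) auto
    have "cos ((pi + y) / 2) \<le> p" unfolding p_def
      using that by (intro cos_monotone_0_pi_le) auto
    then have p: "- S \<le> p" by (simp add: S_def add_divide_distrib cos_add)
    have "0 \<le> q" unfolding q_def using that by (intro cos_ge_zero) (auto simp: field_simps)
    then have q: "- S \<le> q" using S by simp
    have "0 \<le> cos (x / 2)" "0 \<le> cos (y / 2)" using that by (auto intro!: cos_ge_zero)
    then have pq: "0 \<le> p + q" using cos_half_sum[of x y] by (simp add: p_def q_def)
    have "1 / (r + gap1 x y) \<le> 1 / (B + p)" "1 / (r + gap1 x (- y)) \<le> 1 / (B + q)"
    proof -
      have x0: "0 \<le> 1 + cos x" using cos_ge_minus_one[of x] by linarith
      have "B + p \<le> r + gap1 x y" "B + q \<le> r + gap1 x (- y)"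
        unfolding gap1_def B_def p_def q_def unfolding s1
        using x0 by simp_all
      moreover have "0 < B + p" "0 < B + q" using BS p q by linarith+
      ultimately show "1 / (r + gap1 x y) \<le> 1 / (B + p)" "1 / (r + gap1 x (- y)) \<le> 1 / (B + q)"
        by (auto intro!: frac_le)
    qed
    moreover have "1 / (B + p) + 1 / (B + q) \<le> 1 / (B - S) + 1 / (B + S)"
      by (rule convex_pair_ineq) (use BS S p q pq in auto)
    ultimately show ?thesis unfolding e by linarith
  qed
  \<comment> \<open>A sign change of x or of y only exchanges the two summands, so both may be taken
    nonnegative.\<close>
  have m: "gap1 (- x) y = gap1 x (- y)" for x y
  proof -
    have "(- x + y) / 2 = - ((x + - y) / 2)" by (simp add: field_simps)
    then have "cos ((- x + y) / 2) = cos ((x + - y) / 2)" by (simp only: cos_minus)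
    then show ?thesis by (simp add: gap1_def)
  qed
  have "1 / (r + gap1 \<bar>x\<bar> \<bar>y\<bar>) + 1 / (r + gap1 \<bar>x\<bar> (- \<bar>y\<bar>))
      \<le> 1 / (r + gap1 kcrit1 \<bar>y\<bar>) + 1 / (r + gap1 kcrit1 (- \<bar>y\<bar>))"
    by (rule main) (use x y in auto)
  then show ?thesis
    using m[of x y] m[of x "-y"] by (cases "0 \<le> x"; cases "0 \<le> y") auto
qed

end

section \<open>The loop integral: maximal at \<open>kcrit\<close>, bounded by \<open>I00\<close>,
  not square integrable at the edge\<close>

context side begin

definition loop_int :: "R3 \<Rightarrow> real \<Rightarrow> real" where
  "loop_int k z = (LINT t|T3. 1 / (z - shifted_w2 k t))"

lemma integrable_T3_bounded:
  fixes f :: "R3 \<Rightarrow> real"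
  assumes "f \<in> borel_measurable T3" "\<And>t. t \<in> cube3 \<Longrightarrow> \<bar>f t\<bar> \<le> B"
  shows "integrable T3 f"
  by (rule T3.integrable_const_bound[where B = B]) (use assms in \<open>auto simp: AE_space\<close>)

lemma inverse_z_shifted_w2_bounds:
  assumes "18 < z"
  shows "0 < 1 / (z - shifted_w2 k t)" "1 / (z - shifted_w2 k t) \<le> 1 / (z - 18)" "1 / z \<le> 1 / (z - shifted_w2 k t)"
  using assms shifted_w2_le_18[of k t] shifted_w2_nonneg[of k t] by (auto intro!: frac_le)

lemma integrable_loop_int:
  assumes "18 < z"
  shows "integrable T3 (\<lambda>t. 1 / (z - shifted_w2 k t))"
proof (rule integrable_T3_bounded[where B = "1 / (z - 18)"])
  show "\<bar>1 / (z - shifted_w2 k t)\<bar> \<le> 1 / (z - 18)" for t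
    using inverse_z_shifted_w2_bounds[OF assms, of k t] by linarith
qed measurable

lemma loop_int_nn: "18 < z \<Longrightarrow> (\<integral>\<^sup>+t. ennreal (1 / (z - shifted_w2 k t)) \<partial>T3) = ennreal (loop_int k z)"
  unfolding loop_int_def
  by (rule nn_integral_eq_integral) (auto intro!: integrable_loop_int less_imp_le inverse_z_shifted_w2_bounds simp del: zero_le_divide_1_iff zero_less_divide_1_iff)

lemma loop_int_nonneg: "18 < z \<Longrightarrow> 0 \<le> loop_int k z"
  unfolding loop_int_def by (rule Bochner_Integration.integral_nonneg) (auto intro!: less_imp_le inverse_z_shifted_w2_bounds simp del: zero_le_divide_1_iff zero_less_divide_1_iff)

lemma kcrit1_bound: "\<bar>kcrit1\<bar> \<le> pi"
  by (simp add: kcrit1_def)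

text \<open>The contributions of the other coordinates are unchanged by the reflection of
  \<open>t $ i\<close> and form the constant r of \<open>pair_ineq\<close>. Summing the integrand
  over t and its reflection counts the loop integral twice.\<close>

lemma loop_int_step:
  assumes z: "18 < z" and k: "\<And>j. \<bar>k $ j\<bar> \<le> pi"
  shows "loop_int k z \<le> loop_int (\<chi> j. if j = i then kcrit1 else k $ j) z"
proof -
  let ?k = "(\<chi> j. if j = i then kcrit1 else k $ j) :: R3"
  let ?F = "\<lambda>t. ennreal (1 / (z - shifted_w2 k t))" and ?G = "\<lambda>t. ennreal (1 / (z - shifted_w2 ?k t))"
  have split: "z - shifted_w2 k' t = (z - 18 + (\<Sum>j\<in>UNIV - {i}. gap1 (k' $ j) (t $ j))) + gap1 (k' $ i) (t $ i)" for k' t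
    unfolding shifted_w2_def by (subst sum.remove[of UNIV i]) auto
  have le: "?F t + ?F (reflect i 0 t) \<le> ?G t + ?G (reflect i 0 t)" if t: "t \<in> cube3" for t
  proof -
    let ?r = "z - 18 + (\<Sum>j\<in>UNIV - {i}. gap1 (k $ j) (t $ j))"
    have r: "0 < ?r" using z by (intro add_pos_nonneg sum_nonneg gap1_nonneg) auto
    have t1: "\<bar>t $ i\<bar> \<le> pi"
      using t[unfolded cube3_def mem_Collect_eq, rule_format, of i] by (simp add: abs_le_iff)
    have e: "z - shifted_w2 k t = ?r + gap1 (k $ i) (t $ i)" "z - shifted_w2 k (reflect i 0 t) = ?r + gap1 (k $ i) (- (t $ i))"
      "z - shifted_w2 ?k t = ?r + gap1 kcrit1 (t $ i)" "z - shifted_w2 ?k (reflect i 0 t) = ?r + gap1 kcrit1 (- (t $ i))"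
      unfolding split by simp_all
    show ?thesis
      unfolding e using pair_ineq[OF r k[of i] t1] r gap1_nonneg
      by (simp add: ennreal_plus[symmetric] add_pos_nonneg less_imp_le del: ennreal_plus)
  qed
  have sum2: "(\<integral>\<^sup>+t. F t + F (reflect i 0 t) \<partial>T3) = 2 * (\<integral>\<^sup>+t. F t \<partial>T3)"
    if [measurable]: "F \<in> borel_measurable borel" for F :: "R3 \<Rightarrow> ennreal"
  proof -
    have "(\<lambda>t. F (reflect i 0 t)) \<in> borel_measurable T3" "F \<in> borel_measurable T3"
      by (rule borel_measurable_T3, measurable)+
    then show ?thesis by (simp add: nn_integral_add nn_integral_T3_flip mult_2)
  qed
  have "2 * (\<integral>\<^sup>+t. ?F t \<partial>T3) = (\<integral>\<^sup>+t. ?F t + ?F (reflect i 0 t) \<partial>T3)" by (rule sum2[symmetric]) measurable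
  also have "\<dots> \<le> (\<integral>\<^sup>+t. ?G t + ?G (reflect i 0 t) \<partial>T3)"
    by (rule nn_integral_mono) (use le in auto)
  also have "\<dots> = 2 * (\<integral>\<^sup>+t. ?G t \<partial>T3)" by (rule sum2) measurable
  finally have "2 * ennreal (loop_int k z) \<le> 2 * ennreal (loop_int ?k z)" unfolding loop_int_nn[OF z] .
  then have "ennreal (2 * loop_int k z) \<le> ennreal (2 * loop_int ?k z)"
    by (simp add: ennreal_mult')
  then show ?thesis using loop_int_nonneg[OF z, of ?k] by (simp add: ennreal_le_iff)
qed

lemma loop_int_le_kcrit:
  assumes z: "18 < z" and k: "k \<in> cube3"
  shows "loop_int k z \<le> loop_int kcrit z"
proof -
  have b: "\<bar>k $ j\<bar> \<le> pi" for j
    using k[unfolded cube3_def mem_Collect_eq, rule_format, of j] by (simp add: abs_le_iff)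
  let ?u = "\<lambda>i k. (\<chi> j. if j = i then kcrit1 else k $ j) :: R3"
  have "loop_int k z \<le> loop_int (?u 1 k) z" by (rule loop_int_step[OF z]) (use b in auto)
  also have "\<dots> \<le> loop_int (?u 2 (?u 1 k)) z" by (rule loop_int_step[OF z]) (use b kcrit1_bound in auto)
  also have "\<dots> \<le> loop_int (?u 3 (?u 2 (?u 1 k))) z" by (rule loop_int_step[OF z]) (use b kcrit1_bound in auto)
  also have "?u 3 (?u 2 (?u 1 k)) = kcrit" by (simp add: kcrit_def vec_eq_iff forall_3)
  finally show ?thesis .
qed

lemma w2_0: "w2 0 t = (\<Sum>i\<in>UNIV. 2 - cos (t $ i) - cos (t $ i / 2))"
  by (simp add: w2_def eps_def sum_3)

lemma w2_0_ge: "eps t \<le> w2 0 t"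
  using eps_nonneg[of 0] eps_nonneg[of "(1 / 2) *\<^sub>R (0 + t)"] by (simp add: w2_def)

lemma w2_0_measurable [measurable]: "w2 0 \<in> borel_measurable borel"
  unfolding w2_0[abs_def] by measurable

lemma eps_pos:
  assumes "\<bar>t $ i\<bar> \<le> pi" "t $ i \<noteq> 0"
  shows "0 < eps t"
proof -
  have "0 < (t $ i)\<^sup>2 / 18" using assms(2) by simp
  also have "\<dots> \<le> 1 - cos (t $ i)" by (rule one_minus_cos_ge) (rule assms(1))
  also have "\<dots> \<le> eps t" unfolding eps_def
    by (rule member_le_sum[of i UNIV "\<lambda>i. 1 - cos (t $ i)"]) auto
  finally show ?thesis .
qed

lemma AE_eps_pos: "AE t in T3. 0 < eps t"
proof -
  from AE_T3_neq[of 1 0] AE_space[of T3] show ?thesis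
  proof eventually_elim
    case (elim t)
    then show ?case by (intro eps_pos[of t 1]) (auto simp: cube3_def abs_le_iff minus_le_iff less_imp_le)
  qed
qed

lemma integrable_I00: "integrable T3 (\<lambda>t. 1 / w2 0 t)"
proof (rule integrableI_nonneg)
  have [measurable]: "w2 0 \<in> borel_measurable T3" by (rule borel_measurable_T3) measurable
  show "(\<lambda>t. 1 / w2 0 t) \<in> borel_measurable T3" by measurable
  show "AE t in T3. 0 \<le> 1 / w2 0 t" using w2_0_ge eps_nonneg by (auto intro: order_trans)
  have "(\<integral>\<^sup>+t. ennreal (1 / w2 0 t) \<partial>T3) \<le> (\<integral>\<^sup>+t. ennreal (1 / eps t) \<partial>T3)"
    by (rule nn_integral_mono_AE)
      (use AE_eps_pos in \<open>auto elim!: eventually_mono intro!: ennreal_leI frac_le w2_0_ge\<close>)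
  also have "\<dots> < \<infinity>" by (rule nn_integral_inverse_eps)
  finally show "(\<integral>\<^sup>+t. ennreal (1 / w2 0 t) \<partial>T3) < \<infinity>" .
qed

lemma I00_nn: "(\<integral>\<^sup>+t. ennreal (1 / w2 0 t) \<partial>T3) = ennreal I00"
  unfolding I00_def
  by (rule nn_integral_eq_integral[OF integrable_I00])
    (use w2_0_ge eps_nonneg in \<open>auto intro: order_trans\<close>)

lemma I00_nonneg: "0 \<le> I00"
  unfolding I00_def by (rule Bochner_Integration.integral_nonneg) (use w2_0_ge eps_nonneg in \<open>auto intro: order_trans\<close>)

text \<open>At \<open>kcrit\<close> and s = 1 the denominator differs from that of
  \<open>I00\<close> only by z - 18 > 0. For s = -1 a comparison is possible after
  \<open>half_swap3\<close>: sin (y / 2) \<le> cos (half_swap y / 2), with equality for y > 0,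
  whereas for y < 0 the left side is negative. So \<open>I00\<close> bounds the loop integral at
  both edges, although it is not its edge value at the right one.\<close>

lemma loop_int_le_I00:
  assumes z: "18 < z" and k: "k \<in> cube3"
  shows "loop_int k z \<le> I00"
proof -
  have sum18: "18 - shifted_w2 kcrit t = (\<Sum>i\<in>UNIV. gap1 kcrit1 (t $ i))" for t
    by (simp add: shifted_w2_def kcrit_def)
  have "(\<integral>\<^sup>+t. ennreal (1 / (z - shifted_w2 kcrit t)) \<partial>T3) \<le> ennreal I00"
  proof (cases "s = 1")
    case True
    have w: "18 - shifted_w2 kcrit t = w2 0 t" for t
      unfolding sum18 w2_0 gap1_def kcrit1_def by (rule sum.cong) (use True in simp_all)
    have "(\<integral>\<^sup>+t. ennreal (1 / (z - shifted_w2 kcrit t)) \<partial>T3) \<le> (\<integral>\<^sup>+t. ennreal (1 / w2 0 t) \<partial>T3)"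
    proof (rule nn_integral_mono_AE, rule eventually_mono[OF AE_eps_pos])
      fix t :: R3 assume "0 < eps t"
      then have "0 < w2 0 t" using w2_0_ge[of t] by linarith
      then show "ennreal (1 / (z - shifted_w2 kcrit t)) \<le> ennreal (1 / w2 0 t)"
        using w[of t] z by (intro ennreal_leI frac_le) auto
    qed
    then show ?thesis unfolding I00_nn .
  next
    case False
    then have s1: "s = -1" using s by simp
    have "(\<integral>\<^sup>+t. ennreal (1 / (z - shifted_w2 kcrit t)) \<partial>T3) \<le> (\<integral>\<^sup>+t. ennreal (1 / w2 0 (half_swap3 t)) \<partial>T3)"
    proof (rule nn_integral_mono_AE)
      from AE_T3_neq[of 1 pi] AE_space[of T3]
      show "AE t in T3. ennreal (1 / (z - shifted_w2 kcrit t)) \<le> ennreal (1 / w2 0 (half_swap3 t))"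
      proof eventually_elim
        case (elim t)
        have t: "- pi < t $ i" "t $ i \<le> pi" for i using elim by (auto simp: cube3_def)
        have "\<bar>half_swap3 t $ 1\<bar> \<le> pi" "half_swap3 t $ 1 \<noteq> 0"
          using t[of 1] elim by (auto simp: half_swap3_def half_swap_def)
        then have "0 < eps (half_swap3 t)" by (rule eps_pos)
        then have pos: "0 < w2 0 (half_swap3 t)" using w2_0_ge[of "half_swap3 t"] by linarith
        have c: "2 - cos (half_swap y) - cos (half_swap y / 2) \<le> gap1 kcrit1 y" if y: "- pi < y" "y \<le> pi" for y
        proof -
          have "gap1 kcrit1 y = 2 + cos y - sin (y / 2)"
            unfolding gap1_def kcrit1_def unfolding s1 by (simp add: add_divide_distrib cos_add)
          moreover have "sin (y / 2) \<le> cos (half_swap y / 2)"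
          proof (cases "0 < y")
            case True
            then show ?thesis by (simp add: half_swap_def diff_divide_distrib cos_diff)
          next
            case False
            have "0 \<le> sin (- (y / 2))" using False y by (intro sin_ge_zero) auto
            then show ?thesis using False by (simp add: half_swap_def diff_divide_distrib cos_diff)
          qed
          ultimately show ?thesis by (simp add: half_swap_cos)
        qed
        have "w2 0 (half_swap3 t) \<le> 18 - shifted_w2 kcrit t"
          unfolding sum18 w2_0 by (rule sum_mono) (use c t in \<open>auto simp: half_swap3_def\<close>)
        then show ?case using pos z by (intro ennreal_leI frac_le) auto
      qed
    qed
    also have "\<dots> = (\<integral>\<^sup>+t. ennreal (1 / w2 0 t) \<partial>T3)"
      by (rule nn_integral_T3_half_swap3[of "\<lambda>t. ennreal (1 / w2 0 t)"]) measurable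
    finally show ?thesis unfolding I00_nn .
  qed
  then have "loop_int kcrit z \<le> I00" unfolding loop_int_nn[OF z] using I00_nonneg by (simp add: ennreal_le_iff)
  then show ?thesis using loop_int_le_kcrit[OF z k] by linarith
qed

text \<open>Near \<open>kcrit\<close> the integrand is of order \<open>\<bar>t - kcrit\<bar>\<close> to the power \<open>-4\<close> in three dimensions.\<close>

lemma not_integrable_inverse_square_kcrit: "\<not> integrable T3 (\<lambda>t. (1 / (18 - shifted_w2 kcrit t))\<^sup>2)"
proof
  assume int: "integrable T3 (\<lambda>t. (1 / (18 - shifted_w2 kcrit t))\<^sup>2)"
  define I where "I = (LINT t|T3. (1 / (18 - shifted_w2 kcrit t))\<^sup>2)"
  \<comment> \<open>The box of side d has a corner at \<open>kcrit\<close> and reaches from there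
    into the cube. On it the integrand is at least 1 / (9 d^4) and the volume is d^3. A small d then
    makes the lower bound equal to |I| + 1.\<close>
  have bound: "1 / (9 * d) \<le> I" if d: "0 < d" "d \<le> 1" for d
  proof -
    let ?l = "(\<chi> i. if s = 1 then 0 else pi - d) :: R3" and ?u = "(\<chi> i. if s = 1 then d else pi) :: R3"
    have lu: "?u $ i - ?l $ i = d" for i by simp
    have c: "gap1 kcrit1 y \<le> d\<^sup>2" if y: "?l $ i < y" "y < ?u $ i" for y i
    proof -
      define r where "r = (if s = 1 then y else pi - y)"
      have r: "0 \<le> r" "r \<le> d" using y by (auto simp: r_def split: if_splits)
      have "gap1 kcrit1 y = 2 - cos r - cos (r / 2)"
      proof (cases "s = 1")
        case True
        then show ?thesis unfolding gap1_def kcrit1_def r_def using True by simp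
      next
        case False
        then have "s = -1" using s by simp
        then show ?thesis unfolding gap1_def kcrit1_def r_def
          by (simp add: add_divide_distrib diff_divide_distrib cos_add cos_diff)
      qed
      also have "\<dots> \<le> r\<^sup>2 / 2 + (r / 2)\<^sup>2 / 2"
        using one_minus_cos_le[of r] one_minus_cos_le[of "r / 2"] by linarith
      also have "\<dots> \<le> r\<^sup>2" by (simp add: power_divide)
      also have "\<dots> \<le> d\<^sup>2" using r by (intro power_mono) auto
      finally show ?thesis .
    qed
    have ge: "ennreal (1 / (9 * d ^ 4)) * indicator (box ?l ?u) t
        \<le> ennreal ((1 / (18 - shifted_w2 kcrit t))\<^sup>2) * indicator cubeo t" if ne: "t $ 1 \<noteq> kcrit1" for t
    proof (cases "t \<in> box ?l ?u")
      case True
      then have t: "?l $ i < t $ i" "t $ i < ?u $ i" for i by (auto simp: mem_box_cart)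
      have tc: "t \<in> cubeo"
        unfolding cubeo_def mem_Collect_eq
      proof
        fix i show "- pi < t $ i \<and> t $ i < pi"
          using t[of i] d pi_gt3 by (auto split: if_splits)
      qed
      have le: "18 - shifted_w2 kcrit t \<le> 3 * d\<^sup>2"
      proof -
        have "18 - shifted_w2 kcrit t = (\<Sum>i\<in>UNIV. gap1 kcrit1 (t $ i))" by (simp add: shifted_w2_def kcrit_def)
        also have "\<dots> \<le> (\<Sum>i\<in>(UNIV::3 set). d\<^sup>2)"
          by (rule sum_mono) (use c t in blast)
        finally show ?thesis by simp
      qed
      have "0 < 18 - shifted_w2 kcrit t"
      proof -
        have "t \<in> cube3" using tc by (auto simp: cubeo_def cube3_def less_imp_le)
        moreover have "t \<noteq> kcrit" using ne by (auto simp: kcrit_def)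
        ultimately have "0 < gap t" using gap_zero_imp gap_nonneg[of t] by fastforce
        then show ?thesis using shifted_w2_le[of kcrit t] by simp
      qed
      then have "1 / (3 * d\<^sup>2) \<le> 1 / (18 - shifted_w2 kcrit t)" using le by (intro frac_le) auto
      then have "(1 / (3 * d\<^sup>2))\<^sup>2 \<le> (1 / (18 - shifted_w2 kcrit t))\<^sup>2" by (intro power_mono) auto
      moreover have "(1 / (3 * d\<^sup>2))\<^sup>2 = 1 / (9 * d ^ 4)" by (simp add: power_divide power_mult_distrib)
      ultimately show ?thesis using True tc by (simp add: ennreal_leI)
    qed simp
    have "ennreal (1 / (9 * d)) = ennreal (1 / (9 * d ^ 4)) * emeasure lborel (box ?l ?u)"
    proof -
      have "emeasure lborel (box ?l ?u) = ennreal (\<Prod>b\<in>Basis. (?u - ?l) \<bullet> b)"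
        by (rule emeasure_lborel_box) (use d in \<open>auto simp: Basis_vec_def inner_axis\<close>)
      also have "(\<Prod>b\<in>Basis. (?u - ?l) \<bullet> b) = d ^ 3"
        using prod_Basis_vec[of "\<lambda>x. x" "?u - ?l"] lu by simp
      finally have "emeasure lborel (box ?l ?u) = ennreal (d ^ 3)" .
      moreover have "1 / (9 * d) = 1 / (9 * d ^ 4) * d ^ 3" using d by (simp add: field_simps eval_nat_numeral)
      ultimately show ?thesis using d by (simp only: ennreal_mult' zero_le_power less_imp_le) (simp add: ennreal_mult'[symmetric])
    qed
    also have "\<dots> = (\<integral>\<^sup>+t. ennreal (1 / (9 * d ^ 4)) * indicator (box ?l ?u) t \<partial>lborel)"
      by (simp add: nn_integral_cmult)
    also have "\<dots> \<le> (\<integral>\<^sup>+t. ennreal ((1 / (18 - shifted_w2 kcrit t))\<^sup>2) * indicator cubeo t \<partial>lborel)"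
      by (rule nn_integral_mono_AE) (use AE_coord_neq[of 1 kcrit1] ge in \<open>auto elim!: eventually_mono\<close>)
    also have "\<dots> = (\<integral>\<^sup>+t. ennreal ((1 / (18 - shifted_w2 kcrit t))\<^sup>2) \<partial>T3)" by (rule nn_integral_T3[symmetric])
    also have "\<dots> = ennreal I" unfolding I_def by (rule nn_integral_eq_integral[OF int]) simp
    finally have "ennreal (1 / (9 * d)) \<le> ennreal I" .
    moreover have "0 \<le> I" unfolding I_def by (rule Bochner_Integration.integral_nonneg) simp
    ultimately show ?thesis by (simp add: ennreal_le_iff)
  qed
  define d where "d = 1 / (9 * (\<bar>I\<bar> + 1))"
  have "0 < d" by (simp add: d_def)
  moreover have "d \<le> 1" by (simp add: d_def divide_le_eq)
  ultimately have "1 / (9 * d) \<le> I" by (rule bound)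
  moreover have "1 / (9 * d) = \<bar>I\<bar> + 1" by (simp add: d_def)
  ultimately show False by linarith
qed

end

text \<open>A homogeneous linear system with more unknowns \<open>c j\<close> than equations. The
  induction removes equation i by a pivot l with \<open>x l i\<close> nonzero; \<open>e\<close>
  gives the pivot the value that equation i forces.\<close>

lemma exists_annihilating_combination:
  fixes x :: "'j \<Rightarrow> 'i \<Rightarrow> real"
  assumes "finite I" "finite J" "card I < card J"
  shows "\<exists>c. (\<exists>j\<in>J. c j \<noteq> 0) \<and> (\<forall>i\<in>I. (\<Sum>j\<in>J. c j * x j i) = 0)"
  using assms
proof (induction I arbitrary: J x rule: finite_induct)
  case empty
  then have "J \<noteq> {}" by auto
  then show ?case by (intro exI[of _ "\<lambda>_. 1"]) auto
next
  case (insert i I)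
  show ?case
  proof (cases "\<forall>j\<in>J. x j i = 0")
    case True
    have "card I < card J" using insert by simp
    then obtain c where "\<exists>j\<in>J. c j \<noteq> 0" "\<forall>i\<in>I. (\<Sum>j\<in>J. c j * x j i) = 0"
      using insert.IH[OF insert.prems(1)] by blast
    then show ?thesis using True by (intro exI[of _ c]) auto
  next
    case False
    then obtain l where l: "l \<in> J" "x l i \<noteq> 0" by blast
    let ?J = "J - {l}"
    have "card I < card ?J" using insert l by simp
    then obtain c where c: "\<exists>j\<in>?J. c j \<noteq> 0"
      "\<forall>a\<in>I. (\<Sum>j\<in>?J. c j * (x j a - x j i / x l i * x l a)) = 0"
      using insert.IH[of ?J "\<lambda>j a. x j a - x j i / x l i * x l a"] insert.prems by auto
    define e where "e = c(l := - (\<Sum>j\<in>?J. c j * (x j i / x l i)))"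
    have sum: "(\<Sum>j\<in>J. e j * x j a) = (\<Sum>j\<in>?J. c j * (x j a - x j i / x l i * x l a))" for a
    proof -
      have "(\<Sum>j\<in>J. e j * x j a) = e l * x l a + (\<Sum>j\<in>?J. e j * x j a)"
        by (rule sum.remove) (use insert.prems l in auto)
      also have "(\<Sum>j\<in>?J. e j * x j a) = (\<Sum>j\<in>?J. c j * x j a)"
        by (rule sum.cong) (auto simp: e_def)
      also have "e l * x l a = - (\<Sum>j\<in>?J. c j * (x j i / x l i) * x l a)"
        by (simp add: e_def sum_distrib_right)
      finally show ?thesis by (simp add: right_diff_distrib sum_subtractf mult.assoc)
    qed
    have "\<forall>a\<in>insert i I. (\<Sum>j\<in>J. e j * x j a) = 0"
      using c(2) l unfolding sum by auto
    moreover have "\<exists>j\<in>J. e j \<noteq> 0" using c(1) by (auto simp: e_def)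
    ultimately show ?thesis by blast
  qed
qed

section \<open>Square integrable functions\<close>

text \<open>Real functions suffice for the form argument: the operator matrix has real coefficients,
  so the real and imaginary parts of an eigenvector can be treated separately.\<close>

definition L2r :: "'a measure \<Rightarrow> ('a \<Rightarrow> real) \<Rightarrow> bool" where
  "L2r M f \<longleftrightarrow> f \<in> borel_measurable M \<and> integrable M (\<lambda>x. (f x)\<^sup>2)"

lemma L2r_meas: "L2r M f \<Longrightarrow> f \<in> borel_measurable M"
  by (simp add: L2r_def)

lemma L2r_mult:
  assumes "L2r M f" "L2r M g"
  shows "integrable M (\<lambda>x. f x * g x)"
proof (rule Bochner_Integration.integrable_bound)
  show "integrable M (\<lambda>x. (f x)\<^sup>2 + (g x)\<^sup>2)" using assms by (simp add: L2r_def)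
  have [measurable]: "f \<in> borel_measurable M" "g \<in> borel_measurable M"
    using assms by (simp_all add: L2r_def)
  show "(\<lambda>x. f x * g x) \<in> borel_measurable M" by measurable
  have "\<bar>a * b\<bar> \<le> a\<^sup>2 + b\<^sup>2" for a b :: real
  proof -
    have "0 \<le> (\<bar>a\<bar> - \<bar>b\<bar>)\<^sup>2" by simp
    then have "2 * (\<bar>a\<bar> * \<bar>b\<bar>) \<le> a\<^sup>2 + b\<^sup>2" by (simp add: power2_diff)
    moreover have "0 \<le> \<bar>a\<bar> * \<bar>b\<bar>" by simp
    ultimately show ?thesis unfolding abs_mult by linarith
  qed
  then show "AE x in M. norm (f x * g x) \<le> norm ((f x)\<^sup>2 + (g x)\<^sup>2)" by simp
qed

lemma L2r_add:
  assumes "L2r M f" "L2r M g"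
  shows "L2r M (\<lambda>x. f x + g x)"
proof -
  have "integrable M (\<lambda>x. (f x)\<^sup>2 + (g x)\<^sup>2 + 2 * (f x * g x))"
    using assms L2r_mult[OF assms] by (intro Bochner_Integration.integrable_add) (auto simp: L2r_def)
  moreover have "(\<lambda>x. f x + g x) \<in> borel_measurable M"
    by (intro borel_measurable_add L2r_meas assms)
  ultimately show ?thesis by (simp add: L2r_def power2_sum mult.assoc)
qed

lemma L2r_bounded_mult:
  assumes f: "L2r M f" and a: "a \<in> borel_measurable M" and b: "\<And>x. x \<in> space M \<Longrightarrow> \<bar>a x\<bar> \<le> B"
  shows "L2r M (\<lambda>x. a x * f x)"
  unfolding L2r_def
proof
  show m: "(\<lambda>x. a x * f x) \<in> borel_measurable M"
    by (intro borel_measurable_times a L2r_meas[OF f])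
  show "integrable M (\<lambda>x. (a x * f x)\<^sup>2)"
  proof (rule Bochner_Integration.integrable_bound)
    show "integrable M (\<lambda>x. B\<^sup>2 * (f x)\<^sup>2)" using f by (simp add: L2r_def)
    show "(\<lambda>x. (a x * f x)\<^sup>2) \<in> borel_measurable M" by (intro borel_measurable_power m)
    have "(a x)\<^sup>2 \<le> B\<^sup>2" if "x \<in> space M" for x
      using b[OF that] by (metis abs_ge_zero power2_abs power_mono)
    then show "AE x in M. norm ((a x * f x)\<^sup>2) \<le> norm (B\<^sup>2 * (f x)\<^sup>2)"
      by (intro AE_I2) (simp add: power_mult_distrib mult_right_mono)
  qed
qed

lemma L2r_scale: "L2r M f \<Longrightarrow> L2r M (\<lambda>x. c * f x)"
  using L2r_bounded_mult[of M f "\<lambda>_. c" "\<bar>c\<bar>"] by simp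

lemma L2r_zero: "L2r M (\<lambda>x. 0)"
  by (simp add: L2r_def)

lemma L2r_sum: "finite J \<Longrightarrow> (\<And>j. j \<in> J \<Longrightarrow> L2r M (f j)) \<Longrightarrow> L2r M (\<lambda>x. \<Sum>j\<in>J. c j * f j x)"
proof (induction J rule: finite_induct)
  case (insert i J)
  then show ?case using L2r_add[OF L2r_scale[of M "f i" "c i"]] by simp
qed (simp add: L2r_zero)

lemma (in finite_measure) L2r_integrable:
  assumes "L2r M f"
  shows "integrable M f"
proof -
  have "L2r M (\<lambda>_. 1)" by (simp add: L2r_def)
  from L2r_mult[OF assms this] show ?thesis by simp
qed

lemma integral_Cauchy_Schwarz:
  assumes "L2r M f" "L2r M g"
  shows "\<bar>LINT x|M. f x * g x\<bar> \<le> sqrt (LINT x|M. (f x)\<^sup>2) * sqrt (LINT x|M. (g x)\<^sup>2)"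
proof -
  have [measurable]: "f \<in> borel_measurable M" "g \<in> borel_measurable M"
    using assms by (simp_all add: L2r_def)
  let ?F = "LINT x|M. (f x)\<^sup>2" and ?G = "LINT x|M. (g x)\<^sup>2"
  have nn: "0 \<le> ?F" "0 \<le> ?G" by (simp_all add: Bochner_Integration.integral_nonneg)
  have abs: "(\<integral>\<^sup>+x. ennreal \<bar>f x\<bar> * ennreal \<bar>g x\<bar> \<partial>M) = ennreal (LINT x|M. \<bar>f x * g x\<bar>)"
    using integrable_abs[OF L2r_mult[OF assms]]
    by (subst nn_integral_eq_integral[symmetric]) (simp_all add: ennreal_mult' abs_mult)
  have sq: "(\<integral>\<^sup>+x. (ennreal \<bar>f x\<bar>)\<^sup>2 \<partial>M) = ennreal ?F" "(\<integral>\<^sup>+x. (ennreal \<bar>g x\<bar>)\<^sup>2 \<partial>M) = ennreal ?G"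
    using assms by (auto simp: L2r_def nn_integral_eq_integral[symmetric] ennreal_power)
  have "(ennreal (LINT x|M. \<bar>f x * g x\<bar>))\<^sup>2 \<le> ennreal ?F * ennreal ?G"
    unfolding abs[symmetric] sq[symmetric] by (rule Cauchy_Schwarz_nn_integral) measurable
  then have "ennreal ((LINT x|M. \<bar>f x * g x\<bar>)\<^sup>2) \<le> ennreal (?F * ?G)"
    using nn by (simp add: ennreal_power Bochner_Integration.integral_nonneg ennreal_mult')
  then have "(LINT x|M. \<bar>f x * g x\<bar>)\<^sup>2 \<le> ?F * ?G"
    using nn by (simp add: ennreal_le_iff)
  then have "(LINT x|M. \<bar>f x * g x\<bar>) \<le> sqrt (?F * ?G)" by (rule real_le_rsqrt)
  moreover have "\<bar>LINT x|M. f x * g x\<bar> \<le> (LINT x|M. \<bar>f x * g x\<bar>)"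
    by (rule integral_abs_bound)
  ultimately show ?thesis unfolding real_sqrt_mult by linarith
qed

lemma integrable_tensor:
  fixes f g :: "R3 \<Rightarrow> real"
  assumes "integrable T3 f" "integrable T3 g"
  shows "integrable T3T3 (\<lambda>x. f (fst x) * g (snd x))"
proof (rule T3T3.Fubini_integrable)
  have [measurable]: "f \<in> borel_measurable T3" "g \<in> borel_measurable T3" using assms by auto
  show "(\<lambda>x. f (fst x) * g (snd x)) \<in> borel_measurable T3T3" by measurable
  have "(LINT y|T3. norm (f (fst (x, y)) * g (snd (x, y)))) = \<bar>f x\<bar> * (LINT y|T3. \<bar>g y\<bar>)" for x
    by (simp add: abs_mult)
  then show "integrable T3 (\<lambda>x. LINT y|T3. norm (f (fst (x, y)) * g (snd (x, y))))"
    using assms by simp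
  show "AE x in T3. integrable T3 (\<lambda>y. f (fst (x, y)) * g (snd (x, y)))" using assms by simp
qed

lemma integral_tensor:
  fixes f g :: "R3 \<Rightarrow> real"
  assumes "integrable T3 f" "integrable T3 g"
  shows "(LINT x|T3T3. f (fst x) * g (snd x)) = (LINT k|T3. f k) * (LINT k|T3. g k)"
proof -
  have "(LINT x|T3T3. f (fst x) * g (snd x)) = (LINT k|T3. LINT p|T3. f k * g p)"
    using T3T3.integral_fst'[OF integrable_tensor[OF assms]] by simp
  then show ?thesis by simp
qed

lemma L2r_tensor:
  assumes "L2r T3 f" "L2r T3 g"
  shows "L2r T3T3 (\<lambda>x. f (fst x) * g (snd x))"
proof -
  have [measurable]: "f \<in> borel_measurable T3" "g \<in> borel_measurable T3" using assms by (auto simp: L2r_def)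
  have "integrable T3T3 (\<lambda>x. (f (fst x))\<^sup>2 * (g (snd x))\<^sup>2)"
    using integrable_tensor[of "\<lambda>x. (f x)\<^sup>2" "\<lambda>x. (g x)\<^sup>2"] assms by (simp add: L2r_def)
  then show ?thesis by (simp add: L2r_def power_mult_distrib)
qed

lemma L2r_const: "L2r T3 (\<lambda>_. c)"
  by (simp add: L2r_def)

lemma L2r_fst: "L2r T3 f \<Longrightarrow> L2r T3T3 (\<lambda>x. f (fst x))"
  using L2r_tensor[OF _ L2r_const[of 1], of f] by simp

lemma L2r_snd: "L2r T3 f \<Longrightarrow> L2r T3T3 (\<lambda>x. f (snd x))"
  using L2r_tensor[OF L2r_const[of 1], of f] by simp

section \<open>Kernels of finite rank\<close>

definition bounded_meas :: "(R3 \<Rightarrow> real) \<Rightarrow> bool" where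
  "bounded_meas a \<longleftrightarrow> a \<in> borel_measurable T3 \<and> (\<exists>B. \<forall>t. \<bar>a t\<bar> \<le> B)"

lemma bounded_meas_mult: "bounded_meas a \<Longrightarrow> bounded_meas b \<Longrightarrow> bounded_meas (\<lambda>t. a t * b t)"
  unfolding bounded_meas_def
proof safe
  fix A B assume "\<forall>t. \<bar>a t\<bar> \<le> A" "\<forall>t. \<bar>b t\<bar> \<le> B"
  then have "\<bar>a t * b t\<bar> \<le> A * B" for t
    unfolding abs_mult by (intro mult_mono) (auto intro: order_trans[OF abs_ge_zero])
  then show "\<exists>B. \<forall>t. \<bar>a t * b t\<bar> \<le> B" by blast
qed auto

lemma bounded_meas_const: "bounded_meas (\<lambda>_. c)"
  by (auto simp: bounded_meas_def)

lemma bounded_meas_trig: "bounded_meas (\<lambda>t. cos (t $ i / c))" "bounded_meas (\<lambda>t. sin (t $ i / c))"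
proof -
  have "(\<lambda>t. sin (t $ i / c)) \<in> borel_measurable T3"
    by (rule borel_measurable_continuous_on[where f = sin]) (auto intro!: continuous_intros)
  then show "bounded_meas (\<lambda>t. cos (t $ i / c))" "bounded_meas (\<lambda>t. sin (t $ i / c))"
    unfolding bounded_meas_def by (auto intro!: exI[of _ 1])
qed

lemma bounded_meas_integrable:
  assumes "bounded_meas a" "integrable T3 f"
  shows "integrable T3 (\<lambda>t. a t * f t)"
proof -
  obtain B where B: "\<And>t. \<bar>a t\<bar> \<le> B" using assms(1) by (auto simp: bounded_meas_def)
  have [measurable]: "a \<in> borel_measurable T3" "f \<in> borel_measurable T3" using assms by (auto simp: bounded_meas_def)
  show ?thesis
  proof (rule Bochner_Integration.integrable_bound)
    show "integrable T3 (\<lambda>t. B * f t)" using assms(2) by simp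
    show "AE t in T3. norm (a t * f t) \<le> norm (B * f t)"
      using B by (intro AE_I2) (simp add: abs_mult mult_right_mono order_trans[OF _ abs_ge_self])
  qed measurable
qed

text \<open>Finite sums of products of bounded functions of one variable. Sums are built in, so
  closure under products, and hence under powers, is a plain induction.\<close>

inductive finrank :: "(R3 \<Rightarrow> R3 \<Rightarrow> real) \<Rightarrow> bool" where
  one: "bounded_meas a \<Longrightarrow> bounded_meas b \<Longrightarrow> finrank (\<lambda>k p. a k * b p)"
| add: "finrank K \<Longrightarrow> finrank L \<Longrightarrow> finrank (\<lambda>k p. K k p + L k p)"

lemma finrank_const: "finrank (\<lambda>k p. c)"
  using finrank.one[OF bounded_meas_const[of c] bounded_meas_const[of 1]] by simp

lemma finrank_left: "bounded_meas a \<Longrightarrow> finrank (\<lambda>k p. a k)"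
  using finrank.one[OF _ bounded_meas_const[of 1], of a] by simp

lemma finrank_right: "bounded_meas a \<Longrightarrow> finrank (\<lambda>k p. a p)"
  using finrank.one[OF bounded_meas_const[of 1], of a] by simp

lemma finrank_mult_one:
  assumes "finrank K" "bounded_meas a" "bounded_meas b"
  shows "finrank (\<lambda>k p. (a k * b p) * K k p)"
  using assms
proof (induction rule: finrank.induct)
  case (one c d)
  have "finrank (\<lambda>k p. (a k * c k) * (b p * d p))"
    by (intro finrank.one bounded_meas_mult one)
  then show ?case by (simp add: mult_ac)
next
  case (add K L)
  then show ?case using finrank.add[of "\<lambda>k p. (a k * b p) * K k p" "\<lambda>k p. (a k * b p) * L k p"]
    by (simp add: distrib_left)
qed

lemma finrank_mult:
  assumes "finrank K" "finrank L"
  shows "finrank (\<lambda>k p. K k p * L k p)"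
  using assms(1)
proof (induction rule: finrank.induct)
  case (one a b)
  then show ?case using finrank_mult_one[OF assms(2)] by simp
next
  case (add K1 K2)
  then show ?case using finrank.add[of "\<lambda>k p. K1 k p * L k p" "\<lambda>k p. K2 k p * L k p"]
    by (simp add: distrib_right)
qed

lemma finrank_power: "finrank K \<Longrightarrow> finrank (\<lambda>k p. K k p ^ n)"
  by (induction n) (auto intro: finrank_const finrank_mult)

lemma finrank_sum:
  "finite I \<Longrightarrow> (\<And>i. i \<in> I \<Longrightarrow> finrank (K i)) \<Longrightarrow> finrank (\<lambda>k p. \<Sum>i\<in>I. K i k p)"
  by (induction I rule: finite_induct) (auto intro: finrank_const finrank.add)

definition quad :: "(R3 \<Rightarrow> R3 \<Rightarrow> real) \<Rightarrow> (R3 \<Rightarrow> real) \<Rightarrow> R3 \<times> R3 \<Rightarrow> real" where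
  "quad K f x = K (fst x) (snd x) * (f (fst x) * f (snd x))"

text \<open>For a sum of a_i(k) b_i(p) the quadratic form is the sum of the products of the
  integrals of a_i f and b_i f, so it vanishes once the left factors annihilate f. The finite set is
  chosen before f.\<close>

lemma finrank_annihilator:
  assumes "finrank K"
  shows "\<exists>A. finite A \<and> (\<forall>a\<in>A. bounded_meas a) \<and> (\<forall>f. integrable T3 f \<longrightarrow> (\<forall>a\<in>A. (LINT t|T3. a t * f t) = 0) \<longrightarrow>
    integrable T3T3 (quad K f) \<and> (LINT x|T3T3. quad K f x) = 0)"
  using assms
proof (induction rule: finrank.induct)
  case (one a b)
  have "integrable T3T3 (quad (\<lambda>k p. a k * b p) f) \<and> (LINT x|T3T3. quad (\<lambda>k p. a k * b p) f x) = 0"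
    if f: "integrable T3 f" and 0: "(LINT t|T3. a t * f t) = 0" for f
  proof -
    have e: "quad (\<lambda>k p. a k * b p) f = (\<lambda>x. (a (fst x) * f (fst x)) * (b (snd x) * f (snd x)))"
      by (simp add: quad_def fun_eq_iff mult_ac)
    show ?thesis
      unfolding e using integrable_tensor[of "\<lambda>t. a t * f t" "\<lambda>t. b t * f t"]
        integral_tensor[of "\<lambda>t. a t * f t" "\<lambda>t. b t * f t"] bounded_meas_integrable[OF one(1) f] bounded_meas_integrable[OF one(2) f] 0
      by simp
  qed
  then show ?case using one by (intro exI[of _ "{a}"]) auto
next
  case (add K L)
  then obtain A B where AB: "finite A" "\<forall>a\<in>A. bounded_meas a" "finite B" "\<forall>a\<in>B. bounded_meas a"
    and A: "\<And>f. integrable T3 f \<Longrightarrow> \<forall>a\<in>A. (LINT t|T3. a t * f t) = 0 \<Longrightarrow>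
      integrable T3T3 (quad K f) \<and> (LINT x|T3T3. quad K f x) = 0"
    and B: "\<And>f. integrable T3 f \<Longrightarrow> \<forall>a\<in>B. (LINT t|T3. a t * f t) = 0 \<Longrightarrow>
      integrable T3T3 (quad L f) \<and> (LINT x|T3T3. quad L f x) = 0" by blast
  have e: "quad (\<lambda>k p. K k p + L k p) f = (\<lambda>x. quad K f x + quad L f x)" for f
    by (simp add: quad_def fun_eq_iff algebra_simps)
  show ?case
    unfolding e using AB A B by (intro exI[of _ "A \<union> B"]) auto
qed

section \<open>The geometric series of the kernel and its remainder\<close>

context side begin

text \<open>The cosine of the half sum splits by the addition theorem; every other term depends on
  one variable only.\<close>

lemma finrank_shifted_w2: "finrank shifted_w2"
proof -
  have c: "finrank (\<lambda>k p. gap1 (k $ i) (p $ i))" for i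
  proof -
    have "finrank (\<lambda>k p. 3 + ((- s) * cos (k $ i / 1) + ((- s) * cos (p $ i / 1) +
        (((- s) * cos (k $ i / 2)) * cos (p $ i / 2) + (s * sin (k $ i / 2)) * sin (p $ i / 2)))))"
      by (intro finrank.add finrank_const finrank_left[OF bounded_meas_mult] finrank_right[OF bounded_meas_mult] finrank.one bounded_meas_mult bounded_meas_const bounded_meas_trig)
    then show ?thesis
      by (simp add: gap1_def add_divide_distrib cos_add algebra_simps)
  qed
  have "finrank (\<lambda>k p. 18 + (-1) * (\<Sum>i\<in>UNIV. gap1 (k $ i) (p $ i)))"
    by (intro finrank.add finrank_const finrank_mult finrank_sum c) auto
  then show ?thesis by (simp add: shifted_w2_def[abs_def])
qed

definition tail :: "nat \<Rightarrow> real \<Rightarrow> R3 \<Rightarrow> R3 \<Rightarrow> real" where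
  "tail N z k p = (shifted_w2 k p / z) ^ N / (z - shifted_w2 k p)"

lemma kernel_expansion:
  assumes "18 < z"
  shows "1 / (z - shifted_w2 k p) = (\<Sum>n<N. (1 / z ^ Suc n) * shifted_w2 k p ^ n) + tail N z k p"
proof -
  let ?v = "shifted_w2 k p"
  have z: "z \<noteq> 0" "z - ?v \<noteq> 0" using assms shifted_w2_le_18[of k p] by auto
  have "(\<Sum>n<N. (1 / z ^ Suc n) * ?v ^ n) = (\<Sum>n<N. (?v / z) ^ n) / z"
    by (simp add: sum_divide_distrib power_divide mult.commute)
  also have "(\<Sum>n<N. (?v / z) ^ n) = (1 - (?v / z) ^ N) / (1 - ?v / z)"
    using sum_gp_strict[of "?v / z" N] z by auto
  also have "\<dots> / z = (1 - (?v / z) ^ N) / (z - ?v)"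
    using z by (simp add: field_simps)
  finally show ?thesis by (simp add: tail_def diff_divide_distrib)
qed

text \<open>The tail decreases in z, so one bound at z = E covers all z > E. The strict bound on
  \<open>shifted_w2\<close> keeps the denominator at z = E positive, also when E = 18.\<close>

lemma tail_mono:
  assumes "18 \<le> E" "E < z" "shifted_w2 k p < 18"
  shows "0 \<le> tail N z k p" "tail N z k p \<le> tail N E k p"
proof -
  show "0 \<le> tail N z k p" unfolding tail_def using assms shifted_w2_nonneg[of k p] by auto
  show "tail N z k p \<le> tail N E k p" unfolding tail_def
    using assms shifted_w2_nonneg[of k p] by (intro frac_le power_mono zero_le_power) (auto intro!: divide_left_mono)
qed

lemma tail_measurable [measurable]: "(\<lambda>x. tail N z (fst x) (snd x)) \<in> borel_measurable T3T3"
  unfolding tail_def by measurable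

lemma AE_shifted_w2_less_18: "AE x in T3T3. shifted_w2 (fst x) (snd x) < 18"
proof (rule T3T3.AE_pair_measure)
  show "{x \<in> space T3T3. shifted_w2 (fst x) (snd x) < 18} \<in> sets T3T3" by measurable
  have "AE y in T3. shifted_w2 x y < 18" for x
    using AE_gap_pos shifted_w2_le[of x] gap_nonneg[of x] by (auto elim!: eventually_mono) (smt (verit))
  then show "AE x in T3. AE y in T3. shifted_w2 (fst (x, y)) (snd (x, y)) < 18" by simp
qed

text \<open>The ratio \<open>shifted_w2 / E\<close> is below 1 almost everywhere even if E = 18, so
  the tail tends to 0 pointwise. The weighted square of the full kernel is the dominating
  function.\<close>

lemma tail_square_limit:
  assumes E: "18 \<le> E" and [measurable]: "d \<in> borel_measurable T3"
    and int: "integrable T3T3 (\<lambda>x. (1 / (E - shifted_w2 (fst x) (snd x)))\<^sup>2 / (d (fst x) * d (snd x)))"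
    and d: "\<And>k. 0 \<le> d k"
  shows "integrable T3T3 (\<lambda>x. (tail N E (fst x) (snd x))\<^sup>2 / (d (fst x) * d (snd x)))"
    and "(\<lambda>N. LINT x|T3T3. (tail N E (fst x) (snd x))\<^sup>2 / (d (fst x) * d (snd x))) \<longlonglongrightarrow> 0"
proof -
  let ?w = "\<lambda>x. (1 / (E - shifted_w2 (fst x) (snd x)))\<^sup>2 / (d (fst x) * d (snd x))"
  let ?s = "\<lambda>N x. (tail N E (fst x) (snd x))\<^sup>2 / (d (fst x) * d (snd x))"
  have bound: "AE x in T3T3. norm (?s N x) \<le> ?w x" for N
    using AE_shifted_w2_less_18
  proof eventually_elim
    case (elim x)
    have v: "0 \<le> shifted_w2 (fst x) (snd x) / E" "shifted_w2 (fst x) (snd x) / E \<le> 1"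
      using elim E shifted_w2_nonneg[of "fst x" "snd x"] by auto
    have "tail N E (fst x) (snd x) \<le> 1 / (E - shifted_w2 (fst x) (snd x))"
      unfolding tail_def using v elim E by (intro divide_right_mono power_le_one) auto
    moreover have "0 \<le> tail N E (fst x) (snd x)"
      unfolding tail_def using v elim E by auto
    ultimately have "(tail N E (fst x) (snd x))\<^sup>2 \<le> (1 / (E - shifted_w2 (fst x) (snd x)))\<^sup>2"
      by (rule power_mono)
    then have "?s N x \<le> ?w x" using d by (intro divide_right_mono) auto
    moreover have "0 \<le> ?s N x" using d by simp
    ultimately show ?case by simp
  qed
  have lim: "AE x in T3T3. (\<lambda>N. ?s N x) \<longlonglongrightarrow> 0"
    using AE_shifted_w2_less_18
  proof eventually_elim
    case (elim x)
    let ?r = "shifted_w2 (fst x) (snd x) / E"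
    have "\<bar>?r\<bar> < 1" using elim E shifted_w2_nonneg[of "fst x" "snd x"] by auto
    then have "(\<lambda>N. ?r ^ N) \<longlonglongrightarrow> 0" by (simp add: LIMSEQ_power_zero)
    then show ?case unfolding tail_def
      by (intro tendsto_divide_zero tendsto_null_power) simp_all
  qed
  have m: "\<And>i. ?s i \<in> borel_measurable T3T3" by measurable
  show "integrable T3T3 (?s N)"
    by (rule integrable_dominated_convergence2[OF _ m int lim bound]) simp
  have "(\<lambda>N. LINT x|T3T3. ?s N x) \<longlonglongrightarrow> (LINT x|T3T3. 0)"
    by (rule integral_dominated_convergence[OF _ m int lim bound]) simp
  then show "(\<lambda>N. LINT x|T3T3. ?s N x) \<longlonglongrightarrow> 0" by simp
qed

end

section \<open>Finiteness above the edge\<close>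

definition avg :: "(R3 \<Rightarrow> real) \<Rightarrow> R3 \<times> R3 \<Rightarrow> real" where
  "avg f x = (f (fst x) + f (snd x)) / 2"

definition sym2 :: "(R3 \<times> R3 \<Rightarrow> real) \<Rightarrow> bool" where
  "sym2 F \<longleftrightarrow> (AE x in T3T3. F (fst x, snd x) = F (snd x, fst x))"

lemma L2r_avg: "L2r T3 f \<Longrightarrow> L2r T3T3 (avg f)"
  using L2r_scale[OF L2r_add[OF L2r_fst L2r_snd], of f f "1/2"]
  by (simp add: avg_def[abs_def])

lemma integral_swap:
  fixes h :: "R3 \<times> R3 \<Rightarrow> real"
  assumes "h \<in> borel_measurable T3T3"
  shows "(LINT x|T3T3. h (snd x, fst x)) = (LINT x|T3T3. h x)"
  using T3T3.integral_product_swap[OF assms] unfolding case_prod_unfold .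

text \<open>Symmetry of F makes the integrals of F against g(k) and against g(p) equal. This is the
  adjointness of \<open>A12\<close> and \<open>A12_adj\<close>, in real form.\<close>

lemma integral_marginal_mult:
  assumes F: "L2r T3T3 F" and sym: "sym2 F" and g: "L2r T3 g"
  shows "integrable T3 (\<lambda>k. (LINT t|T3. F (k, t)) * g k)"
    and "(LINT k|T3. (LINT t|T3. F (k, t)) * g k) = (LINT x|T3T3. F x * avg g x)"
proof -
  have [measurable]: "F \<in> borel_measurable T3T3" "g \<in> borel_measurable T3"
    using F g by (simp_all add: L2r_def)
  have i1: "integrable T3T3 (\<lambda>x. F x * g (fst x))" and i2: "integrable T3T3 (\<lambda>x. F x * g (snd x))"
    using L2r_mult[OF F L2r_fst[OF g]] L2r_mult[OF F L2r_snd[OF g]] .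
  show "integrable T3 (\<lambda>k. (LINT t|T3. F (k, t)) * g k)"
    using T3T3.integrable_fst'[OF i1] by simp
  have "(LINT k|T3. (LINT t|T3. F (k, t)) * g k) = (LINT x|T3T3. F x * g (fst x))"
    using T3T3.integral_fst'[OF i1] by simp
  moreover have "(LINT x|T3T3. F x * g (fst x)) = (LINT x|T3T3. F (snd x, fst x) * g (snd x))"
    using integral_swap[of "\<lambda>x. F x * g (fst x)"] by simp
  moreover have "(LINT x|T3T3. F (snd x, fst x) * g (snd x)) = (LINT x|T3T3. F x * g (snd x))"
    by (rule integral_cong_AE) (use sym in \<open>auto simp: sym2_def elim!: eventually_mono\<close>)
  moreover have "(LINT x|T3T3. F x * avg g x) = ((LINT x|T3T3. F x * g (fst x)) + (LINT x|T3T3. F x * g (snd x))) / 2"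
    using i1 i2 by (simp add: avg_def Bochner_Integration.integral_add[symmetric] distrib_left del: Bochner_Integration.integral_add)
  ultimately show "(LINT k|T3. (LINT t|T3. F (k, t)) * g k) = (LINT x|T3T3. F x * avg g x)"
    by simp
qed

section \<open>The quadratic form of the transformed operator\<close>

context side begin

definition vF :: "(R3 \<times> R3 \<Rightarrow> real) \<Rightarrow> R3 \<times> R3 \<Rightarrow> real" where
  "vF F x = shifted_w2 (fst x) (snd x) * F x"

lemma L2r_vF: "L2r T3T3 F \<Longrightarrow> L2r T3T3 (vF F)"
  unfolding vF_def[abs_def]
  by (rule L2r_bounded_mult[where B = 18]) (simp_all add: abs_of_nonneg shifted_w2_nonneg shifted_w2_le_18)

text \<open>The operator matrix with diagonal entries u and \<open>shifted_w2\<close> and coupling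
  m. It is a relation because images are determined only up to null sets; they are later read off
  from eigenvalue equations.\<close>

definition is_image :: "(R3 \<Rightarrow> real) \<Rightarrow> real \<Rightarrow> (R3 \<Rightarrow> real) \<Rightarrow> (R3 \<times> R3 \<Rightarrow> real) \<Rightarrow>
    (R3 \<Rightarrow> real) \<Rightarrow> (R3 \<times> R3 \<Rightarrow> real) \<Rightarrow> bool" where
  "is_image u m f F f' F' \<longleftrightarrow>
     (AE k in T3. f' k = u k * f k + m * (LINT t|T3. F (k, t))) \<and>
     (AE x in T3T3. F' x = vF F x + m * avg f x)"

definition ip :: "(R3 \<Rightarrow> real) \<Rightarrow> (R3 \<times> R3 \<Rightarrow> real) \<Rightarrow> (R3 \<Rightarrow> real) \<Rightarrow> (R3 \<times> R3 \<Rightarrow> real) \<Rightarrow> real" where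
  "ip f F g G = (LINT k|T3. f k * g k) + (LINT x|T3T3. F x * G x)"

text \<open>Written without images, so that its symmetry under exchange of (f, F) and (g, G) is
  evident; orthogonality of eigenvectors rests on it.\<close>

definition form :: "(R3 \<Rightarrow> real) \<Rightarrow> real \<Rightarrow> (R3 \<Rightarrow> real) \<Rightarrow> (R3 \<times> R3 \<Rightarrow> real) \<Rightarrow>
    (R3 \<Rightarrow> real) \<Rightarrow> (R3 \<times> R3 \<Rightarrow> real) \<Rightarrow> real" where
  "form u m f F g G = (LINT k|T3. u k * f k * g k) + (LINT x|T3T3. vF F x * G x)
     + m * ((LINT x|T3T3. F x * avg g x) + (LINT x|T3T3. G x * avg f x))"

lemma ip_image:
  assumes im: "is_image u m f F f' F'"
    and L: "L2r T3 f" "L2r T3T3 F" "L2r T3 f'" "L2r T3T3 F'" "L2r T3 g" "L2r T3T3 G"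
    and sym: "sym2 F" and u: "u \<in> borel_measurable T3" "\<And>k. \<bar>u k\<bar> \<le> U"
  shows "ip f' F' g G = form u m f F g G"
proof -
  have [measurable]: "f \<in> borel_measurable T3" "F \<in> borel_measurable T3T3" "f' \<in> borel_measurable T3"
    "F' \<in> borel_measurable T3T3" "g \<in> borel_measurable T3" "G \<in> borel_measurable T3T3"
    using L by (simp_all add: L2r_def)
  note [measurable] = u(1)
  have uf: "L2r T3 (\<lambda>k. u k * f k)" by (rule L2r_bounded_mult[OF L(1) u(1) u(2)])
  have i1: "integrable T3 (\<lambda>k. (u k * f k) * g k)" by (rule L2r_mult[OF uf L(5)])
  note m = integral_marginal_mult[OF L(2) sym L(5)]
  have "(LINT k|T3. f' k * g k) = (LINT k|T3. (u k * f k) * g k + m * ((LINT t|T3. F (k, t)) * g k))"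
    by (rule integral_cong_AE) (use im in \<open>auto simp: is_image_def distrib_right elim!: eventually_mono\<close>)
  also have "\<dots> = (LINT k|T3. u k * f k * g k) + m * (LINT x|T3T3. F x * avg g x)"
    using i1 m(1) by (subst Bochner_Integration.integral_add) (simp_all add: m(2))
  finally have A: "(LINT k|T3. f' k * g k) = (LINT k|T3. u k * f k * g k) + m * (LINT x|T3T3. F x * avg g x)" .
  have av: "L2r T3T3 (avg f)" by (rule L2r_avg[OF L(1)])
  have [measurable]: "avg f \<in> borel_measurable T3T3" "vF F \<in> borel_measurable T3T3"
    using L2r_meas[OF av] L2r_meas[OF L2r_vF[OF L(2)]] .
  have j: "integrable T3T3 (\<lambda>x. vF F x * G x)" "integrable T3T3 (\<lambda>x. G x * avg f x)"
    using L2r_mult[OF L2r_vF[OF L(2)] L(6)] L2r_mult[OF L(6) av] .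
  have "(LINT x|T3T3. F' x * G x) = (LINT x|T3T3. vF F x * G x + m * (G x * avg f x))"
    by (rule integral_cong_AE) (use im in \<open>auto simp: is_image_def algebra_simps elim!: eventually_mono\<close>)
  also have "\<dots> = (LINT x|T3T3. vF F x * G x) + m * (LINT x|T3T3. G x * avg f x)"
    using j by simp
  finally show ?thesis using A by (simp add: ip_def form_def algebra_simps)
qed

lemma integral_loop_int:
  assumes z: "18 < z" and f: "L2r T3 f"
  shows "integrable T3T3 (\<lambda>x. 1 / (z - shifted_w2 (fst x) (snd x)) * (f (fst x))\<^sup>2)"
    and "integrable T3T3 (\<lambda>x. 1 / (z - shifted_w2 (fst x) (snd x)) * (f (snd x))\<^sup>2)"
    and "(LINT x|T3T3. 1 / (z - shifted_w2 (fst x) (snd x)) * (f (fst x))\<^sup>2) = (LINT k|T3. loop_int k z * (f k)\<^sup>2)"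
    and "(LINT x|T3T3. 1 / (z - shifted_w2 (fst x) (snd x)) * (f (snd x))\<^sup>2) = (LINT k|T3. loop_int k z * (f k)\<^sup>2)"
    and "integrable T3 (\<lambda>k. loop_int k z * (f k)\<^sup>2)"
proof -
  have [measurable]: "f \<in> borel_measurable T3" using f by (simp add: L2r_def)
  have b: "\<bar>1 / (z - shifted_w2 k p)\<bar> \<le> 1 / (z - 18)" for k p
    using inverse_z_shifted_w2_bounds[OF z, of k p] by linarith
  show i1: "integrable T3T3 (\<lambda>x. 1 / (z - shifted_w2 (fst x) (snd x)) * (f (fst x))\<^sup>2)"
  proof (rule Bochner_Integration.integrable_bound)
    show "integrable T3T3 (\<lambda>x. 1 / (z - 18) * (f (fst x))\<^sup>2)"
      using L2r_fst[OF f] by (simp add: L2r_def)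
    show "AE x in T3T3. norm (1 / (z - shifted_w2 (fst x) (snd x)) * (f (fst x))\<^sup>2) \<le> norm (1 / (z - 18) * (f (fst x))\<^sup>2)"
      using b order_trans[OF b abs_ge_self] by (intro AE_I2) (simp only: real_norm_def abs_mult, intro mult_right_mono, auto)
  qed measurable
  have e: "(LINT t|T3. 1 / (z - shifted_w2 (fst (k, t)) (snd (k, t))) * (f (fst (k, t)))\<^sup>2) = loop_int k z * (f k)\<^sup>2" for k
    unfolding loop_int_def by (simp only: fst_conv snd_conv Bochner_Integration.integral_mult_left_zero)
  show 3: "(LINT x|T3T3. 1 / (z - shifted_w2 (fst x) (snd x)) * (f (fst x))\<^sup>2) = (LINT k|T3. loop_int k z * (f k)\<^sup>2)"
    using T3T3.integral_fst'[OF i1] unfolding e by simp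
  show "integrable T3 (\<lambda>k. loop_int k z * (f k)\<^sup>2)"
    using T3T3.integrable_fst'[OF i1] unfolding e .
  have "integrable T3T3 (\<lambda>(x, y). 1 / (z - shifted_w2 y x) * (f y)\<^sup>2)"
    using T3T3.integrable_product_swap[OF i1] by (simp only: fst_conv snd_conv)
  then show "integrable T3T3 (\<lambda>x. 1 / (z - shifted_w2 (fst x) (snd x)) * (f (snd x))\<^sup>2)"
    unfolding case_prod_beta by (subst shifted_w2_sym)
  have "(LINT x|T3T3. 1 / (z - shifted_w2 (snd x) (fst x)) * (f (snd x))\<^sup>2) = (LINT k|T3. loop_int k z * (f k)\<^sup>2)"
    using integral_swap[of "\<lambda>x. 1 / (z - shifted_w2 (fst x) (snd x)) * (f (fst x))\<^sup>2"] unfolding 3 by simp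
  then show "(LINT x|T3T3. 1 / (z - shifted_w2 (fst x) (snd x)) * (f (snd x))\<^sup>2) = (LINT k|T3. loop_int k z * (f k)\<^sup>2)"
    by (subst shifted_w2_sym)
qed

lemma integrable_quad_kernel:
  assumes z: "18 < z" and f: "L2r T3 f"
  shows "integrable T3T3 (quad (\<lambda>k p. 1 / (z - shifted_w2 k p)) f)"
proof (rule Bochner_Integration.integrable_bound)
  have [measurable]: "f \<in> borel_measurable T3" using f by (simp add: L2r_def)
  have b: "\<bar>1 / (z - shifted_w2 k p)\<bar> \<le> \<bar>1 / (z - 18)\<bar>" for k p
    using inverse_z_shifted_w2_bounds[OF z, of k p] by linarith
  have "integrable T3 f" by (rule T3.L2r_integrable[OF f])
  then show "integrable T3T3 (\<lambda>x. 1 / (z - 18) * (f (fst x) * f (snd x)))"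
    by (intro Bochner_Integration.integrable_mult_right integrable_tensor)
  show "quad (\<lambda>k p. 1 / (z - shifted_w2 k p)) f \<in> borel_measurable T3T3"
    unfolding quad_def[abs_def] by measurable
  show "AE x in T3T3. norm (quad (\<lambda>k p. 1 / (z - shifted_w2 k p)) f x) \<le> norm (1 / (z - 18) * (f (fst x) * f (snd x)))"
    using b by (intro AE_I2) (simp only: quad_def real_norm_def abs_mult mult_right_mono abs_ge_zero mult_nonneg_nonneg)
qed

text \<open>The square is completed in the two-particle component.\<close>

lemma form_bound:
  assumes z: "18 < z" and f: "L2r T3 f" and F: "L2r T3T3 F"
    and u: "u \<in> borel_measurable T3" "\<And>k. \<bar>u k\<bar> \<le> U"
  shows "(LINT k|T3. (z - u k - m\<^sup>2 / 2 * loop_int k z) * (f k)\<^sup>2)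
      - m\<^sup>2 / 2 * (LINT x|T3T3. quad (\<lambda>k p. 1 / (z - shifted_w2 k p)) f x)
    \<le> z * ip f F f F - form u m f F f F"
proof -
  let ?Q = "\<lambda>x. 1 / (z - shifted_w2 (fst x) (snd x))"
  have [measurable]: "f \<in> borel_measurable T3" "F \<in> borel_measurable T3T3"
    using f F by (simp_all add: L2r_def)
  note J = integral_loop_int[OF z f] and q = integrable_quad_kernel[OF z f]
  have f2: "integrable T3 (\<lambda>k. (f k)\<^sup>2)" using f by (simp add: L2r_def)
  have uf2: "integrable T3 (\<lambda>k. u k * (f k)\<^sup>2)"
    using L2r_mult[OF L2r_bounded_mult[OF f u] f] by (simp add: power2_eq_square mult.assoc)
  have F2: "integrable T3T3 (\<lambda>x. (F x)\<^sup>2)" using F by (simp add: L2r_def)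
  have vF2: "integrable T3T3 (\<lambda>x. vF F x * F x)" by (rule L2r_mult[OF L2r_vF[OF F] F])
  have Ff: "integrable T3T3 (\<lambda>x. F x * avg f x)" by (rule L2r_mult[OF F L2r_avg[OF f]])
  \<comment> \<open>The two squares give the loop integral of the determinant, the mixed product
    gives the kernel term. After integration both carry the factor 1 / 2, which turns m^2 into m^2 /
    2.\<close>
  have avg2: "?Q x * (avg f x)\<^sup>2 = (?Q x * (f (fst x))\<^sup>2 + ?Q x * (f (snd x))\<^sup>2) / 4 + quad (\<lambda>k p. 1 / (z - shifted_w2 k p)) f x / 2" for x
  proof -
    have "q * ((a + b) / 2)\<^sup>2 = (q * a\<^sup>2 + q * b\<^sup>2) / 4 + q * (a * b) / 2" for q a b :: real
      by (simp add: power2_eq_square field_simps)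
    then show ?thesis unfolding avg_def quad_def .
  qed
  have iq: "integrable T3T3 (\<lambda>x. ?Q x * (avg f x)\<^sup>2)"
    unfolding avg2 by (intro Bochner_Integration.integrable_add Bochner_Integration.integrable_divide J q)
  have Iq: "(LINT x|T3T3. ?Q x * (avg f x)\<^sup>2) = (LINT k|T3. loop_int k z * (f k)\<^sup>2) / 2
      + (LINT x|T3T3. quad (\<lambda>k p. 1 / (z - shifted_w2 k p)) f x) / 2"
    unfolding avg2
    apply (subst Bochner_Integration.integral_add)
      apply (intro Bochner_Integration.integrable_add Bochner_Integration.integrable_divide J q)
     apply (intro Bochner_Integration.integrable_divide q)
    apply (subst Bochner_Integration.integral_divide_zero)
    apply (subst Bochner_Integration.integral_divide_zero)
    apply (subst Bochner_Integration.integral_add[OF J(1,2)])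
    apply (simp only: J(3,4))
    apply simp
    done
  have pt: "- (m\<^sup>2) * (?Q x * (avg f x)\<^sup>2) \<le> z * (F x)\<^sup>2 - vF F x * F x - 2 * m * (F x * avg f x)" for x
  proof -
    define w h where "w = z - shifted_w2 (fst x) (snd x)" and "h = m * avg f x"
    have w: "0 < w" using z shifted_w2_le_18[of "fst x" "snd x"] by (simp add: w_def)
    have "0 \<le> (w * F x - h)\<^sup>2 / w" using w by simp
    also have "\<dots> = w * (F x)\<^sup>2 - 2 * h * F x + h\<^sup>2 / w"
      using w by (simp add: power2_eq_square field_simps)
    finally have "- (h\<^sup>2 / w) \<le> w * (F x)\<^sup>2 - 2 * h * F x" by simp
    moreover have "m\<^sup>2 * (?Q x * (avg f x)\<^sup>2) = h\<^sup>2 / w" by (simp add: w_def h_def power_mult_distrib)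
    moreover have "w * (F x)\<^sup>2 - 2 * h * F x = z * (F x)\<^sup>2 - vF F x * F x - 2 * m * (F x * avg f x)"
      by (simp add: w_def h_def vF_def power2_eq_square algebra_simps)
    ultimately show ?thesis by simp
  qed
  have "- (m\<^sup>2) * (LINT x|T3T3. ?Q x * (avg f x)\<^sup>2) = (LINT x|T3T3. - (m\<^sup>2) * (?Q x * (avg f x)\<^sup>2))"
    by (simp only: Bochner_Integration.integral_mult_right_zero)
  also have "\<dots> \<le> (LINT x|T3T3. z * (F x)\<^sup>2 - vF F x * F x - 2 * m * (F x * avg f x))"
    by (rule integral_mono)
      (intro Bochner_Integration.integrable_diff Bochner_Integration.integrable_mult_right iq F2 vF2 Ff pt)+
  also have "\<dots> = z * (LINT x|T3T3. (F x)\<^sup>2) - (LINT x|T3T3. vF F x * F x) - 2 * m * (LINT x|T3T3. F x * avg f x)"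
    using F2 vF2 Ff by simp
  finally have two: "- (m\<^sup>2) * ((LINT k|T3. loop_int k z * (f k)\<^sup>2) / 2
      + (LINT x|T3T3. quad (\<lambda>k p. 1 / (z - shifted_w2 k p)) f x) / 2)
    \<le> z * (LINT x|T3T3. (F x)\<^sup>2) - (LINT x|T3T3. vF F x * F x) - 2 * m * (LINT x|T3T3. F x * avg f x)"
    unfolding Iq .
  have "(LINT k|T3. (z - u k - m\<^sup>2 / 2 * loop_int k z) * (f k)\<^sup>2)
      = (LINT k|T3. z * (f k)\<^sup>2 - u k * (f k)\<^sup>2 - m\<^sup>2 / 2 * (loop_int k z * (f k)\<^sup>2))"
    by (rule Bochner_Integration.integral_cong) (simp_all add: left_diff_distrib)
  also have "\<dots> = z * (LINT k|T3. (f k)\<^sup>2) - (LINT k|T3. u k * (f k)\<^sup>2) - m\<^sup>2 / 2 * (LINT k|T3. loop_int k z * (f k)\<^sup>2)"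
    using f2 uf2 J(5) by simp
  finally have one: "(LINT k|T3. (z - u k - m\<^sup>2 / 2 * loop_int k z) * (f k)\<^sup>2)
    = z * (LINT k|T3. (f k)\<^sup>2) - (LINT k|T3. u k * (f k)\<^sup>2) - m\<^sup>2 / 2 * (LINT k|T3. loop_int k z * (f k)\<^sup>2)" .
  have ip: "ip f F f F = (LINT k|T3. (f k)\<^sup>2) + (LINT x|T3T3. (F x)\<^sup>2)"
    by (simp add: ip_def power2_eq_square)
  have form: "form u m f F f F = (LINT k|T3. u k * (f k)\<^sup>2) + (LINT x|T3T3. vF F x * F x) + 2 * m * (LINT x|T3T3. F x * avg f x)"
    by (simp add: form_def power2_eq_square mult.assoc)
  show ?thesis using two unfolding one ip form by (simp add: algebra_simps)
qed

text \<open>Cauchy-Schwarz after moving the weight sqrt d from the kernel to both copies of f. The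
  first factor is the Hilbert-Schmidt norm of the weighted tail, estimated at E instead of z by
  \<open>tail_mono\<close>; the second is the form of d.\<close>

lemma quad_tail_bound:
  assumes E: "18 \<le> E" "E < z" and f: "L2r T3 f"
    and d: "d \<in> borel_measurable T3" "\<And>k. 0 \<le> d k" "\<And>k. d k \<le> B" "AE k in T3. 0 < d k"
    and int: "integrable T3T3 (\<lambda>x. (tail N E (fst x) (snd x))\<^sup>2 / (d (fst x) * d (snd x)))"
  shows "\<bar>LINT x|T3T3. quad (tail N z) f x\<bar>
    \<le> sqrt (LINT x|T3T3. (tail N E (fst x) (snd x))\<^sup>2 / (d (fst x) * d (snd x))) * (LINT k|T3. d k * (f k)\<^sup>2)"
proof -
  note [measurable] = d(1)
  have [measurable]: "f \<in> borel_measurable T3" using f by (simp add: L2r_def)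
  let ?g = "\<lambda>x. tail N z (fst x) (snd x) / sqrt (d (fst x) * d (snd x))"
  let ?f = "\<lambda>k. sqrt (d k) * f k"
  let ?h = "\<lambda>x. ?f (fst x) * ?f (snd x)"
  have f': "L2r T3 ?f"
    by (rule L2r_bounded_mult[OF f, where B = "sqrt B"]) (use d in auto)
  have h: "L2r T3T3 ?h" by (rule L2r_tensor[OF f' f'])
  have g2: "(?g x)\<^sup>2 = (tail N z (fst x) (snd x))\<^sup>2 / (d (fst x) * d (snd x))" for x
    using d(2) by (simp add: power_divide)
  have le: "AE x in T3T3. (?g x)\<^sup>2 \<le> (tail N E (fst x) (snd x))\<^sup>2 / (d (fst x) * d (snd x))"
    using AE_shifted_w2_less_18
  proof eventually_elim
    case (elim x)
    then show ?case unfolding g2 using tail_mono[OF E elim] d(2)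
      by (intro divide_right_mono power_mono) auto
  qed
  have g: "L2r T3T3 ?g"
    unfolding L2r_def
  proof
    show "?g \<in> borel_measurable T3T3" by measurable
    show "integrable T3T3 (\<lambda>x. (?g x)\<^sup>2)"
    proof (rule Bochner_Integration.integrable_bound[OF int])
      show "AE x in T3T3. norm ((?g x)\<^sup>2) \<le> norm ((tail N E (fst x) (snd x))\<^sup>2 / (d (fst x) * d (snd x)))"
        using le d(2) by (auto elim!: eventually_mono)
    qed measurable
  qed
  have "AE x in T3T3. 0 < d (fst x) \<and> 0 < d (snd x)"
  proof (rule T3T3.AE_pair_measure)
    show "{x \<in> space T3T3. 0 < d (fst x) \<and> 0 < d (snd x)} \<in> sets T3T3" by measurable
    show "AE x in T3. AE y in T3. 0 < d (fst (x, y)) \<and> 0 < d (snd (x, y))"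
      using d(4) by (auto elim!: eventually_mono)
  qed
  then have "AE x in T3T3. quad (tail N z) f x = ?g x * ?h x"
    by (rule eventually_mono) (simp add: quad_def real_sqrt_mult)
  then have e: "(LINT x|T3T3. quad (tail N z) f x) = (LINT x|T3T3. ?g x * ?h x)"
    by (intro integral_cong_AE) (auto simp: quad_def[abs_def])
  have "(LINT x|T3T3. (?h x)\<^sup>2) = (LINT k|T3. (?f k)\<^sup>2) * (LINT k|T3. (?f k)\<^sup>2)"
    unfolding power_mult_distrib[of "?f (fst _)"]
    by (rule integral_tensor) (use f' in \<open>simp_all only: L2r_def\<close>)
  also have "(LINT k|T3. (?f k)\<^sup>2) = (LINT k|T3. d k * (f k)\<^sup>2)"
    using d(2) by (simp add: power_mult_distrib)
  finally have h2: "sqrt (LINT x|T3T3. (?h x)\<^sup>2) = (LINT k|T3. d k * (f k)\<^sup>2)"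
    using d(2) by (simp add: Bochner_Integration.integral_nonneg)
  have "\<bar>LINT x|T3T3. quad (tail N z) f x\<bar> \<le> sqrt (LINT x|T3T3. (?g x)\<^sup>2) * sqrt (LINT x|T3T3. (?h x)\<^sup>2)"
    unfolding e by (rule integral_Cauchy_Schwarz[OF g h])
  also have "\<dots> \<le> sqrt (LINT x|T3T3. (tail N E (fst x) (snd x))\<^sup>2 / (d (fst x) * d (snd x))) * (LINT k|T3. d k * (f k)\<^sup>2)"
    unfolding h2
  proof (intro mult_right_mono)
    have "(LINT x|T3T3. (?g x)\<^sup>2) \<le> (LINT x|T3T3. (tail N E (fst x) (snd x))\<^sup>2 / (d (fst x) * d (snd x)))"
      by (rule integral_mono_AE[OF _ int le]) (use g in \<open>simp add: L2r_def\<close>)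
    then show "sqrt (LINT x|T3T3. (?g x)\<^sup>2) \<le> sqrt (LINT x|T3T3. (tail N E (fst x) (snd x))\<^sup>2 / (d (fst x) * d (snd x)))"
      by simp
    show "0 \<le> (LINT k|T3. d k * (f k)\<^sup>2)" using d(2) by (simp add: Bochner_Integration.integral_nonneg)
  qed
  finally show ?thesis .
qed

section \<open>The contradiction from infinitely many eigenvalues\<close>

definition real_eigen :: "(R3 \<Rightarrow> real) \<Rightarrow> real \<Rightarrow> real \<Rightarrow> (R3 \<Rightarrow> real) \<Rightarrow> (R3 \<times> R3 \<Rightarrow> real) \<Rightarrow> bool" where
  "real_eigen u m l f F \<longleftrightarrow> L2r T3 f \<and> L2r T3T3 F \<and> sym2 F \<and>
     is_image u m f F (\<lambda>k. l * f k) (\<lambda>x. l * F x) \<and> 0 < ip f F f F"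

lemma ip_commute: "ip f F g G = ip g G f F"
  by (simp add: ip_def mult.commute)

lemma form_commute: "form u m f F g G = form u m g G f F"
  by (simp add: form_def vF_def mult_ac add.commute)

lemma ip_scale: "ip (\<lambda>k. c * f k) (\<lambda>x. c * F x) g G = c * ip f F g G"
  by (simp add: ip_def mult.assoc distrib_left)

lemma ip_sum_left:
  assumes "finite J" "\<And>j. j \<in> J \<Longrightarrow> L2r T3 (f j)" "\<And>j. j \<in> J \<Longrightarrow> L2r T3T3 (F j)" "L2r T3 g" "L2r T3T3 G"
  shows "ip (\<lambda>k. \<Sum>j\<in>J. c j * f j k) (\<lambda>x. \<Sum>j\<in>J. c j * F j x) g G = (\<Sum>j\<in>J. c j * ip (f j) (F j) g G)"
proof -
  have i: "integrable T3 (\<lambda>k. c j * f j k * g k)" "integrable T3T3 (\<lambda>x. c j * F j x * G x)" if "j \<in> J" for j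
    using L2r_mult[OF L2r_scale[OF assms(2)[OF that]] assms(4)]
      L2r_mult[OF L2r_scale[OF assms(3)[OF that]] assms(5)] .
  have "ip (\<lambda>k. \<Sum>j\<in>J. c j * f j k) (\<lambda>x. \<Sum>j\<in>J. c j * F j x) g G
    = (\<Sum>j\<in>J. LINT k|T3. c j * f j k * g k) + (\<Sum>j\<in>J. LINT x|T3T3. c j * F j x * G x)"
    unfolding ip_def sum_distrib_right
    by (intro arg_cong2[of _ _ _ _ "(+)"] Bochner_Integration.integral_sum i)
  then show ?thesis by (simp add: ip_def sum.distrib[symmetric] mult.assoc distrib_left)
qed

text \<open>Here d is a lower bound of the determinant valid for all z > E. The order of choices
  matters: N is fixed from the kernel at E, then the finite set P of functionals, then more
  eigenvalues than functionals, and only then z between E and these eigenvalues. This is possible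
  because the earlier choices do not refer to z.\<close>

theorem finite_eigenvalues_above:
  assumes E: "18 \<le> E" and u: "u \<in> borel_measurable T3" "\<And>k. \<bar>u k\<bar> \<le> U"
    and d: "d \<in> borel_measurable T3" "\<And>k. 0 \<le> d k" "\<And>k. d k \<le> B" "AE k in T3. 0 < d k"
    and int: "integrable T3T3 (\<lambda>x. (1 / (E - shifted_w2 (fst x) (snd x)))\<^sup>2 / (d (fst x) * d (snd x)))"
    and low: "\<And>z k. E < z \<Longrightarrow> k \<in> cube3 \<Longrightarrow> d k \<le> z - u k - m\<^sup>2 / 2 * loop_int k z"
    and S: "\<And>l. l \<in> S \<Longrightarrow> E < l \<and> (\<exists>f F. real_eigen u m l f F)"
  shows "finite S"
proof (rule ccontr)
  assume inf: "infinite S"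
  define Y where "Y N = (LINT x|T3T3. (tail N E (fst x) (snd x))\<^sup>2 / (d (fst x) * d (snd x)))" for N
  note tsl = tail_square_limit[OF E d(1) int d(2)]
  have "(\<lambda>N. m\<^sup>2 / 2 * sqrt (Y N)) \<longlonglongrightarrow> m\<^sup>2 / 2 * sqrt 0"
    unfolding Y_def by (intro tendsto_intros tsl)
  then have "eventually (\<lambda>N. m\<^sup>2 / 2 * sqrt (Y N) < 1) sequentially"
    by (rule order_tendstoD) simp
  \<comment> \<open>With this N the tail costs less than the form of d.\<close>
  then obtain N where N: "m\<^sup>2 / 2 * sqrt (Y N) < 1"
    by (auto simp: eventually_sequentially)
  define ann where "ann B n \<longleftrightarrow> finite B \<and> (\<forall>a\<in>B. bounded_meas a) \<and> (\<forall>f. integrable T3 f \<longrightarrow> (\<forall>a\<in>B. (LINT t|T3. a t * f t) = 0) \<longrightarrow>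
    integrable T3T3 (quad (\<lambda>k p. shifted_w2 k p ^ n) f) \<and> (LINT x|T3T3. quad (\<lambda>k p. shifted_w2 k p ^ n) f x) = 0)" for B n
  have "\<forall>n. \<exists>B. ann B n"
    unfolding ann_def by (intro allI finrank_annihilator finrank_power finrank_shifted_w2)
  then obtain A where ann: "\<And>n. ann (A n) n" by (elim choice[THEN exE]) blast
  then have A: "\<And>n. finite (A n)" "\<And>n a. a \<in> A n \<Longrightarrow> bounded_meas a"
    "\<And>n f. integrable T3 f \<Longrightarrow> (\<forall>a\<in>A n. (LINT t|T3. a t * f t) = 0) \<Longrightarrow>
      integrable T3T3 (quad (\<lambda>k p. shifted_w2 k p ^ n) f) \<and> (LINT x|T3T3. quad (\<lambda>k p. shifted_w2 k p ^ n) f x) = 0"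
    unfolding ann_def by blast+
  define P where "P = (\<Union>n<N. A n)"
  have P: "finite P" unfolding P_def using A(1) by auto
  \<comment> \<open>One eigenvalue more than functionals, so that a nontrivial combination is
    annihilated by all of them.\<close>
  obtain J where J: "J \<subseteq> S" "finite J" "card J = Suc (card P)"
    using infinite_arbitrarily_large[OF inf] by blast
  obtain f F where ev: "\<And>l. l \<in> J \<Longrightarrow> real_eigen u m l (f l) (F l)"
    using S J(1) by (metis subsetD)
  have L: "L2r T3 (f l)" "L2r T3T3 (F l)" if "l \<in> J" for l
    using ev[OF that] by (auto simp: real_eigen_def)
  obtain c where c: "\<exists>l\<in>J. c l \<noteq> 0" "\<forall>a\<in>P. (\<Sum>l\<in>J. c l * (LINT t|T3. a t * f l t)) = 0"
    using exists_annihilating_combination[OF P J(2), of "\<lambda>l a. LINT t|T3. a t * f l t"] J(3) by auto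
  have Jne: "J \<noteq> {}" using c(1) by auto
  define z where "z = (E + Min J) / 2"
  have "Min J \<in> J" using J Jne by simp
  then have "E < Min J" using S J(1) by blast
  then have Ez: "E < z" and zl: "\<And>l. l \<in> J \<Longrightarrow> z < l"
    using J(2) by (auto simp: z_def) (smt (verit) Min_le field_sum_of_halves)
  have z18: "18 < z" using E Ez by simp
  define g G where "g k = (\<Sum>l\<in>J. c l * f l k)" and "G x = (\<Sum>l\<in>J. c l * F l x)" for k x
  \<comment> \<open>(g', G') is the image of the combination (g, G): each term is multiplied by its
    eigenvalue.\<close>
  define g' G' where "g' k = (\<Sum>l\<in>J. (c l * l) * f l k)" and "G' x = (\<Sum>l\<in>J. (c l * l) * F l x)" for k x
  have Lg: "L2r T3 g" "L2r T3T3 G" "L2r T3 g'" "L2r T3T3 G'"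
    unfolding g_def[abs_def] G_def[abs_def] g'_def[abs_def] G'_def[abs_def]
    by (intro L2r_sum J(2) L; assumption)+
  have symG: "sym2 G"
  proof -
    have "AE x in T3T3. \<forall>l\<in>J. F l (fst x, snd x) = F l (snd x, fst x)"
      using ev by (intro AE_finite_allI[OF J(2)]) (auto simp: real_eigen_def sym2_def)
    then show ?thesis unfolding sym2_def by (rule eventually_mono) (simp add: G_def)
  qed
  have im: "is_image u m g G g' G'"
  proof -
    have intF: "AE k in T3. \<forall>l\<in>J. integrable T3 (\<lambda>t. F l (k, t))"
      using L by (intro AE_finite_allI[OF J(2)] T3T3.AE_integrable_fst' T3T3f.L2r_integrable)
    have "AE k in T3. \<forall>l\<in>J. l * f l k = u k * f l k + m * (LINT t|T3. F l (k, t))"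
      using ev by (intro AE_finite_allI[OF J(2)]) (auto simp: real_eigen_def is_image_def)
    with intF have 1: "AE k in T3. g' k = u k * g k + m * (LINT t|T3. G (k, t))"
    proof eventually_elim
      case (elim k)
      have "g' k = (\<Sum>l\<in>J. c l * (u k * f l k + m * (LINT t|T3. F l (k, t))))"
        unfolding g'_def by (rule sum.cong) (use elim in \<open>auto simp: mult.assoc\<close>)
      also have "\<dots> = u k * g k + m * (\<Sum>l\<in>J. c l * (LINT t|T3. F l (k, t)))"
        by (simp add: g_def sum_distrib_left distrib_left sum.distrib mult_ac)
      also have "(\<Sum>l\<in>J. c l * (LINT t|T3. F l (k, t))) = (LINT t|T3. G (k, t))"
        unfolding G_def using elim by (subst Bochner_Integration.integral_sum) auto
      finally show ?case .
    qed
    have "AE x in T3T3. \<forall>l\<in>J. l * F l x = vF (F l) x + m * avg (f l) x"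
      using ev by (intro AE_finite_allI[OF J(2)]) (auto simp: real_eigen_def is_image_def)
    then have 2: "AE x in T3T3. G' x = vF G x + m * avg g x"
    proof eventually_elim
      case (elim x)
      have "G' x = (\<Sum>l\<in>J. c l * (vF (F l) x + m * avg (f l) x))"
        unfolding G'_def by (rule sum.cong) (use elim in \<open>auto simp: mult.assoc\<close>)
      then show ?case
        by (simp add: G_def g_def vF_def avg_def sum_distrib_left distrib_left sum.distrib sum_divide_distrib mult_ac add_divide_distrib)
    qed
    show ?thesis using 1 2 by (simp add: is_image_def)
  qed
  \<comment> \<open>Evaluating the symmetric form on two eigenvectors gives both i and j times the
    same inner product.\<close>
  have orth: "ip (f i) (F i) (f j) (F j) = 0" if ij: "i \<in> J" "j \<in> J" "i \<noteq> j" for i j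
  proof -
    have ii: "l * ip (f l) (F l) g G = form u m (f l) (F l) g G" if "l \<in> J" "L2r T3 g" "L2r T3T3 G" for l g G
    proof -
      have "ip (\<lambda>k. l * f l k) (\<lambda>x. l * F l x) g G = form u m (f l) (F l) g G"
        by (rule ip_image[OF _ L[OF that(1)] L2r_scale[OF L(1)[OF that(1)]] L2r_scale[OF L(2)[OF that(1)]] that(2,3) _ u])
          (use ev[OF that(1)] in \<open>auto simp: real_eigen_def\<close>)
      then show ?thesis by (simp add: ip_scale)
    qed
    have "i * ip (f i) (F i) (f j) (F j) = j * ip (f j) (F j) (f i) (F i)"
      using ii[of i "f j" "F j"] ii[of j "f i" "F i"] L ij form_commute by metis
    then have "(i - j) * ip (f i) (F i) (f j) (F j) = 0"
      using ip_commute[of "f j" "F j" "f i" "F i"] by (simp add: left_diff_distrib)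
    then show ?thesis using ij by simp
  qed
  have left: "ip (f l) (F l) g G = c l * ip (f l) (F l) (f l) (F l)" if l: "l \<in> J" for l
  proof -
    have "ip g G (f l) (F l) = (\<Sum>j\<in>J. c j * ip (f j) (F j) (f l) (F l))"
      unfolding g_def[abs_def] G_def[abs_def] by (rule ip_sum_left[OF J(2)]) (use L l in auto)
    also have "\<dots> = (\<Sum>j\<in>J. if j = l then c j * ip (f j) (F j) (f l) (F l) else 0)"
      by (rule sum.cong) (use orth l in auto)
    also have "\<dots> = c l * ip (f l) (F l) (f l) (F l)" using l J(2) by simp
    finally show ?thesis by (simp add: ip_commute)
  qed
  have "z * ip g G g G - form u m g G g G = z * ip g G g G - ip g' G' g G"
    using ip_image[OF im Lg(1-4,1,2) symG u] by simp
  also have "\<dots> = (\<Sum>l\<in>J. (z - l) * (c l)\<^sup>2 * ip (f l) (F l) (f l) (F l))"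
  proof -
    have "ip g G g G = (\<Sum>l\<in>J. c l * ip (f l) (F l) g G)"
      unfolding g_def[abs_def] G_def[abs_def]
      by (rule ip_sum_left[OF J(2) L]) (use Lg in \<open>auto simp: g_def[abs_def] G_def[abs_def]\<close>)
    moreover have "ip g' G' g G = (\<Sum>l\<in>J. (c l * l) * ip (f l) (F l) g G)"
      unfolding g'_def[abs_def] G'_def[abs_def]
      by (rule ip_sum_left[OF J(2) L]) (use Lg in auto)
    ultimately show ?thesis
      by (simp add: left sum_distrib_left sum_subtractf[symmetric] power2_eq_square algebra_simps)
  qed
  \<comment> \<open>Strictness comes from the full vectors. The component g alone might vanish, but
    the lower bound derived below is then 0, which is still a contradiction.\<close>
  also have "\<dots> < 0"
  proof -
    have np: "(z - l) * (c l)\<^sup>2 * ip (f l) (F l) (f l) (F l) \<le> 0" if "l \<in> J" for l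
      using zl[OF that] ev[OF that] by (auto simp: real_eigen_def intro!: mult_nonpos_nonneg)
    obtain l where l: "l \<in> J" "c l \<noteq> 0" using c(1) by blast
    have "(z - l) * (c l)\<^sup>2 * ip (f l) (F l) (f l) (F l) < 0"
      using zl[OF l(1)] ev[OF l(1)] l(2) by (auto simp: real_eigen_def intro!: mult_neg_pos)
    then show ?thesis
      using np l(1) sum_strict_mono_ex1[OF J(2), of "\<lambda>l. (z - l) * (c l)\<^sup>2 * ip (f l) (F l) (f l) (F l)" "\<lambda>_. 0"] by auto
  qed
  finally have neg: "z * ip g G g G - form u m g G g G < 0" .
  define X where "X = (LINT k|T3. d k * (g k)\<^sup>2)"
  have X0: "0 \<le> X" unfolding X_def using d(2) by (simp add: Bochner_Integration.integral_nonneg)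
  have annh: "(LINT t|T3. a t * g t) = 0" if a: "a \<in> P" for a
  proof -
    have "bounded_meas a" using a A(2) by (auto simp: P_def)
    then have ia: "integrable T3 (\<lambda>t. a t * f l t)" if "l \<in> J" for l
      using L(1)[OF that] by (intro bounded_meas_integrable T3.L2r_integrable)
    have "(LINT t|T3. a t * g t) = (LINT t|T3. (\<Sum>l\<in>J. c l * (a t * f l t)))"
      by (simp add: g_def sum_distrib_left mult_ac)
    also have "\<dots> = (\<Sum>l\<in>J. c l * (LINT t|T3. a t * f l t))"
      using ia by (subst Bochner_Integration.integral_sum) auto
    finally show ?thesis using c(2) a by simp
  qed
  \<comment> \<open>The coefficients 1 / z^(n+1) depend on z, but the forms of the powers that they
    multiply vanish at g for every n < N, so only the tail is left.\<close>
  have quadE: "(LINT x|T3T3. quad (\<lambda>k p. 1 / (z - shifted_w2 k p)) g x) = (LINT x|T3T3. quad (tail N z) g x)"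
  proof -
    have vn: "integrable T3T3 (quad (\<lambda>k p. shifted_w2 k p ^ n) g) \<and> (LINT x|T3T3. quad (\<lambda>k p. shifted_w2 k p ^ n) g x) = 0"
      if "n < N" for n
      using A(3)[of g n] annh that T3.L2r_integrable[OF Lg(1)] by (auto simp: P_def)
    let ?T = "\<lambda>x. \<Sum>n<N. (1 / z ^ Suc n) * quad (\<lambda>k p. shifted_w2 k p ^ n) g x"
    have iT: "integrable T3T3 ?T" using vn by (intro Bochner_Integration.integrable_sum) auto
    have "(LINT x|T3T3. ?T x) = (\<Sum>n<N. LINT x|T3T3. (1 / z ^ Suc n) * quad (\<lambda>k p. shifted_w2 k p ^ n) g x)"
      using vn by (intro Bochner_Integration.integral_sum) auto
    also have "\<dots> = 0" using vn by simp
    finally have T0: "(LINT x|T3T3. ?T x) = 0" .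
    have e: "quad (tail N z) g x = quad (\<lambda>k p. 1 / (z - shifted_w2 k p)) g x - ?T x" for x
      unfolding quad_def kernel_expansion[OF z18, of _ _ N]
      by (simp add: distrib_right sum_distrib_right mult.assoc)
    show ?thesis
      unfolding e using integrable_quad_kernel[OF z18 Lg(1)] iT T0 by simp
  qed
  have tb: "(LINT x|T3T3. quad (tail N z) g x) \<le> sqrt (Y N) * X"
    using quad_tail_bound[OF E Ez Lg(1) d tsl(1)[of N]] by (simp add: Y_def X_def)
  have "X \<le> (LINT k|T3. (z - u k - m\<^sup>2 / 2 * loop_int k z) * (g k)\<^sup>2)"
    unfolding X_def
  proof (rule integral_mono_AE)
    show "integrable T3 (\<lambda>k. d k * (g k)\<^sup>2)"
      using L2r_mult[OF L2r_bounded_mult[OF Lg(1) d(1), of B] Lg(1)] d(2,3)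
      by (simp add: power2_eq_square mult.assoc abs_le_iff order_trans[OF _ d(2)] minus_le_iff)
    have "integrable T3 (\<lambda>k. z * (g k)\<^sup>2 - u k * (g k)\<^sup>2 - m\<^sup>2 / 2 * (loop_int k z * (g k)\<^sup>2))"
    proof (intro Bochner_Integration.integrable_diff Bochner_Integration.integrable_mult_right integral_loop_int(5)[OF z18 Lg(1)])
      show "integrable T3 (\<lambda>k. (g k)\<^sup>2)" using Lg(1) by (simp add: L2r_def)
      show "integrable T3 (\<lambda>k. u k * (g k)\<^sup>2)"
        using L2r_mult[OF L2r_bounded_mult[OF Lg(1) u] Lg(1)] by (simp add: power2_eq_square mult.assoc)
    qed
    then show "integrable T3 (\<lambda>k. (z - u k - m\<^sup>2 / 2 * loop_int k z) * (g k)\<^sup>2)"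
      by (simp add: left_diff_distrib mult.assoc)
    show "AE k in T3. d k * (g k)\<^sup>2 \<le> (z - u k - m\<^sup>2 / 2 * loop_int k z) * (g k)\<^sup>2"
      using low[OF Ez] by (intro AE_I2 mult_right_mono) auto
  qed
  moreover have "m\<^sup>2 / 2 * (LINT x|T3T3. quad (tail N z) g x) \<le> X"
  proof -
    have "m\<^sup>2 / 2 * (LINT x|T3T3. quad (tail N z) g x) \<le> m\<^sup>2 / 2 * (sqrt (Y N) * X)"
      by (rule mult_left_mono[OF tb]) simp
    also have "\<dots> = (m\<^sup>2 / 2 * sqrt (Y N)) * X" by simp
    also have "\<dots> \<le> 1 * X" using N X0 by (intro mult_right_mono) auto
    finally show ?thesis by simp
  qed
  moreover note form_bound[OF z18 Lg(1,2) u, of m]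
  ultimately show False using neg unfolding quadE by linarith
qed

end

section \<open>The fibre operators\<close>

definition sq_norm :: "'a measure \<Rightarrow> ('a \<Rightarrow> complex) \<Rightarrow> real" where
  "sq_norm M f = (LINT x|M. (cmod (f x))\<^sup>2)"

lemma sq_norm_nonneg [simp]: "0 \<le> sq_norm M f"
  by (simp add: sq_norm_def Bochner_Integration.integral_nonneg)

lemma L2norm_sq [simp]: "(L2norm M f)\<^sup>2 = sq_norm M f"
  by (simp add: L2norm_def sq_norm_def Bochner_Integration.integral_nonneg)

lemma L2_meas: "f \<in> L2 M \<Longrightarrow> f \<in> borel_measurable M"
  by (simp add: L2_def)

lemma L2_L2r: "f \<in> L2 M \<Longrightarrow> L2r M (\<lambda>x. cmod (f x))"
  by (auto simp: L2_def L2r_def)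

lemma L2I:
  assumes "f \<in> borel_measurable M" "integrable M g" "\<And>x. x \<in> space M \<Longrightarrow> (cmod (f x))\<^sup>2 \<le> g x"
  shows "f \<in> L2 M" "sq_norm M f \<le> (LINT x|M. g x)"
proof -
  have i: "integrable M (\<lambda>x. (cmod (f x))\<^sup>2)"
  proof (rule Bochner_Integration.integrable_bound[OF assms(2)])
    show "(\<lambda>x. (cmod (f x))\<^sup>2) \<in> borel_measurable M" using assms(1) by simp
    show "AE x in M. norm ((cmod (f x))\<^sup>2) \<le> norm (g x)"
      using assms(3) by (intro AE_I2) (simp add: order_trans[OF _ abs_ge_self])
  qed
  then show "f \<in> L2 M" using assms(1) by (simp add: L2_def)
  show "sq_norm M f \<le> (LINT x|M. g x)"
    unfolding sq_norm_def by (rule integral_mono[OF i assms(2,3)])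
qed

lemma cmod_add_square: "(cmod (a + b))\<^sup>2 \<le> 2 * (cmod a)\<^sup>2 + 2 * (cmod b)\<^sup>2"
proof -
  have "(cmod (a + b))\<^sup>2 \<le> (cmod a + cmod b)\<^sup>2" by (intro power_mono norm_triangle_ineq) simp
  also have "\<dots> \<le> 2 * (cmod a)\<^sup>2 + 2 * (cmod b)\<^sup>2"
    using sum_squares_bound[of "cmod a" "cmod b"] by (simp add: power2_sum)
  finally show ?thesis .
qed

lemma L2_add:
  assumes "f \<in> L2 M" "g \<in> L2 M"
  shows "(\<lambda>x. f x + g x) \<in> L2 M" "sq_norm M (\<lambda>x. f x + g x) \<le> 2 * sq_norm M f + 2 * sq_norm M g"
proof -
  have i: "integrable M (\<lambda>x. 2 * (cmod (f x))\<^sup>2 + 2 * (cmod (g x))\<^sup>2)"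
    using assms by (simp add: L2_def)
  have m: "(\<lambda>x. f x + g x) \<in> borel_measurable M" by (intro borel_measurable_add L2_meas assms)
  note L = L2I[OF m i cmod_add_square]
  show "(\<lambda>x. f x + g x) \<in> L2 M" by (rule L(1))
  have "(LINT x|M. 2 * (cmod (f x))\<^sup>2 + 2 * (cmod (g x))\<^sup>2) = 2 * sq_norm M f + 2 * sq_norm M g"
    using assms by (simp add: L2_def sq_norm_def)
  then show "sq_norm M (\<lambda>x. f x + g x) \<le> 2 * sq_norm M f + 2 * sq_norm M g" using L(2) by simp
qed

lemma L2_bounded_mult:
  assumes f: "f \<in> L2 M" and a: "a \<in> borel_measurable M" "\<And>x. x \<in> space M \<Longrightarrow> cmod (a x) \<le> B"
  shows "(\<lambda>x. a x * f x) \<in> L2 M" "sq_norm M (\<lambda>x. a x * f x) \<le> B\<^sup>2 * sq_norm M f"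
proof -
  have i: "integrable M (\<lambda>x. B\<^sup>2 * (cmod (f x))\<^sup>2)" using f by (simp add: L2_def)
  have m: "(\<lambda>x. a x * f x) \<in> borel_measurable M" by (intro borel_measurable_times a(1) L2_meas[OF f])
  have "(cmod (a x * f x))\<^sup>2 \<le> B\<^sup>2 * (cmod (f x))\<^sup>2" if "x \<in> space M" for x
    using power_mono[OF a(2)[OF that], of 2] by (simp add: norm_mult power_mult_distrib mult_right_mono)
  note L = L2I[OF m i this]
  show "(\<lambda>x. a x * f x) \<in> L2 M" by (rule L(1))
  show "sq_norm M (\<lambda>x. a x * f x) \<le> B\<^sup>2 * sq_norm M f" using L(2) f by (simp add: sq_norm_def)
qed

lemma L2_const: "(\<lambda>_. a) \<in> L2 T3"
  by (simp add: L2_def)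

lemma L2_integrable: "f \<in> L2 T3 \<Longrightarrow> integrable T3 f"
  using T3.L2r_integrable[OF L2_L2r, of f] by (simp add: L2_meas integrable_norm_iff)

definition vol :: real where "vol = measure T3 cube3"

lemma vol_nonneg: "0 \<le> vol" by (simp add: vol_def)

lemma cmod_integral_sq:
  assumes "f \<in> L2 T3"
  shows "(cmod (LINT t|T3. f t))\<^sup>2 \<le> vol * sq_norm T3 f"
proof -
  have "cmod (LINT t|T3. f t) \<le> (LINT t|T3. cmod (f t) * 1)"
    using integral_norm_bound[of T3 f] by simp
  also have "\<dots> \<le> sqrt (LINT t|T3. (cmod (f t))\<^sup>2) * sqrt (LINT t|T3. 1\<^sup>2)"
    using integral_Cauchy_Schwarz[OF L2_L2r[OF assms] L2r_const[of 1]] by linarith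
  also have "\<dots> = sqrt (vol * sq_norm T3 f)"
    by (simp add: sq_norm_def vol_def real_sqrt_mult mult.commute)
  finally show ?thesis
    using power_mono[of "cmod (LINT t|T3. f t)" "sqrt (vol * sq_norm T3 f)" 2] by (simp add: vol_nonneg)
qed

lemma sq_norm_zero_AE:
  assumes "f \<in> L2 M"
  shows "sq_norm M f = 0 \<longleftrightarrow> (AE x in M. f x = 0)"
  unfolding sq_norm_def
  by (subst integral_nonneg_eq_0_iff_AE) (use assms in \<open>auto simp: L2_def\<close>)

lemma sq_norm_cong: "(\<And>x. x \<in> space M \<Longrightarrow> f x = g x) \<Longrightarrow> sq_norm M f = sq_norm M g"
  unfolding sq_norm_def by (rule Bochner_Integration.integral_cong) auto

lemma norm_H01_eq: "norm_H01 (a, f) = sqrt ((cmod a)\<^sup>2 + sq_norm T3 f)"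
  by (simp add: norm_H01_def)

lemma norm_H01_zero: "norm_H01 (a, f) = 0 \<longleftrightarrow> a = 0 \<and> sq_norm T3 f = 0"
  by (simp add: norm_H01_eq add_nonneg_eq_0_iff)

section \<open>The resolvent of a fibre operator through its Schur complement\<close>

definition coupling :: "real \<Rightarrow> complex" where "coupling \<mu> = complex_of_real (\<mu> / sqrt 2)"

lemma coupling_sq: "coupling \<mu> * coupling \<mu> = complex_of_real (\<mu>\<^sup>2 / 2)"
  unfolding coupling_def of_real_mult[symmetric] by (simp add: power2_eq_square)

lemma Afib_minus:
  "Afib \<gamma> \<mu> k (a, f) - z *\<^sub>C (a, f) =
    ((complex_of_real (w1 \<gamma> k) - z) * a + coupling \<mu> * (LINT t|T3. f t),
     \<lambda>p. coupling \<mu> * a + (complex_of_real (w2 k p) - z) * f p)"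
  by (simp add: Afib_def A00_fib_def A01_def A01_adj_def A11_fib_def scaleC_prod_def scaleC_complex_def
      scaleC_fun_def fun_eq_iff coupling_def algebra_simps)

lemma w2_measurable [measurable]: "w2 k \<in> borel_measurable T3"
  unfolding w2_def[abs_def] by (rule borel_measurable_T3) measurable

lemma w2_bounds: "0 \<le> w2 k p" "w2 k p \<le> 18"
  using eps_nonneg[of k] eps_nonneg[of p] eps_nonneg[of "(1/2) *\<^sub>R (k + p)"]
    eps_le[of k] eps_le[of p] eps_le[of "(1/2) *\<^sub>R (k + p)"] by (simp_all add: w2_def)

text \<open>Since z keeps the distance c from the values of \<open>w2 k\<close>, the second diagonal
  entry minus z is inverted by multiplication with the bounded function \<open>r\<close>.
  Eliminating the second component leaves one scalar equation whose coefficient \<open>Kz\<close> is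
  the Schur complement.\<close>

locale fibre =
  fixes \<gamma> \<mu> :: real and k :: R3 and z :: complex and c :: real
  assumes c: "0 < c" "\<And>p. p \<in> cube3 \<Longrightarrow> c \<le> cmod (complex_of_real (w2 k p) - z)"
begin

definition r :: "R3 \<Rightarrow> complex" where "r p = 1 / (complex_of_real (w2 k p) - z)"

definition Kz :: complex where
  "Kz = complex_of_real (w1 \<gamma> k) - z - coupling \<mu> * coupling \<mu> * (LINT p|T3. r p)"

lemma r_measurable [measurable]: "r \<in> borel_measurable T3"
  unfolding r_def[abs_def] by measurable

lemma r_bound: "p \<in> cube3 \<Longrightarrow> cmod (r p) \<le> 1 / c"
  using c(2)[of p] c(1) by (simp add: r_def norm_divide frac_le)

lemma r_inverse: "p \<in> cube3 \<Longrightarrow> (complex_of_real (w2 k p) - z) * r p = 1"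
  using c(2)[of p] c(1) by (auto simp: r_def)

lemma r_mult: "f \<in> L2 T3 \<Longrightarrow> (\<lambda>p. r p * f p) \<in> L2 T3" "f \<in> L2 T3 \<Longrightarrow> sq_norm T3 (\<lambda>p. r p * f p) \<le> (1 / c)\<^sup>2 * sq_norm T3 f"
  using L2_bounded_mult[of f T3 r "1 / c"] r_bound by auto

lemma r_L2: "r \<in> L2 T3"
  using r_mult(1)[OF L2_const[of 1]] by simp

lemma w2z_mult:
  assumes "f \<in> L2 T3"
  shows "(\<lambda>p. coupling \<mu> * a + (complex_of_real (w2 k p) - z) * f p) \<in> L2 T3"
proof (intro L2_add L2_const L2_bounded_mult[OF assms])
  show "cmod (complex_of_real (w2 k p) - z) \<le> 18 + cmod z" for p
    using norm_triangle_ineq4[of "complex_of_real (w2 k p)" z] w2_bounds[of k p] by simp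
qed measurable

lemma solve:
  assumes K: "Kz \<noteq> 0" and g: "g \<in> L2 T3"
  shows "\<exists>x\<in>H01. norm_H01 (Afib \<gamma> \<mu> k x - z *\<^sub>C x - (b, g)) = 0"
proof -
  define a where "a = (b - coupling \<mu> * (LINT p|T3. r p * g p)) / Kz"
  define f where "f p = r p * g p + (- (coupling \<mu> * a)) * r p" for p
  have f: "f \<in> L2 T3"
    unfolding f_def[abs_def] by (intro L2_add r_mult g L2_bounded_mult[OF r_L2]) auto
  have i: "integrable T3 (\<lambda>p. r p * g p)" "integrable T3 r"
    using L2_integrable[OF r_mult(1)[OF g]] L2_integrable[OF r_L2] .
  have If: "(LINT p|T3. f p) = (LINT p|T3. r p * g p) + (- (coupling \<mu> * a)) * (LINT p|T3. r p)"
    unfolding f_def using i by (subst Bochner_Integration.integral_add) auto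
  have "(complex_of_real (w1 \<gamma> k) - z) * a + coupling \<mu> * (LINT p|T3. f p)
    = Kz * a + coupling \<mu> * (LINT p|T3. r p * g p)"
    unfolding Kz_def If by (simp add: algebra_simps)
  also have "\<dots> = b" using K by (simp add: a_def)
  finally have 1: "(complex_of_real (w1 \<gamma> k) - z) * a + coupling \<mu> * (LINT p|T3. f p) = b" .
  have 2: "coupling \<mu> * a + (complex_of_real (w2 k p) - z) * f p - g p = 0" if "p \<in> cube3" for p
  proof -
    have "(complex_of_real (w2 k p) - z) * f p = ((complex_of_real (w2 k p) - z) * r p) * (g p - coupling \<mu> * a)"
      by (simp add: f_def algebra_simps)
    then show ?thesis unfolding r_inverse[OF that] by simp
  qed
  have "sq_norm T3 (\<lambda>p. coupling \<mu> * a + (complex_of_real (w2 k p) - z) * f p - g p) = sq_norm T3 (\<lambda>p. 0)"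
    by (rule sq_norm_cong) (use 2 in simp)
  moreover have "Afib \<gamma> \<mu> k (a, f) - z *\<^sub>C (a, f) - (b, g)
    = (0, \<lambda>p. coupling \<mu> * a + (complex_of_real (w2 k p) - z) * f p - g p)"
    unfolding Afib_minus using 1 by (simp add: fun_eq_iff)
  ultimately have "norm_H01 (Afib \<gamma> \<mu> k (a, f) - z *\<^sub>C (a, f) - (b, g)) = 0"
    by (simp add: norm_H01_zero) (simp add: sq_norm_def)
  moreover have "(a, f) \<in> H01" using f by (simp add: H01_def)
  ultimately show ?thesis by blast
qed

text \<open>The elimination done quantitatively. \<open>A1\<close> and \<open>A2\<close> bound |a|^2
  by the two components b and h of the right-hand side; \<open>B\<close> and \<open>B2\<close> bound
  the squared norm of f by h and a. The factors 2 come from splitting squares of sums.\<close>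

lemma lower_bound:
  assumes K: "Kz \<noteq> 0"
  shows "\<exists>C. \<forall>x\<in>H01. norm_H01 x \<le> C * norm_H01 (Afib \<gamma> \<mu> k x - z *\<^sub>C x)"
proof -
  define A1 A2 B where "A1 = 2 / (cmod Kz)\<^sup>2" and "A2 = A1 * (cmod (coupling \<mu>))\<^sup>2 * vol * (1 / c)\<^sup>2"
    and "B = 2 * (1 / c)\<^sup>2"
  define B2 where "B2 = B * (cmod (coupling \<mu>))\<^sup>2 * vol"
  have nn: "0 \<le> A1" "0 \<le> A2" "0 \<le> B" "0 \<le> B2"
    by (simp_all add: A1_def A2_def B_def B2_def vol_nonneg)
  define C where "C = sqrt ((A1 + A2) + (B + B2 * (A1 + A2)))"
  have "norm_H01 (a, f) \<le> C * norm_H01 (Afib \<gamma> \<mu> k (a, f) - z *\<^sub>C (a, f))" if f: "f \<in> L2 T3" for a f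
  proof -
    define b h where "b = (complex_of_real (w1 \<gamma> k) - z) * a + coupling \<mu> * (LINT t|T3. f t)"
      and "h p = coupling \<mu> * a + (complex_of_real (w2 k p) - z) * f p" for p
    have h: "h \<in> L2 T3" unfolding h_def[abs_def] by (rule w2z_mult[OF f])
    have fe: "f p = r p * (h p + (- (coupling \<mu> * a)))" if "p \<in> cube3" for p
    proof -
      have "r p * (h p + (- (coupling \<mu> * a))) = ((complex_of_real (w2 k p) - z) * r p) * f p"
        by (simp add: h_def)
      then show ?thesis unfolding r_inverse[OF that] by simp
    qed
    have i: "integrable T3 (\<lambda>p. r p * h p)" "integrable T3 r"
      using L2_integrable[OF r_mult(1)[OF h]] L2_integrable[OF r_L2] .
    have "(LINT p|T3. f p) = (LINT p|T3. r p * h p + (- (coupling \<mu> * a)) * r p)"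
      by (rule Bochner_Integration.integral_cong) (use fe in \<open>simp_all add: algebra_simps\<close>)
    also have "\<dots> = (LINT p|T3. r p * h p) + (- (coupling \<mu> * a)) * (LINT p|T3. r p)"
      using i by (subst Bochner_Integration.integral_add) auto
    finally have If: "(LINT p|T3. f p) = (LINT p|T3. r p * h p) + (- (coupling \<mu> * a)) * (LINT p|T3. r p)" .
    have "b = Kz * a + coupling \<mu> * (LINT p|T3. r p * h p)"
      unfolding b_def Kz_def If by (simp add: algebra_simps)
    then have "a = (b + (- (coupling \<mu> * (LINT p|T3. r p * h p)))) / Kz"
      using K by (simp add: field_simps)
    then have "(cmod a)\<^sup>2 = (cmod (b + (- (coupling \<mu> * (LINT p|T3. r p * h p)))))\<^sup>2 / (cmod Kz)\<^sup>2"
      by (simp add: norm_divide power_divide)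
    also have "\<dots> \<le> (2 * (cmod b)\<^sup>2 + 2 * (cmod (- (coupling \<mu> * (LINT p|T3. r p * h p))))\<^sup>2) / (cmod Kz)\<^sup>2"
      by (intro divide_right_mono cmod_add_square) simp
    also have "\<dots> = A1 * (cmod b)\<^sup>2 + A1 * (cmod (coupling \<mu>))\<^sup>2 * (cmod (LINT p|T3. r p * h p))\<^sup>2"
      by (simp add: A1_def norm_mult power_mult_distrib add_divide_distrib)
    also have "\<dots> \<le> A1 * (cmod b)\<^sup>2 + A1 * (cmod (coupling \<mu>))\<^sup>2 * (vol * ((1 / c)\<^sup>2 * sq_norm T3 h))"
    proof -
      have "(cmod (LINT p|T3. r p * h p))\<^sup>2 \<le> vol * sq_norm T3 (\<lambda>p. r p * h p)"
        by (rule cmod_integral_sq[OF r_mult(1)[OF h]])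
      also have "\<dots> \<le> vol * ((1 / c)\<^sup>2 * sq_norm T3 h)"
        by (intro mult_left_mono r_mult(2)[OF h] vol_nonneg)
      finally show ?thesis using nn by (intro add_left_mono mult_left_mono) auto
    qed
    finally have a: "(cmod a)\<^sup>2 \<le> A1 * (cmod b)\<^sup>2 + A2 * sq_norm T3 h" by (simp add: A2_def mult.assoc)
    have "sq_norm T3 f = sq_norm T3 (\<lambda>p. r p * (h p + (- (coupling \<mu> * a))))"
      by (rule sq_norm_cong) (use fe in simp)
    also have "\<dots> \<le> (1 / c)\<^sup>2 * sq_norm T3 (\<lambda>p. h p + (- (coupling \<mu> * a)))"
      by (intro r_mult L2_add h L2_const)
    also have "\<dots> \<le> (1 / c)\<^sup>2 * (2 * sq_norm T3 h + 2 * sq_norm T3 (\<lambda>p. - (coupling \<mu> * a)))"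
      by (intro mult_left_mono L2_add h L2_const) simp
    also have "sq_norm T3 (\<lambda>p. - (coupling \<mu> * a)) = vol * ((cmod (coupling \<mu>))\<^sup>2 * (cmod a)\<^sup>2)"
      by (simp add: sq_norm_def vol_def norm_mult power_mult_distrib)
    finally have f2: "sq_norm T3 f \<le> B * sq_norm T3 h + B2 * (cmod a)\<^sup>2"
      by (simp add: B_def B2_def algebra_simps)
    define p q where "p = (cmod b)\<^sup>2" and "q = sq_norm T3 h"
    have pq: "0 \<le> p" "0 \<le> q" by (simp_all add: p_def q_def)
    have a': "(cmod a)\<^sup>2 \<le> (A1 + A2) * (p + q)"
    proof -
      have "0 \<le> A1 * q + A2 * p" using nn pq by simp
      then show ?thesis using a by (simp add: p_def[symmetric] q_def[symmetric] algebra_simps)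
    qed
    have "sq_norm T3 f \<le> B * (p + q) + B2 * ((A1 + A2) * (p + q))"
      using f2 mult_left_mono[OF a' nn(4)] nn pq
      by (simp add: p_def[symmetric] q_def[symmetric] distrib_left)
        (smt (verit) mult_nonneg_nonneg)
    then have "(cmod a)\<^sup>2 + sq_norm T3 f \<le> ((A1 + A2) + (B + B2 * (A1 + A2))) * (p + q)"
      using a' by (simp add: distrib_right mult.assoc)
    then have "sqrt ((cmod a)\<^sup>2 + sq_norm T3 f) \<le> sqrt (((A1 + A2) + (B + B2 * (A1 + A2))) * (p + q))"
      by (rule real_sqrt_le_mono)
    also have "\<dots> = C * sqrt (p + q)" by (simp add: C_def real_sqrt_mult)
    finally show ?thesis
      unfolding Afib_minus norm_H01_eq b_def[symmetric] h_def[symmetric] by (simp add: p_def q_def)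
  qed
  then have "\<forall>x\<in>H01. norm_H01 x \<le> C * norm_H01 (Afib \<gamma> \<mu> k x - z *\<^sub>C x)"
    by (auto simp: H01_def)
  then show ?thesis by blast
qed

lemma regular: "Kz \<noteq> 0 \<Longrightarrow> regular_point H01 norm_H01 (Afib \<gamma> \<mu> k) z"
  unfolding regular_point_def
proof
  assume K: "Kz \<noteq> 0"
  show "\<forall>y\<in>H01. \<exists>x\<in>H01. norm_H01 (Afib \<gamma> \<mu> k x - z *\<^sub>C x - y) = 0"
    using solve[OF K] by (auto simp: H01_def)
  show "\<exists>c. \<forall>x\<in>H01. norm_H01 x \<le> c * norm_H01 (Afib \<gamma> \<mu> k x - z *\<^sub>C x)"
    by (rule lower_bound[OF K])
qed

text \<open>The second row of the eigenvalue equation solved for first component 1; the first row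
  then says that \<open>Kz\<close> is 0.\<close>

definition eigvec :: "complex \<times> (R3 \<Rightarrow> complex)" where "eigvec = (1, \<lambda>p. - coupling \<mu> * r p)"

lemma eigvec_H01: "eigvec \<in> H01"
  using L2_bounded_mult(1)[OF r_L2, of "\<lambda>_. - coupling \<mu>" "cmod (coupling \<mu>)"] by (simp add: eigvec_def H01_def)

lemma eigvec_norm: "norm_H01 eigvec \<noteq> 0"
  unfolding eigvec_def by (simp add: norm_H01_zero)

lemma eigvec_eigen:
  assumes "Kz = 0"
  shows "eigvec \<in> eigenspace H01 norm_H01 (Afib \<gamma> \<mu> k) z"
proof -
  have "sq_norm T3 (\<lambda>p. coupling \<mu> * 1 + (complex_of_real (w2 k p) - z) * (- coupling \<mu> * r p)) = sq_norm T3 (\<lambda>p. 0)"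
  proof (rule sq_norm_cong)
    fix p assume "p \<in> space T3"
    then have "(complex_of_real (w2 k p) - z) * r p = 1" using r_inverse by simp
    then show "coupling \<mu> * 1 + (complex_of_real (w2 k p) - z) * (- coupling \<mu> * r p) = 0"
      by (metis add.right_inverse minus_mult_left mult.assoc mult.commute mult_1 mult_minus_left mult_1_right)
  qed
  then have "sq_norm T3 (\<lambda>p. coupling \<mu> * 1 + (complex_of_real (w2 k p) - z) * (- coupling \<mu> * r p)) = 0"
    by (simp add: sq_norm_def)
  moreover have "(complex_of_real (w1 \<gamma> k) - z) * 1 + coupling \<mu> * (LINT t|T3. - coupling \<mu> * r t) = 0"
    using assms by (simp add: Kz_def mult.assoc)
  ultimately have "norm_H01 (Afib \<gamma> \<mu> k eigvec - z *\<^sub>C eigvec) = 0"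
    unfolding eigvec_def Afib_minus norm_H01_zero by simp
  then show ?thesis using eigvec_H01 by (simp add: eigenspace_def)
qed

text \<open>The second row determines f from a, so every eigenvector is a times
  \<open>eigvec\<close> up to a null set.\<close>

lemma finite_mult:
  assumes "Kz = 0"
  shows "finite_multiplicity H01 norm_H01 (Afib \<gamma> \<mu> k) z"
  unfolding finite_multiplicity_def
proof (intro exI[of _ "{eigvec}"] conjI ballI)
  show "{eigvec} \<subseteq> eigenspace H01 norm_H01 (Afib \<gamma> \<mu> k) z" using eigvec_eigen[OF assms] by simp
  fix x assume x: "x \<in> eigenspace H01 norm_H01 (Afib \<gamma> \<mu> k) z"
  obtain a f where xa: "x = (a, f)" by (cases x)
  have f: "f \<in> L2 T3" using x by (simp add: eigenspace_def H01_def xa)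
  have "sq_norm T3 (\<lambda>p. coupling \<mu> * a + (complex_of_real (w2 k p) - z) * f p) = 0"
    using x by (simp add: eigenspace_def xa Afib_minus norm_H01_zero)
  then have ae: "AE p in T3. coupling \<mu> * a + (complex_of_real (w2 k p) - z) * f p = 0"
    using sq_norm_zero_AE[OF w2z_mult[OF f]] by blast
  have L: "(\<lambda>p. f p + (coupling \<mu> * a) * r p) \<in> L2 T3"
    by (intro L2_add f L2_bounded_mult[OF r_L2]) auto
  have "AE p in T3. f p + (coupling \<mu> * a) * r p = 0"
    using ae AE_space[of T3]
  proof eventually_elim
    case (elim p)
    have i: "(complex_of_real (w2 k p) - z) * r p = 1" using elim(2) r_inverse by simp
    have "f p + (coupling \<mu> * a) * r p = ((complex_of_real (w2 k p) - z) * r p) * f p + (coupling \<mu> * a) * r p"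
      unfolding i by simp
    also have "\<dots> = r p * (coupling \<mu> * a + (complex_of_real (w2 k p) - z) * f p)"
      by (simp add: algebra_simps)
    finally show ?case using elim(1) by simp
  qed
  then have "sq_norm T3 (\<lambda>p. f p + (coupling \<mu> * a) * r p) = 0" using sq_norm_zero_AE[OF L] by blast
  moreover have "x - (\<Sum>b\<in>{eigvec}. a *\<^sub>C b) = (0, \<lambda>p. f p + (coupling \<mu> * a) * r p)"
    by (simp add: xa eigvec_def scaleC_prod_def scaleC_complex_def scaleC_fun_def fun_eq_iff mult_ac)
  ultimately show "\<exists>c. norm_H01 (x - (\<Sum>b\<in>{eigvec}. c b *\<^sub>C b)) = 0"
    by (intro exI[of _ "\<lambda>_. a"]) (simp add: norm_H01_zero)
qed simp

lemma not_regular: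
  assumes "Kz = 0"
  shows "\<not> regular_point H01 norm_H01 (Afib \<gamma> \<mu> k) z"
proof
  assume "regular_point H01 norm_H01 (Afib \<gamma> \<mu> k) z"
  then obtain C where "norm_H01 eigvec \<le> C * norm_H01 (Afib \<gamma> \<mu> k eigvec - z *\<^sub>C eigvec)"
    using eigvec_H01 unfolding regular_point_def by blast
  then have "norm_H01 eigvec \<le> 0" using eigvec_eigen[OF assms] by (simp add: eigenspace_def)
  moreover have "0 \<le> norm_H01 eigvec" by (simp add: eigvec_def norm_H01_eq)
  ultimately show False using eigvec_norm by linarith
qed

end

text \<open>The zero of the determinant is isolated: by the resolvent identity the determinant at \<open>y\<close>
  is \<open>x - y\<close> times a factor with real part at least 1.\<close>

lemma fibre_discrete_eigenvalue:
  fixes x c :: real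
  assumes c: "0 < c" "\<And>p. p \<in> cube3 \<Longrightarrow> c \<le> \<bar>w2 k p - x\<bar>"
    and zero: "w1 \<gamma> k - x = \<mu>\<^sup>2 / 2 * (LINT p|T3. 1 / (w2 k p - x))"
  shows "x \<in> sigma_disc_fib \<gamma> \<mu> k"
proof -
  have cm: "cmod (complex_of_real a - complex_of_real x) = \<bar>a - x\<bar>" for a
    by (simp add: of_real_diff[symmetric] del: of_real_diff)
  interpret X: fibre \<gamma> \<mu> k "complex_of_real x" c
    by unfold_locales (use c cm in auto)
  have Ir: "(LINT p|T3. X.r p) = complex_of_real (LINT p|T3. 1 / (w2 k p - x))"
    unfolding integral_complex_of_real[symmetric] X.r_def by simp
  have K0: "X.Kz = 0"
  proof -
    have "X.Kz = complex_of_real (w1 \<gamma> k - x - \<mu>\<^sup>2 / 2 * (LINT p|T3. 1 / (w2 k p - x)))"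
      unfolding X.Kz_def Ir coupling_sq by simp
    then show ?thesis using zero by simp
  qed
  have reg: "regular_point H01 norm_H01 (Afib \<gamma> \<mu> k) y"
    if y: "cmod (y - complex_of_real x) < c / 2" "y \<noteq> complex_of_real x" for y
  proof -
    \<comment> \<open>Half of the distance remains for y, so the reduction to a scalar applies at y
      as well.\<close>
    have c2: "c / 2 \<le> cmod (complex_of_real (w2 k p) - y)" if "p \<in> cube3" for p
    proof -
      have "cmod (complex_of_real (w2 k p) - complex_of_real x)
          \<le> cmod (complex_of_real (w2 k p) - y) + cmod (y - complex_of_real x)"
        using norm_triangle_ineq[of "complex_of_real (w2 k p) - y" "y - complex_of_real x"] by simp
      then show ?thesis using X.c(2)[OF that] y(1) by simp
    qed
    interpret Y: fibre \<gamma> \<mu> k y "c / 2"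
      by unfold_locales (use c c2 in auto)
    have iY: "integrable T3 Y.r" and iX: "integrable T3 X.r"
      using L2_integrable[OF Y.r_L2] L2_integrable[OF X.r_L2] .
    have iXY: "integrable T3 (\<lambda>p. Y.r p * X.r p)"
      by (rule L2_integrable[OF Y.r_mult(1)[OF X.r_L2]])
    have id: "Y.r p - X.r p = (y - complex_of_real x) * (Y.r p * X.r p)" if "p \<in> cube3" for p
    proof -
      have "Y.r p - X.r p = ((complex_of_real (w2 k p) - complex_of_real x) * X.r p) * Y.r p
          - ((complex_of_real (w2 k p) - y) * Y.r p) * X.r p"
        unfolding X.r_inverse[OF that] Y.r_inverse[OF that] by simp
      then show ?thesis by (simp add: algebra_simps)
    qed
    have "(LINT p|T3. Y.r p) - (LINT p|T3. X.r p) = (LINT p|T3. Y.r p - X.r p)"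
      using iX iY by simp
    also have "\<dots> = (LINT p|T3. (y - complex_of_real x) * (Y.r p * X.r p))"
      by (rule Bochner_Integration.integral_cong) (use id in auto)
    also have "\<dots> = (y - complex_of_real x) * (LINT p|T3. Y.r p * X.r p)" by simp
    finally have dI: "(LINT p|T3. Y.r p) - (LINT p|T3. X.r p) = (y - complex_of_real x) * (LINT p|T3. Y.r p * X.r p)" .
    have "Y.Kz = Y.Kz - X.Kz" using K0 by simp
    also have "\<dots> = - (y - complex_of_real x) - coupling \<mu> * coupling \<mu> * ((LINT p|T3. Y.r p) - (LINT p|T3. X.r p))"
      by (simp add: Y.Kz_def X.Kz_def algebra_simps)
    also have "\<dots> = - (y - complex_of_real x) * (1 + coupling \<mu> * coupling \<mu> * (LINT p|T3. Y.r p * X.r p))"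
      unfolding dI by (simp add: algebra_simps)
    finally have K: "Y.Kz = - (y - complex_of_real x) * (1 + coupling \<mu> * coupling \<mu> * (LINT p|T3. Y.r p * X.r p))" .
    \<comment> \<open>The real part of \<open>Y.r p\<close> has the sign of t - Re d, which is the
      sign of t because |Re d| < c \<le> |t|; and \<open>X.r p\<close> is the real number 1 /
      t.\<close>
    have pos: "0 \<le> Re (Y.r p * X.r p)" if p: "p \<in> cube3" for p
    proof -
      define t d where "t = w2 k p - x" and "d = y - complex_of_real x"
      have t: "c \<le> \<bar>t\<bar>" using c(2)[OF p] by (simp add: t_def)
      have dR: "\<bar>Re d\<bar> < c" using abs_Re_le_cmod[of d] y(1) c(1) by (simp add: d_def)
      have Xr: "X.r p = complex_of_real (1 / t)"
        by (simp add: X.r_def t_def)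
      have Yr: "Y.r p = 1 / (complex_of_real t - d)"
        by (simp add: Y.r_def t_def d_def)
      have "Re (Y.r p) = (t - Re d) / (cmod (complex_of_real t - d))\<^sup>2"
        unfolding Yr by (simp add: Re_divide cmod_power2)
      then have e: "Re (Y.r p * X.r p) = ((t - Re d) / t) / (cmod (complex_of_real t - d))\<^sup>2"
        unfolding Xr by simp
      have "0 \<le> (t - Re d) / t"
        using t dR c(1) by (cases "0 < t") (auto simp: zero_le_divide_iff)
      then show ?thesis unfolding e by (rule divide_nonneg_nonneg) simp
    qed
    have "Re (LINT p|T3. Y.r p * X.r p) = (LINT p|T3. Re (Y.r p * X.r p))"
      by (rule integral_Re[OF iXY, symmetric])
    also have "\<dots> \<ge> 0"
      using pos by (intro integral_nonneg_AE AE_I2) auto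
    finally have "0 \<le> Re (LINT p|T3. Y.r p * X.r p)" .
    then have ge1: "1 \<le> Re (1 + coupling \<mu> * coupling \<mu> * (LINT p|T3. Y.r p * X.r p))"
      unfolding coupling_sq by simp
    have "1 + coupling \<mu> * coupling \<mu> * (LINT p|T3. Y.r p * X.r p) \<noteq> 0"
    proof
      assume "1 + coupling \<mu> * coupling \<mu> * (LINT p|T3. Y.r p * X.r p) = 0"
      then show False using ge1 by (simp only: zero_complex.simps)
    qed
    then have "Y.Kz \<noteq> 0" unfolding K using y(2) by simp
    then show ?thesis by (rule Y.regular)
  qed
  have "complex_of_real x isolated_in op_spectrum H01 norm_H01 (Afib \<gamma> \<mu> k)"
    unfolding isolated_in_def
  proof
    show "complex_of_real x \<in> op_spectrum H01 norm_H01 (Afib \<gamma> \<mu> k)"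
      using X.not_regular[OF K0] by (simp add: op_spectrum_def)
    moreover have "y = complex_of_real x"
      if "y \<in> ball (complex_of_real x) (c / 2)" "y \<in> op_spectrum H01 norm_H01 (Afib \<gamma> \<mu> k)" for y
      by (rule ccontr) (use reg[of y] that in \<open>simp add: op_spectrum_def dist_norm norm_minus_commute\<close>)
    ultimately have "ball (complex_of_real x) (c / 2) \<inter> op_spectrum H01 norm_H01 (Afib \<gamma> \<mu> k) = {complex_of_real x}"
      using c(1) by auto
    then show "\<exists>T. open T \<and> T \<inter> op_spectrum H01 norm_H01 (Afib \<gamma> \<mu> k) = {complex_of_real x}"
      using open_ball by blast
  qed
  moreover have "eigenvalue H01 norm_H01 (Afib \<gamma> \<mu> k) (complex_of_real x)"
    unfolding eigenvalue_def using X.eigvec_eigen[OF K0] X.eigvec_norm by blast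
  ultimately show ?thesis
    using X.finite_mult[OF K0] by (simp add: sigma_disc_fib_def disc_spectrum_def)
qed

text \<open>No distance of x from the values of \<open>w2 k\<close> is available. Still, the second
  row forces f to be a multiple of 1 / (w2 - x) almost everywhere, and a nonzero one, since a = 0
  would make the whole vector null. Square integrability of f gives the first claim, the first row
  the second.\<close>

lemma fibre_eigenvalue_at_edge:
  fixes x :: real
  assumes ev: "x \<in> sigma_disc_fib \<gamma> \<mu> k" and ne: "AE p in T3. w2 k p \<noteq> x" and mu: "\<mu> \<noteq> 0"
  shows "integrable T3 (\<lambda>p. (1 / (w2 k p - x))\<^sup>2)"
    and "w1 \<gamma> k - x = \<mu>\<^sup>2 / 2 * (LINT p|T3. 1 / (w2 k p - x))"
proof -
  have "eigenvalue H01 norm_H01 (Afib \<gamma> \<mu> k) (complex_of_real x)"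
    using ev by (simp add: sigma_disc_fib_def disc_spectrum_def)
  then obtain a f where f: "f \<in> L2 T3" and nz: "norm_H01 (a, f) \<noteq> 0"
    and z: "norm_H01 (Afib \<gamma> \<mu> k (a, f) - complex_of_real x *\<^sub>C (a, f)) = 0"
    by (auto simp: eigenvalue_def eigenspace_def H01_def)
  have z1: "(complex_of_real (w1 \<gamma> k) - complex_of_real x) * a + coupling \<mu> * (LINT t|T3. f t) = 0"
    and z2: "sq_norm T3 (\<lambda>p. coupling \<mu> * a + (complex_of_real (w2 k p) - complex_of_real x) * f p) = 0"
    using z by (auto simp: Afib_minus norm_H01_zero)
  have "(\<lambda>p. coupling \<mu> * a + (complex_of_real (w2 k p) - complex_of_real x) * f p) \<in> L2 T3"
  proof (intro L2_add L2_const L2_bounded_mult[OF f])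
    show "cmod (complex_of_real (w2 k p) - complex_of_real x) \<le> 18 + \<bar>x\<bar>" for p
      using norm_triangle_ineq4[of "complex_of_real (w2 k p)" "complex_of_real x"] w2_bounds[of k p] by simp
  qed measurable
  then have ae: "AE p in T3. coupling \<mu> * a + (complex_of_real (w2 k p) - complex_of_real x) * f p = 0"
    using sq_norm_zero_AE z2 by blast
  have fe: "AE p in T3. f p = - (coupling \<mu> * a) * complex_of_real (1 / (w2 k p - x))"
    using ae ne
  proof eventually_elim
    case (elim p)
    have n: "complex_of_real (w2 k p - x) \<noteq> 0" using elim(2) by (simp add: of_real_eq_0_iff del: of_real_diff)
    have "complex_of_real (w2 k p - x) * f p + coupling \<mu> * a = 0"
      using elim(1) by (simp add: add.commute)
    then have e: "complex_of_real (w2 k p - x) * f p = - (coupling \<mu> * a)"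
      by (rule eq_neg_iff_add_eq_0[THEN iffD2])
    have "f p = (complex_of_real (w2 k p - x) * f p) * (1 / complex_of_real (w2 k p - x))"
      using n by simp
    then show ?case unfolding e by simp
  qed
  have a0: "a \<noteq> 0"
  proof
    assume "a = 0"
    then have "AE p in T3. f p = 0" using fe by simp
    then have "sq_norm T3 f = 0" using sq_norm_zero_AE[OF f] by blast
    then show False using nz \<open>a = 0\<close> by (simp add: norm_H01_zero)
  qed
  have b0: "coupling \<mu> * a \<noteq> 0" using a0 mu by (simp add: coupling_def)
  define C where "C = (cmod (coupling \<mu> * a))\<^sup>2"
  have C: "0 < C" using b0 by (simp add: C_def)
  have "AE p in T3. (cmod (f p))\<^sup>2 = C * (1 / (w2 k p - x))\<^sup>2"
    using fe by (rule eventually_mono) (simp add: C_def norm_mult power_mult_distrib norm_divide power_divide flip: of_real_diff)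
  then have "integrable T3 (\<lambda>p. C * (1 / (w2 k p - x))\<^sup>2)"
    using f by (subst integrable_cong_AE[symmetric, where f = "\<lambda>p. (cmod (f p))\<^sup>2"]) (auto simp: L2_def)
  then have i2: "integrable T3 (\<lambda>p. (1 / (w2 k p - x))\<^sup>2)"
    using C by simp
  then show "integrable T3 (\<lambda>p. (1 / (w2 k p - x))\<^sup>2)" .
  have "(LINT t|T3. f t) = (LINT p|T3. - (coupling \<mu> * a) * complex_of_real (1 / (w2 k p - x)))"
    by (rule integral_cong_AE) (use fe L2_meas[OF f] in auto)
  also have "\<dots> = - (coupling \<mu> * a) * complex_of_real (LINT p|T3. 1 / (w2 k p - x))"
    by (simp only: Bochner_Integration.integral_mult_right_zero integral_complex_of_real)
  finally have "((complex_of_real (w1 \<gamma> k) - complex_of_real x) - coupling \<mu> * coupling \<mu> * complex_of_real (LINT p|T3. 1 / (w2 k p - x))) * a = 0"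
    using z1 by (simp add: algebra_simps)
  then have "complex_of_real (w1 \<gamma> k - x - \<mu>\<^sup>2 / 2 * (LINT p|T3. 1 / (w2 k p - x))) = 0"
    using a0 unfolding coupling_sq by simp
  then show "w1 \<gamma> k - x = \<mu>\<^sup>2 / 2 * (LINT p|T3. 1 / (w2 k p - x))"
    by (simp add: of_real_eq_0_iff del: of_real_diff of_real_mult of_real_divide)
qed

section \<open>The discrete spectrum\<close>

interpretation L: side 1 by unfold_locales simp
interpretation R: side "-1" by unfold_locales simp

lemma L2_scale: "f \<in> L2 M \<Longrightarrow> (\<lambda>x. a * f x) \<in> L2 M"
  by (rule L2_bounded_mult(1)[where B = "cmod a"]) auto

lemma norm_H12_zero: "norm_H12 (f, F) = 0 \<longleftrightarrow> sq_norm T3 f = 0 \<and> sq_norm T3T3 F = 0"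
  by (simp add: norm_H12_def add_nonneg_eq_0_iff)

lemma L2_Re_Im:
  assumes "f \<in> L2 M"
  shows "L2r M (\<lambda>x. Re (f x))" "L2r M (\<lambda>x. Im (f x))"
proof -
  have m: "f \<in> borel_measurable M" by (rule L2_meas[OF assms])
  have i: "integrable M (\<lambda>x. (cmod (f x))\<^sup>2)" using assms by (simp add: L2_def)
  have "integrable M (\<lambda>x. (Re (f x))\<^sup>2)" "integrable M (\<lambda>x. (Im (f x))\<^sup>2)"
    by (rule Bochner_Integration.integrable_bound[OF i]; use m in \<open>simp add: cmod_power2\<close>)+
  then show "L2r M (\<lambda>x. Re (f x))" "L2r M (\<lambda>x. Im (f x))" using m by (auto simp: L2r_def)
qed

lemma sq_norm_Re_Im:
  assumes "f \<in> L2 M"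
  shows "sq_norm M f = (LINT x|M. Re (f x) * Re (f x)) + (LINT x|M. Im (f x) * Im (f x))"
  using L2_Re_Im[OF assms] by (simp add: sq_norm_def cmod_power2 L2r_def flip: power2_eq_square)

text \<open>A residual of seminorm 0 vanishes almost everywhere only if it is known to be square
  integrable, since the integral of a nonintegrable function is 0 by convention. Most of the proof
  supplies this; for the marginal of F it is Cauchy-Schwarz in t on almost every slice.\<close>

lemma A_eigenvector:
  assumes "x \<in> sigma_disc_A \<gamma> \<mu>"
  obtains f F where "f \<in> L2 T3" "F \<in> L2 T3T3" "AE x in T3T3. F (fst x, snd x) = F (snd x, fst x)"
    "sq_norm T3 f \<noteq> 0 \<or> sq_norm T3T3 F \<noteq> 0"
    "AE k in T3. complex_of_real x * f k = complex_of_real (w1 \<gamma> k) * f k + complex_of_real \<mu> * (LINT t|T3. F (k, t))"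
    "AE y in T3T3. complex_of_real x * F y = complex_of_real (w2 (fst y) (snd y)) * F y
      + complex_of_real \<mu> * ((f (fst y) + f (snd y)) / 2)"
proof -
  have "eigenvalue H12 norm_H12 (Aop \<gamma> \<mu>) (complex_of_real x)"
    using assms by (simp add: sigma_disc_A_def disc_spectrum_def)
  then obtain f F where fF: "f \<in> L2 T3" "F \<in> L2sym" and nz: "norm_H12 (f, F) \<noteq> 0"
    and z: "norm_H12 (Aop \<gamma> \<mu> (f, F) - complex_of_real x *\<^sub>C (f, F)) = 0"
    by (auto simp: eigenvalue_def eigenspace_def H12_def)
  have F: "F \<in> L2 T3T3" and sym: "AE x in T3T3. F (fst x, snd x) = F (snd x, fst x)"
    using fF(2) by (auto simp: L2sym_def)
  note [measurable] = L2_meas[OF fF(1)] L2_meas[OF F]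
  let ?h1 = "\<lambda>k. complex_of_real (w1 \<gamma> k) * f k + complex_of_real \<mu> * (LINT t|T3. F (k, t)) - complex_of_real x * f k"
  let ?h2 = "\<lambda>y. complex_of_real \<mu> * ((f (fst y) + f (snd y)) / 2) + complex_of_real (w2 (fst y) (snd y)) * F y - complex_of_real x * F y"
  have e: "Aop \<gamma> \<mu> (f, F) - complex_of_real x *\<^sub>C (f, F) = (?h1, ?h2)"
    by (auto simp: Aop_def A11_def A12_def A12_adj_def A22_def scaleC_prod_def scaleC_fun_def scaleC_complex_def fun_eq_iff)
  have z1: "sq_norm T3 ?h1 = 0" and z2: "sq_norm T3T3 ?h2 = 0"
    using z unfolding e norm_H12_zero by auto
  have F2: "integrable T3T3 (\<lambda>x. (cmod (F x))\<^sup>2)" using F by (simp add: L2_def)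
  have sec: "(\<lambda>k. LINT t|T3. F (k, t)) \<in> L2 T3"
  proof -
    have bound: "AE k in T3. (cmod (LINT t|T3. F (k, t)))\<^sup>2 \<le> vol * (LINT t|T3. (cmod (F (k, t)))\<^sup>2)"
      using T3T3.AE_integrable_fst'[OF F2] AE_space[of T3]
    proof eventually_elim
      case (elim k)
      then have "(\<lambda>t. F (k, t)) \<in> L2 T3" by (auto simp: L2_def)
      from cmod_integral_sq[OF this] show ?case by (simp add: sq_norm_def)
    qed
    have m: "(\<lambda>k. LINT t|T3. F (k, t)) \<in> borel_measurable T3"
      by (rule T3.borel_measurable_lebesgue_integral) simp
    have "integrable T3 (\<lambda>k. (cmod (LINT t|T3. F (k, t)))\<^sup>2)"
    proof (rule Bochner_Integration.integrable_bound)
      show "integrable T3 (\<lambda>k. vol * (LINT t|T3. (cmod (F (k, t)))\<^sup>2))"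
        using T3T3.integrable_fst'[OF F2] by simp
      show "AE k in T3. norm ((cmod (LINT t|T3. F (k, t)))\<^sup>2) \<le> norm (vol * (LINT t|T3. (cmod (F (k, t)))\<^sup>2))"
        using bound by (rule eventually_mono) (simp add: order_trans[OF _ abs_ge_self])
    qed (use m in simp)
    then show ?thesis using m by (simp add: L2_def)
  qed
  have w1m: "w1 \<gamma> \<in> borel_measurable T3" unfolding w1_def[abs_def] by measurable
  note [measurable] = w1m
  have w1c: "(\<lambda>k. complex_of_real (w1 \<gamma> k)) \<in> borel_measurable T3" by measurable
  have w1b: "cmod (complex_of_real (w1 \<gamma> k)) \<le> 6 + \<bar>\<gamma>\<bar>" for k
    unfolding norm_of_real w1_def using eps_nonneg[of k] eps_le[of k] by linarith
  have h1: "?h1 \<in> L2 T3"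
  proof -
    have "(\<lambda>k. (complex_of_real (w1 \<gamma> k) * f k + complex_of_real \<mu> * (LINT t|T3. F (k, t))) + (- complex_of_real x) * f k) \<in> L2 T3"
      by (intro L2_add L2_scale fF(1) sec L2_bounded_mult(1)[OF fF(1) w1c w1b])
    then show ?thesis by simp
  qed
  then have ae1: "AE k in T3. ?h1 k = 0" using sq_norm_zero_AE z1 by blast
  have w2m: "(\<lambda>y. w2 (fst y) (snd y)) \<in> borel_measurable T3T3"
  proof -
    have "w2 k p = 18 - L.shifted_w2 k p" for k p using L.shifted_w2_w2[of k p] by simp
    then show ?thesis by simp
  qed
  note [measurable] = w2m
  have w2c: "(\<lambda>y. complex_of_real (w2 (fst y) (snd y))) \<in> borel_measurable T3T3" by measurable
  have w2b: "cmod (complex_of_real (w2 (fst y) (snd y))) \<le> 18" for y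
    using w2_bounds[of "fst y" "snd y"] by simp
  have cfst: "(\<lambda>y. f (fst y)) \<in> L2 T3T3" "(\<lambda>y. f (snd y)) \<in> L2 T3T3"
    using L2r_fst[OF L2_L2r[OF fF(1)]] L2r_snd[OF L2_L2r[OF fF(1)]] by (auto simp: L2_def L2r_def)
  have h2: "?h2 \<in> L2 T3T3"
  proof -
    have "(\<lambda>y. ((complex_of_real \<mu> / 2) * (f (fst y) + f (snd y)) + complex_of_real (w2 (fst y) (snd y)) * F y) + (- complex_of_real x) * F y) \<in> L2 T3T3"
      by (intro L2_add L2_scale F cfst L2_bounded_mult(1)[OF F w2c w2b])
    then show ?thesis by simp
  qed
  then have ae2: "AE y in T3T3. ?h2 y = 0" using sq_norm_zero_AE z2 by blast
  show thesis
  proof (rule that[OF fF(1) F sym])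
    show "sq_norm T3 f \<noteq> 0 \<or> sq_norm T3T3 F \<noteq> 0" using nz by (simp add: norm_H12_zero)
    show "AE k in T3. complex_of_real x * f k = complex_of_real (w1 \<gamma> k) * f k + complex_of_real \<mu> * (LINT t|T3. F (k, t))"
      using ae1 by (rule eventually_mono) simp
    show "AE y in T3T3. complex_of_real x * F y = complex_of_real (w2 (fst y) (snd y)) * F y
      + complex_of_real \<mu> * ((f (fst y) + f (snd y)) / 2)"
      using ae2 by (rule eventually_mono) (simp add: algebra_simps)
  qed
qed

section \<open>Both edges in the common form, and the fibre determinant beyond the edge\<close>

context side begin

text \<open>This is 18 - w1 for s = 1 and w1 for s = -1, written with \<open>gap\<close> to show how
  much it drops from its value at \<open>kcrit\<close>.\<close>

definition shifted_w1 :: "real \<Rightarrow> R3 \<Rightarrow> real" where "shifted_w1 \<gamma> k = 12 + 6 * s - s * \<gamma> - gap k"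

lemma s_sq [simp]: "s * s = 1" using s by auto

lemma shifted_w1_w1: "shifted_w1 \<gamma> k = 9 - s * (w1 \<gamma> k - 9)"
  using s by (auto simp: shifted_w1_def w1_def gap_eps)

lemma shifted_w1_measurable [measurable]: "shifted_w1 \<gamma> \<in> borel_measurable T3"
  unfolding shifted_w1_def[abs_def] by measurable

lemma shifted_w1_bound: "\<bar>shifted_w1 \<gamma> k\<bar> \<le> 24 + \<bar>\<gamma>\<bar>"
  using s gap_nonneg[of k] gap_le[of k] by (auto simp: shifted_w1_def)

text \<open>The map 9 - s (l - 9) is 18 - l for s = 1 and the identity for s = -1; accordingly the
  coupling becomes -s \<mu>. The squared norms of the real and the imaginary part add up to that of
  the eigenvector, so one part is nonzero; \<open>part\<close> treats both through a real-linear
  R.\<close>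

lemma A_real_eigen:
  assumes x: "9 - s * (l - 9) \<in> sigma_disc_A \<gamma> \<mu>"
  shows "\<exists>f F. real_eigen (shifted_w1 \<gamma>) (- s * \<mu>) l f F"
proof -
  define x where "x = 9 - s * (l - 9)"
  have lx: "l = 9 - s * (x - 9)" using s by (auto simp: x_def)
  obtain f F where f: "f \<in> L2 T3" and F: "F \<in> L2 T3T3" and sym: "AE x in T3T3. F (fst x, snd x) = F (snd x, fst x)"
    and nz: "sq_norm T3 f \<noteq> 0 \<or> sq_norm T3T3 F \<noteq> 0"
    and e1: "AE k in T3. complex_of_real x * f k = complex_of_real (w1 \<gamma> k) * f k + complex_of_real \<mu> * (LINT t|T3. F (k, t))"
    and e2: "AE y in T3T3. complex_of_real x * F y = complex_of_real (w2 (fst y) (snd y)) * F y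
      + complex_of_real \<mu> * ((f (fst y) + f (snd y)) / 2)"
    by (rule A_eigenvector[OF x[folded x_def]])
  have flip1: "l * a = shifted_w1 \<gamma> k * a + (- s * \<mu>) * b" if "x * a = w1 \<gamma> k * a + \<mu> * b" for a b k
  proof -
    have "l * a = 9 * a - s * (x * a) + 9 * s * a" by (simp add: lx algebra_simps)
    then show ?thesis unfolding that shifted_w1_w1 by (simp add: algebra_simps)
  qed
  have flip2: "l * a = shifted_w2 k p * a + (- s * \<mu>) * b" if "x * a = w2 k p * a + \<mu> * b" for a b k p
  proof -
    have "l * a = 9 * a - s * (x * a) + 9 * s * a" by (simp add: lx algebra_simps)
    then show ?thesis unfolding that shifted_w2_w2 by (simp add: algebra_simps)
  qed
  have iF: "AE k in T3. integrable T3 (\<lambda>t. F (k, t))"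
    using T3T3f.L2r_integrable[OF L2_L2r[OF F]] L2_meas[OF F]
    by (intro T3T3.AE_integrable_fst') (simp add: integrable_norm_iff)
  have part: "real_eigen (shifted_w1 \<gamma>) (- s * \<mu>) l (\<lambda>k. R (f k)) (\<lambda>y. R (F y))"
    if L: "L2r T3 (\<lambda>k. R (f k))" "L2r T3T3 (\<lambda>y. R (F y))"
      and lin: "\<And>a b. R (a + b) = R a + R b" "\<And>a b. R (complex_of_real a * b) = a * R b"
      and int: "\<And>g. integrable T3 g \<Longrightarrow> R (LINT t|T3. g t) = (LINT t|T3. R (g t))"
      and pos: "0 < ip (\<lambda>k. R (f k)) (\<lambda>y. R (F y)) (\<lambda>k. R (f k)) (\<lambda>y. R (F y))" for R :: "complex \<Rightarrow> real"
    unfolding real_eigen_def is_image_def sym2_def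
  proof (intro conjI L pos)
    have half: "R (b / 2) = R b / 2" for b using lin(2)[of "1/2" b] by simp
    show "AE x in T3T3. R (F (fst x, snd x)) = R (F (snd x, fst x))"
      using sym by (rule eventually_mono) simp
    show "AE k in T3. l * R (f k) = shifted_w1 \<gamma> k * R (f k) + - s * \<mu> * (LINT t|T3. R (F (k, t)))"
      using e1 iF
    proof eventually_elim
      case (elim k)
      have "x * R (f k) = w1 \<gamma> k * R (f k) + \<mu> * (LINT t|T3. R (F (k, t)))"
        using arg_cong[OF elim(1), of R] unfolding lin int[OF elim(2)] .
      then show ?case by (rule flip1)
    qed
    show "AE y in T3T3. l * R (F y) = vF (\<lambda>y. R (F y)) y + - s * \<mu> * avg (\<lambda>k. R (f k)) y"
      using e2
    proof eventually_elim
      case (elim y)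
      have "x * R (F y) = w2 (fst y) (snd y) * R (F y) + \<mu> * ((R (f (fst y)) + R (f (snd y))) / 2)"
        using arg_cong[OF elim, of R] unfolding lin half .
      then show ?case unfolding vF_def avg_def by (rule flip2)
    qed
  qed
  note LR = L2_Re_Im[OF f] L2_Re_Im[OF F]
  let ?R = "ip (\<lambda>k. Re (f k)) (\<lambda>y. Re (F y)) (\<lambda>k. Re (f k)) (\<lambda>y. Re (F y))"
  let ?I = "ip (\<lambda>k. Im (f k)) (\<lambda>y. Im (F y)) (\<lambda>k. Im (f k)) (\<lambda>y. Im (F y))"
  have "?R + ?I = sq_norm T3 f + sq_norm T3T3 F"
    by (simp add: ip_def sq_norm_Re_Im[OF f] sq_norm_Re_Im[OF F])
  moreover have "0 < sq_norm T3 f + sq_norm T3T3 F"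
    using nz sq_norm_nonneg[of T3 f] sq_norm_nonneg[of T3T3 F] by linarith
  ultimately consider "0 < ?R" | "0 < ?I" by linarith
  then show ?thesis
  proof cases
    case 1
    then show ?thesis using part[of Re] LR by (simp add: integral_Re) blast
  next
    case 2
    then show ?thesis using part[of Im] LR by (simp add: integral_Im) blast
  qed
qed

text \<open>For z > 18 the Schur complement \<open>Kz\<close> at the real point 9 - s (z - 9) is s
  times this.\<close>

definition fib_det :: "real \<Rightarrow> real \<Rightarrow> R3 \<Rightarrow> real \<Rightarrow> real" where
  "fib_det \<gamma> \<mu> k z = z - shifted_w1 \<gamma> k - \<mu>\<^sup>2 / 2 * loop_int k z"

lemma fib_det_ge:
  assumes "18 < z" "k \<in> cube3"
  shows "gap k + fib_det \<gamma> \<mu> kcrit z \<le> fib_det \<gamma> \<mu> k z"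
proof -
  have "\<mu>\<^sup>2 / 2 * loop_int k z \<le> \<mu>\<^sup>2 / 2 * loop_int kcrit z"
    by (intro mult_left_mono loop_int_le_kcrit assms) simp
  then show ?thesis by (simp add: fib_det_def shifted_w1_def)
qed

lemma inverse_s_mult: "1 / (s * a) = s * (1 / a)"
  using s by auto

lemma w2_minus: "w2 k p - (9 - s * (z - 9)) = s * (z - shifted_w2 k p)"
  using s by (auto simp: shifted_w2_w2)

lemma fib_det_zero_in_spectrum:
  assumes z: "18 < z" and zero: "fib_det \<gamma> \<mu> k z = 0"
  shows "9 - s * (z - 9) \<in> sigma_disc_fib \<gamma> \<mu> k"
proof (rule fibre_discrete_eigenvalue[of "z - 18"])
  show "0 < z - 18" using z by simp
  show "z - 18 \<le> \<bar>w2 k p - (9 - s * (z - 9))\<bar>" for p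
    unfolding w2_minus using s z shifted_w2_le_18[of k p] by (auto simp: abs_mult)
  have "(LINT p|T3. 1 / (w2 k p - (9 - s * (z - 9)))) = (LINT p|T3. s * (1 / (z - shifted_w2 k p)))"
    unfolding w2_minus inverse_s_mult ..
  also have "\<dots> = s * loop_int k z" unfolding loop_int_def by (rule Bochner_Integration.integral_mult_right_zero)
  finally have I: "(LINT p|T3. 1 / (w2 k p - (9 - s * (z - 9)))) = s * loop_int k z" .
  have "w1 \<gamma> k - (9 - s * (z - 9)) = s * (z - shifted_w1 \<gamma> k)" using s by (auto simp: shifted_w1_w1)
  also have "\<dots> = s * (\<mu>\<^sup>2 / 2 * loop_int k z)" using zero by (simp add: fib_det_def)
  finally show "w1 \<gamma> k - (9 - s * (z - 9)) = \<mu>\<^sup>2 / 2 * (LINT p|T3. 1 / (w2 k p - (9 - s * (z - 9))))"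
    unfolding I by simp
qed

text \<open>Supplies the continuity for the intermediate value argument; the bound degenerates as a
  approaches the edge.\<close>

lemma loop_int_lipschitz:
  assumes a: "18 < a" "a \<le> y" "a \<le> z"
  shows "\<bar>loop_int k y - loop_int k z\<bar> \<le> vol / (a - 18)\<^sup>2 * \<bar>y - z\<bar>"
proof -
  have yz: "18 < y" "18 < z" using a by auto
  have "loop_int k y - loop_int k z = (LINT t|T3. 1 / (y - shifted_w2 k t) - 1 / (z - shifted_w2 k t))"
    unfolding loop_int_def using integrable_loop_int yz by simp
  also have "\<bar>\<dots>\<bar> \<le> (LINT t|T3. \<bar>1 / (y - shifted_w2 k t) - 1 / (z - shifted_w2 k t)\<bar>)"
    by (rule integral_abs_bound)
  also have "\<dots> \<le> (LINT t|T3. 1 / (a - 18)\<^sup>2 * \<bar>y - z\<bar>)"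
  proof (rule integral_mono)
    show "integrable T3 (\<lambda>t. \<bar>1 / (y - shifted_w2 k t) - 1 / (z - shifted_w2 k t)\<bar>)"
      by (intro integrable_abs Bochner_Integration.integrable_diff integrable_loop_int yz)
    fix t
    have p: "a - 18 \<le> y - shifted_w2 k t" "a - 18 \<le> z - shifted_w2 k t" "0 < a - 18"
      using shifted_w2_le_18[of k t] a by auto
    then have "1 / (y - shifted_w2 k t) - 1 / (z - shifted_w2 k t) = (z - y) / ((y - shifted_w2 k t) * (z - shifted_w2 k t))"
      by (simp add: diff_frac_eq)
    then have "\<bar>1 / (y - shifted_w2 k t) - 1 / (z - shifted_w2 k t)\<bar> = \<bar>y - z\<bar> / ((y - shifted_w2 k t) * (z - shifted_w2 k t))"
      using p by (simp add: abs_mult abs_minus_commute)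
    also have "\<dots> \<le> \<bar>y - z\<bar> / ((a - 18) * (a - 18))"
      using p by (intro divide_left_mono mult_mono mult_pos_pos) auto
    finally show "\<bar>1 / (y - shifted_w2 k t) - 1 / (z - shifted_w2 k t)\<bar> \<le> 1 / (a - 18)\<^sup>2 * \<bar>y - z\<bar>"
      by (simp add: power2_eq_square)
  qed simp
  also have "\<dots> = vol / (a - 18)\<^sup>2 * \<bar>y - z\<bar>" by (simp add: vol_def)
  finally show ?thesis .
qed

text \<open>The determinant is nonnegative far out. Were it negative at z, it would vanish at some y
  \<ge> z > E, and y would be a fibre eigenvalue beyond E.\<close>

lemma fib_det_nonneg_above:
  assumes E: "18 \<le> E" and none: "\<And>z. E < z \<Longrightarrow> 9 - s * (z - 9) \<notin> sigma_disc_fib \<gamma> \<mu> k" and z: "E < z"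
  shows "0 \<le> fib_det \<gamma> \<mu> k z"
proof (rule ccontr)
  assume neg: "\<not> 0 \<le> fib_det \<gamma> \<mu> k z"
  have z18: "18 < z" using E z by simp
  \<comment> \<open>The loop integral decreases in its argument, so at b the linear term outweighs
    the two others.\<close>
  define b where "b = z + \<bar>shifted_w1 \<gamma> k\<bar> + \<mu>\<^sup>2 / 2 * loop_int k z"
  have loop_int_mono: "loop_int k b \<le> loop_int k z" if "z \<le> b" for b
    unfolding loop_int_def
  proof (rule integral_mono)
    show "integrable T3 (\<lambda>t. 1 / (b - shifted_w2 k t))" "integrable T3 (\<lambda>t. 1 / (z - shifted_w2 k t))"
      using that z18 by (auto intro!: integrable_loop_int)
    show "1 / (b - shifted_w2 k t) \<le> 1 / (z - shifted_w2 k t)" for t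
      using that z18 shifted_w2_le_18[of k t] by (intro frac_le) auto
  qed
  have zb: "z \<le> b" using loop_int_nonneg[OF z18, of k] by (simp add: b_def)
  have "\<mu>\<^sup>2 / 2 * loop_int k b \<le> \<mu>\<^sup>2 / 2 * loop_int k z" by (intro mult_left_mono loop_int_mono zb) simp
  then have pos: "0 \<le> fib_det \<gamma> \<mu> k b" using z18 by (simp add: fib_det_def b_def)
  have cont: "continuous_on {z..b} (loop_int k)"
  proof (rule lipschitz_on_continuous_on)
    show "(vol / (z - 18)\<^sup>2)-lipschitz_on {z..b} (loop_int k)"
      unfolding lipschitz_on_def dist_real_def using loop_int_lipschitz[OF z18] by (auto simp: vol_nonneg)
  qed
  have "continuous_on {z..b} (fib_det \<gamma> \<mu> k)"
    unfolding fib_det_def[abs_def] by (intro continuous_intros cont)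
  then obtain y where y: "z \<le> y" "y \<le> b" "fib_det \<gamma> \<mu> k y = 0"
    using IVT'[of "fib_det \<gamma> \<mu> k" z 0 b] neg pos zb by auto
  have "9 - s * (y - 9) \<in> sigma_disc_fib \<gamma> \<mu> k"
    by (rule fib_det_zero_in_spectrum) (use y z18 in auto)
  then show False using none[of y] y z by auto
qed

lemma AE_shifted_w2_less: "AE p in T3. shifted_w2 k p < 18"
  using AE_gap_pos
proof (rule eventually_mono)
  fix p assume "0 < gap p" then show "shifted_w2 k p < 18" using shifted_w2_le[of k p] gap_nonneg[of k] by linarith
qed

text \<open>The edge itself is never attained: an eigenvalue there forces the determinant at \<open>18\<close> to
  vanish, hence \<open>k = kcrit\<close>, but the eigenvector is then not square integrable.\<close>

lemma edge_not_maximal: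
  assumes k: "k \<in> cube3" and mu: "\<mu> \<noteq> 0" and ev: "9 - s * 9 \<in> sigma_disc_fib \<gamma> \<mu> k"
    and D: "\<And>z. 18 < z \<Longrightarrow> 0 \<le> fib_det \<gamma> \<mu> kcrit z"
  shows False
proof -
  have w: "w2 k p - (9 - s * 9) = s * (18 - shifted_w2 k p)" for p using w2_minus[of k p 18] by simp
  have ne: "AE p in T3. w2 k p \<noteq> 9 - s * 9"
    using AE_shifted_w2_less[of k]
  proof (rule eventually_mono)
    fix p assume "shifted_w2 k p < 18"
    then show "w2 k p \<noteq> 9 - s * 9" using w[of p] s by auto
  qed
  note fe = fibre_eigenvalue_at_edge[OF ev ne mu]
  have "(\<lambda>p. (1 / (w2 k p - (9 - s * 9)))\<^sup>2) = (\<lambda>p. (1 / (18 - shifted_w2 k p))\<^sup>2)"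
    unfolding w by (simp add: power_divide power_mult_distrib power2_eq_square fun_eq_iff)
  then have i2: "integrable T3 (\<lambda>p. (1 / (18 - shifted_w2 k p))\<^sup>2)" using fe(1) by simp
  have m: "(\<lambda>p. 1 / (18 - shifted_w2 k p)) \<in> borel_measurable T3" by measurable
  have i1: "integrable T3 (\<lambda>p. 1 / (18 - shifted_w2 k p))"
    by (rule T3.L2r_integrable) (use i2 m in \<open>simp add: L2r_def\<close>)
  define J where "J = (LINT p|T3. 1 / (18 - shifted_w2 k p))"
  have "(LINT p|T3. 1 / (w2 k p - (9 - s * 9))) = s * J"
    unfolding w inverse_s_mult J_def by (rule Bochner_Integration.integral_mult_right_zero)
  then have "w1 \<gamma> k - (9 - s * 9) = \<mu>\<^sup>2 / 2 * (s * J)" using fe(2) by simp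
  moreover have "w1 \<gamma> k - (9 - s * 9) = s * (18 - shifted_w1 \<gamma> k)" using s by (auto simp: shifted_w1_w1)
  ultimately have "s * (18 - shifted_w1 \<gamma> k - \<mu>\<^sup>2 / 2 * J) = 0" by (simp add: algebra_simps)
  then have zero: "18 - shifted_w1 \<gamma> k = \<mu>\<^sup>2 / 2 * J" using s by auto
  \<comment> \<open>The integrand of J is integrable only thanks to the eigenvector, and it
    dominates the integrands for all z > 18.\<close>
  have lim: "(\<lambda>n. loop_int k (18 + 1 / real (Suc n))) \<longlonglongrightarrow> J"
    unfolding loop_int_def J_def
  proof (rule integral_dominated_convergence[OF m _ i1])
    show "(\<lambda>t. 1 / (18 + 1 / real (Suc i) - shifted_w2 k t)) \<in> borel_measurable T3" for i by measurable
    show "AE t in T3. (\<lambda>i. 1 / (18 + 1 / real (Suc i) - shifted_w2 k t)) \<longlonglongrightarrow> 1 / (18 - shifted_w2 k t)"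
      using AE_shifted_w2_less[of k]
    proof (rule eventually_mono)
      fix t assume v: "shifted_w2 k t < 18"
      have "(\<lambda>i. 18 + 1 / real (Suc i) - shifted_w2 k t) \<longlonglongrightarrow> 18 + 0 - shifted_w2 k t"
        by (intro tendsto_intros LIMSEQ_Suc lim_1_over_n)
      then show "(\<lambda>i. 1 / (18 + 1 / real (Suc i) - shifted_w2 k t)) \<longlonglongrightarrow> 1 / (18 - shifted_w2 k t)"
        using v by (intro tendsto_divide tendsto_const) auto
    qed
    show "AE t in T3. norm (1 / (18 + 1 / real (Suc i) - shifted_w2 k t)) \<le> 1 / (18 - shifted_w2 k t)" for i
      using AE_shifted_w2_less[of k]
    proof (rule eventually_mono)
      fix t assume "shifted_w2 k t < 18"
      then show "norm (1 / (18 + 1 / real (Suc i) - shifted_w2 k t)) \<le> 1 / (18 - shifted_w2 k t)"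
      proof -
        assume v: "shifted_w2 k t < 18"
        have le: "18 - shifted_w2 k t \<le> 18 + 1 / real (Suc i) - shifted_w2 k t" by simp
        then have "0 < 18 + 1 / real (Suc i) - shifted_w2 k t" using v by linarith
        then have "norm (1 / (18 + 1 / real (Suc i) - shifted_w2 k t)) = 1 / (18 + 1 / real (Suc i) - shifted_w2 k t)" by simp
        then show ?thesis using le v by (simp only:) (rule frac_le, auto)
      qed
    qed
  qed
  \<comment> \<open>This combines \<open>fib_det_ge\<close> with the nonnegative determinant at
    \<open>kcrit\<close>. In the limit the right side is 0 by \<open>zero\<close>, so
    \<open>gap k\<close> vanishes.\<close>
  have le: "gap k \<le> 18 + 1 / real (Suc n) - shifted_w1 \<gamma> k - \<mu>\<^sup>2 / 2 * loop_int k (18 + 1 / real (Suc n))" for n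
    using fib_det_ge[of "18 + 1 / real (Suc n)" k \<gamma> \<mu>] D[of "18 + 1 / real (Suc n)"] k by (simp add: fib_det_def)
  have "(\<lambda>n. 18 + 1 / real (Suc n) - shifted_w1 \<gamma> k - \<mu>\<^sup>2 / 2 * loop_int k (18 + 1 / real (Suc n)))
      \<longlonglongrightarrow> 18 + 0 - shifted_w1 \<gamma> k - \<mu>\<^sup>2 / 2 * J"
    by (intro tendsto_intros lim LIMSEQ_Suc lim_1_over_n)
  then have "gap k \<le> 18 + 0 - shifted_w1 \<gamma> k - \<mu>\<^sup>2 / 2 * J"
    by (rule LIMSEQ_le_const) (use le in blast)
  then have "gap k = 0" using zero gap_nonneg[of k] by simp
  then have "k = kcrit" using gap_zero_imp k by blast
  then show False using i2 not_integrable_inverse_square_kcrit by simp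
qed

lemma integrable_gap_kernel:
  "integrable T3T3 (\<lambda>x. 1 / (gap (fst x) * gap (snd x)))"
  using integrable_tensor[OF integrable_inverse_gap integrable_inverse_gap] by simp

text \<open>The number 6 - 6 s + s \<gamma> is 18 minus \<open>shifted_w1 \<gamma> kcrit\<close>:
  \<gamma> at the left edge and 12 - \<gamma> at the right one. The first alternative is coupling
  below the threshold, where d is constant; the second is an attained extremal fibre eigenvalue,
  where d is \<open>gap\<close>. For either choice \<open>fin\<close> asks that the weighted squared
  kernel be bounded by a multiple of 1 / (gap(k) gap(p)).\<close>

theorem finite_disc_spectrum_beyond:
  assumes E: "18 \<le> E" and mu: "\<mu> > 0"
    and cases: "(E = 18 \<and> \<mu>\<^sup>2 / 2 * I00 < 6 - 6 * s + s * \<gamma>) \<or>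
      ((\<exists>k\<in>cube3. 9 - s * (E - 9) \<in> sigma_disc_fib \<gamma> \<mu> k) \<and>
       (\<forall>z>E. \<forall>k\<in>cube3. 9 - s * (z - 9) \<notin> sigma_disc_fib \<gamma> \<mu> k))"
  shows "finite {z. E < z \<and> 9 - s * (z - 9) \<in> sigma_disc_A \<gamma> \<mu>}"
proof -
  have fin: "finite {z. E < z \<and> 9 - s * (z - 9) \<in> sigma_disc_A \<gamma> \<mu>}"
    if d: "d \<in> borel_measurable T3" "\<And>k. 0 \<le> d k" "\<And>k. d k \<le> B" "AE k in T3. 0 < d k"
      and C: "AE x in T3T3. (1 / (E - shifted_w2 (fst x) (snd x)))\<^sup>2 / (d (fst x) * d (snd x)) \<le> C * (1 / (gap (fst x) * gap (snd x)))"
      and low: "\<And>z k. E < z \<Longrightarrow> k \<in> cube3 \<Longrightarrow> d k \<le> fib_det \<gamma> \<mu> k z" for d B C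
  proof (rule finite_eigenvalues_above[where u = "shifted_w1 \<gamma>" and m = "- s * \<mu>", OF E shifted_w1_measurable shifted_w1_bound d])
    note [measurable] = d(1)
    show "integrable T3T3 (\<lambda>x. (1 / (E - shifted_w2 (fst x) (snd x)))\<^sup>2 / (d (fst x) * d (snd x)))"
    proof (rule Bochner_Integration.integrable_bound)
      show "integrable T3T3 (\<lambda>x. C * (1 / (gap (fst x) * gap (snd x))))"
        by (rule Bochner_Integration.integrable_mult_right[OF integrable_gap_kernel])
      show "AE x in T3T3. norm ((1 / (E - shifted_w2 (fst x) (snd x)))\<^sup>2 / (d (fst x) * d (snd x)))
          \<le> norm (C * (1 / (gap (fst x) * gap (snd x))))"
        using C
      proof (rule eventually_mono)
        fix x assume le: "(1 / (E - shifted_w2 (fst x) (snd x)))\<^sup>2 / (d (fst x) * d (snd x)) \<le> C * (1 / (gap (fst x) * gap (snd x)))"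
        have nn: "0 \<le> (1 / (E - shifted_w2 (fst x) (snd x)))\<^sup>2 / (d (fst x) * d (snd x))" using d(2) by simp
        show "norm ((1 / (E - shifted_w2 (fst x) (snd x)))\<^sup>2 / (d (fst x) * d (snd x)))
          \<le> norm (C * (1 / (gap (fst x) * gap (snd x))))"
          unfolding real_norm_def abs_of_nonneg[OF nn] by (rule order_trans[OF le abs_ge_self])
      qed
    qed measurable
    have m2: "(- s * \<mu>)\<^sup>2 = \<mu>\<^sup>2" using s by auto
    show "d k \<le> z - shifted_w1 \<gamma> k - (- s * \<mu>)\<^sup>2 / 2 * loop_int k z" if "E < z" "k \<in> cube3" for z k
      using low[OF that] unfolding fib_det_def m2 .
    show "E < l \<and> (\<exists>f F. real_eigen (shifted_w1 \<gamma>) (- s * \<mu>) l f F)"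
      if "l \<in> {z. E < z \<and> 9 - s * (z - 9) \<in> sigma_disc_A \<gamma> \<mu>}" for l
      using that A_real_eigen by auto
  qed
  from cases show ?thesis
  proof
    assume *: "E = 18 \<and> \<mu>\<^sup>2 / 2 * I00 < 6 - 6 * s + s * \<gamma>"
    \<comment> \<open>A lower bound of the determinant for all k in the cube and z > 18, by
      \<open>loop_int_le_I00\<close>.\<close>
    define c where "c = 6 - 6 * s + s * \<gamma> - \<mu>\<^sup>2 / 2 * I00"
    have c: "0 < c" using * by (simp add: c_def)
    show ?thesis
    proof (rule fin[of "\<lambda>_. c" c "1 / (4 * c\<^sup>2)"])
      have "AE x in T3T3. 0 < gap (fst x) \<and> 0 < gap (snd x)"
      proof (rule T3T3.AE_pair_measure)
        show "{x \<in> space T3T3. 0 < gap (fst x) \<and> 0 < gap (snd x)} \<in> sets T3T3" by measurable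
        show "AE x in T3. AE y in T3. 0 < gap (fst (x, y)) \<and> 0 < gap (snd (x, y))"
          using AE_gap_pos by (auto elim!: eventually_mono)
      qed
      then show "AE x in T3T3. (1 / (E - shifted_w2 (fst x) (snd x)))\<^sup>2 / (c * c)
          \<le> 1 / (4 * c\<^sup>2) * (1 / (gap (fst x) * gap (snd x)))"
      proof eventually_elim
        case (elim x)
        define a b where "a = gap (fst x)" and "b = gap (snd x)"
        have ab: "0 < a" "0 < b" using elim by (auto simp: a_def b_def)
        have v: "a + b \<le> E - shifted_w2 (fst x) (snd x)"
          using shifted_w2_le[of "fst x" "snd x"] * by (simp add: a_def b_def)
        have "(1 / (E - shifted_w2 (fst x) (snd x)))\<^sup>2 \<le> (1 / (a + b))\<^sup>2"
          using v ab by (intro power_mono frac_le) auto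
        \<comment> \<open>The inequality between arithmetic and geometric mean turns the singularity
          of the kernel at the edge into a product.\<close>
        also have "\<dots> \<le> 1 / (4 * (a * b))"
        proof -
          have "4 * (a * b) \<le> (a + b)\<^sup>2" using zero_le_power2[of "a - b"] by (simp add: power2_eq_square algebra_simps)
          then show ?thesis using ab by (simp add: power_divide frac_le)
        qed
        finally have "(1 / (E - shifted_w2 (fst x) (snd x)))\<^sup>2 / (c * c) \<le> 1 / (4 * (a * b)) / (c * c)"
          using c by (intro divide_right_mono) auto
        then show ?case by (simp add: a_def b_def power2_eq_square mult_ac)
      qed
      show "c \<le> fib_det \<gamma> \<mu> k z" if "E < z" "k \<in> cube3" for z k
      proof -
        have "\<mu>\<^sup>2 / 2 * loop_int k z \<le> \<mu>\<^sup>2 / 2 * I00"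
          using that * by (intro mult_left_mono loop_int_le_I00) auto
        then show ?thesis using that * gap_nonneg[of k] by (simp add: c_def fib_det_def shifted_w1_def)
      qed
    qed (use c in auto)
  next
    assume **: "(\<exists>k\<in>cube3. 9 - s * (E - 9) \<in> sigma_disc_fib \<gamma> \<mu> k) \<and>
       (\<forall>z>E. \<forall>k\<in>cube3. 9 - s * (z - 9) \<notin> sigma_disc_fib \<gamma> \<mu> k)"
    have D: "0 \<le> fib_det \<gamma> \<mu> kcrit z" if "E < z" for z
      by (rule fib_det_nonneg_above[OF E _ that]) (use ** cube3_kcrit in blast)
    \<comment> \<open>If E were 18, the attained fibre eigenvalue would lie on the edge, which
      \<open>edge_not_maximal\<close> excludes.\<close>
    have E18: "18 < E"
    proof (rule ccontr)
      assume "\<not> 18 < E"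
      then have e: "E = 18" using E by simp
      then obtain k where "k \<in> cube3" "9 - s * 9 \<in> sigma_disc_fib \<gamma> \<mu> k" using ** by auto
      then show False using edge_not_maximal[of k \<mu> \<gamma>] D mu e by auto
    qed
    show ?thesis
    proof (rule fin[of gap 6 "(1 / (E - 18))\<^sup>2"])
      have "(1 / (E - shifted_w2 (fst x) (snd x)))\<^sup>2 / (gap (fst x) * gap (snd x))
          \<le> (1 / (E - 18))\<^sup>2 * (1 / (gap (fst x) * gap (snd x)))" for x
      proof -
        have "(1 / (E - shifted_w2 (fst x) (snd x)))\<^sup>2 \<le> (1 / (E - 18))\<^sup>2"
          using inverse_z_shifted_w2_bounds[OF E18, of "fst x" "snd x"] by (intro power_mono) auto
        then show ?thesis using gap_nonneg by (simp add: divide_right_mono)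
      qed
      then show "AE x in T3T3. (1 / (E - shifted_w2 (fst x) (snd x)))\<^sup>2 / (gap (fst x) * gap (snd x))
          \<le> (1 / (E - 18))\<^sup>2 * (1 / (gap (fst x) * gap (snd x)))" by (intro AE_I2)
      show "gap k \<le> fib_det \<gamma> \<mu> k z" if "E < z" "k \<in> cube3" for z k
        using fib_det_ge[of z k \<gamma> \<mu>] D[OF that(1)] that E by simp
    qed (use gap_nonneg gap_le AE_gap_pos in auto)
  qed
qed

end

text \<open>Both thresholds have this shape, with a = \<gamma> for \<open>mu_l\<close> and a = 12 -
  \<gamma> for \<open>mu_r\<close>.\<close>

lemma below_threshold:
  assumes "0 < \<mu>" "\<mu> < sqrt (2 * a) * I00 powr (-1/2)"
  shows "\<mu>\<^sup>2 / 2 * I00 < a"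
proof -
  \<comment> \<open>If \<open>I00\<close> were 0, its power would be 0 by convention and the
    threshold could not exceed \<mu>.\<close>
  have I: "0 < I00"
    using assms L.I00_nonneg by (cases "I00 = 0") auto
  have p: "I00 powr (-1/2) = 1 / sqrt I00"
    using I by (simp add: powr_minus_divide powr_half_sqrt)
  \<comment> \<open>\<open>sqrt\<close> is extended to negative arguments as an odd function, so a
    nonpositive a would give a nonpositive threshold.\<close>
  have a: "0 < 2 * a"
  proof (rule ccontr)
    assume "\<not> 0 < 2 * a"
    then have "sqrt (2 * a) \<le> 0" by simp
    then have "sqrt (2 * a) * I00 powr (-1/2) \<le> 0" by (simp add: mult_nonpos_nonneg)
    then show False using assms by linarith
  qed
  have "\<mu>\<^sup>2 < (sqrt (2 * a) / sqrt I00)\<^sup>2"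
    using assms unfolding p by (intro power_strict_mono) auto
  also have "\<dots> = 2 * a / I00" using a I by (simp add: power_divide)
  finally show ?thesis using I by (simp add: field_simps)
qed

theorem theorem6p4:
  fixes \<gamma> \<mu> :: real
  assumes "\<mu> > 0"
  shows "((\<gamma> \<ge> 12 \<or> (\<gamma> < 12 \<and> \<mu> \<noteq> mu_r \<gamma>)) \<longrightarrow>
            (\<forall>E2. is_E2 \<gamma> \<mu> E2 \<longrightarrow> finite (sigma_disc_A \<gamma> \<mu> \<inter> {E2<..}))) \<and>
         ((\<gamma> \<le> 0 \<or> (\<gamma> > 0 \<and> \<mu> \<noteq> mu_l \<gamma>)) \<longrightarrow>
            (\<forall>E1. is_E1 \<gamma> \<mu> E1 \<longrightarrow> finite (sigma_disc_A \<gamma> \<mu> \<inter> {..<E1})))"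
proof (intro conjI impI allI)
  fix E assume g: "\<gamma> \<ge> 12 \<or> (\<gamma> < 12 \<and> \<mu> \<noteq> mu_r \<gamma>)" and E: "is_E2 \<gamma> \<mu> E"
  \<comment> \<open>For s = -1 the map 9 - s (z - 9) is the identity, so E is used as it
    stands.\<close>
  have "18 \<le> E \<and> ((E = 18 \<and> \<mu>\<^sup>2 / 2 * I00 < 6 - 6 * (-1) + (-1) * \<gamma>) \<or>
      ((\<exists>k\<in>cube3. 9 - (-1) * (E - 9) \<in> sigma_disc_fib \<gamma> \<mu> k) \<and>
       (\<forall>z>E. \<forall>k\<in>cube3. 9 - (-1) * (z - 9) \<notin> sigma_disc_fib \<gamma> \<mu> k)))"
  proof (cases "\<gamma> \<ge> 12 \<or> (\<gamma> < 12 \<and> \<mu> > mu_r \<gamma>)")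
    case True
    then have "is_max (Lam \<gamma> \<mu> \<inter> {18..}) E" using E by (simp add: is_E2_def)
    then have m: "E \<in> Lam \<gamma> \<mu>" "18 \<le> E" "\<And>z. z \<in> Lam \<gamma> \<mu> \<Longrightarrow> 18 \<le> z \<Longrightarrow> z \<le> E"
      by (auto simp: is_max_def)
    have "\<forall>z>E. \<forall>k\<in>cube3. z \<notin> sigma_disc_fib \<gamma> \<mu> k"
      using m(2,3) by (force simp: Lam_def)
    then show ?thesis using m(1,2) by (auto simp: Lam_def)
  next
    case False
    then have "E = 18" "\<gamma> < 12" "\<mu> < mu_r \<gamma>" using E g by (auto simp: is_E2_def)
    then show ?thesis using below_threshold[of \<mu> "12 - \<gamma>"] assms by (simp add: mu_r_def)
  qed
  then have "finite {z. E < z \<and> 9 - (-1) * (z - 9) \<in> sigma_disc_A \<gamma> \<mu>}"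
    using R.finite_disc_spectrum_beyond assms by blast
  moreover have "{z. E < z \<and> 9 - (-1) * (z - 9) \<in> sigma_disc_A \<gamma> \<mu>} = sigma_disc_A \<gamma> \<mu> \<inter> {E<..}"
    by auto
  ultimately show "finite (sigma_disc_A \<gamma> \<mu> \<inter> {E<..})" by simp
next
  fix E assume g: "\<gamma> \<le> 0 \<or> (\<gamma> > 0 \<and> \<mu> \<noteq> mu_l \<gamma>)" and E: "is_E1 \<gamma> \<mu> E"
  \<comment> \<open>For s = 1 the bound E is carried to 18 - E, and the minimum below 0 becomes a
    maximum above 18.\<close>
  have "18 \<le> 18 - E \<and> ((18 - E = 18 \<and> \<mu>\<^sup>2 / 2 * I00 < 6 - 6 * 1 + 1 * \<gamma>) \<or>
      ((\<exists>k\<in>cube3. 9 - 1 * (18 - E - 9) \<in> sigma_disc_fib \<gamma> \<mu> k) \<and>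
       (\<forall>z>18 - E. \<forall>k\<in>cube3. 9 - 1 * (z - 9) \<notin> sigma_disc_fib \<gamma> \<mu> k)))"
  proof (cases "\<gamma> \<le> 0 \<or> (\<gamma> > 0 \<and> \<mu> > mu_l \<gamma>)")
    case True
    then have "is_min (Lam \<gamma> \<mu> \<inter> {..0}) E" using E by (simp add: is_E1_def)
    then have m: "E \<in> Lam \<gamma> \<mu>" "E \<le> 0" "\<And>z. z \<in> Lam \<gamma> \<mu> \<Longrightarrow> z \<le> 0 \<Longrightarrow> E \<le> z"
      by (auto simp: is_min_def)
    have "18 - z \<notin> sigma_disc_fib \<gamma> \<mu> k" if "18 - E < z" "k \<in> cube3" for z k
      using m(2) m(3)[of "18 - z"] that by (auto simp: Lam_def)
    then show ?thesis using m(1,2) by (auto simp: Lam_def)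
  next
    case False
    then have "E = 0" "\<gamma> > 0" "\<mu> < mu_l \<gamma>" using E g by (auto simp: is_E1_def)
    then show ?thesis using below_threshold[of \<mu> \<gamma>] assms by (simp add: mu_l_def)
  qed
  then have f: "finite {z. 18 - E < z \<and> 9 - 1 * (z - 9) \<in> sigma_disc_A \<gamma> \<mu>}"
    using L.finite_disc_spectrum_beyond assms by blast
  have "sigma_disc_A \<gamma> \<mu> \<inter> {..<E} \<subseteq> (\<lambda>z. 18 - z) ` {z. 18 - E < z \<and> 9 - 1 * (z - 9) \<in> sigma_disc_A \<gamma> \<mu>}"
  proof
    fix x assume "x \<in> sigma_disc_A \<gamma> \<mu> \<inter> {..<E}"
    then show "x \<in> (\<lambda>z. 18 - z) ` {z. 18 - E < z \<and> 9 - 1 * (z - 9) \<in> sigma_disc_A \<gamma> \<mu>}"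
      by (intro image_eqI[of _ _ "18 - x"]) auto
  qed
  then show "finite (sigma_disc_A \<gamma> \<mu> \<inter> {..<E})" using f by (rule finite_subset[OF _ finite_imageI])
qed

end
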